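(* Let $(F,Y,\mathbf 1,D,\bar D)$ be a translation covariant full prevertex algebra. Assume that (FL) for any $a_1,a_2,a_3\in F$ and $u\in F^\vee$ there exists $\mu\in\mathrm{GCor}_2$ such that $$u(Y(a_1,\underline z_1)Y(a_2,\underline z_2)a_3)=\mu|_{|z_1|>|z_2|},\qquad u(Y(a_2,\underline z_2)Y(a_1,\underline z_1)a_3)=\mu|_{|z_2|>|z_1|},$$ and that the spectrum of $F$ is bounded below, that is, there exists $N\in\mathbb R$ such that $F_{h,\bar h}=0$ for any $h\le N$ or $\bar h\le N$. Then $(F,Y,\mathbf 1)$ is a full vertex algebra.
   Context: **Conventions.** $z,\bar z$ are independent formal variables, $\underline z=(z,\bar z)$, and $|z|$ stands for $z\bar z$ in exponents, so $|z|^r=z^r\bar z^r$. For a vector space $V$, $V[[z,\bar z,|z|^{\mathbb R}]]$ is the set of formal sums $\sum_{r,s\in\mathbb R}a_{r,s}z^r\bar z^s$ with countable support and $a_{r,s}=0$ unless $r-s\in\mathbb Z$; $V((z,\bar z,|z|^{\mathbb R}))$ is the subspace of those for which there is $N$ with $a_{r,s}=0$ unless $r,s\ge N$. **Function spaces.** $F_{0,1,\infty}$ is the space of real analytic functions $f:\mathbb CP^1\setminus\{0,1,\infty\}\to\mathbb C$ with conformal singularities at $0,1,\infty$: for each $\alpha\in\{0,1,\infty\}$ and each holomorphic chart $\chi$ at $\alpha$ with $\chi(\alpha)=0$ there is a series in $\mathbb C((p,\bar p,|p|^{\mathbb R}))$ converging absolutely and compactly to $f\circ\chi^{-1}(p)$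 in some punctured disc around $p=0$. For $\chi\in\{p,1/p,1-1/p\}$ ($p$ the standard coordinate) this uniquely determined series is denoted $j(\chi,f)$. $\mathrm{GCor}_2$ is the complex span of the functions on $Y_2=\{(z_1,z_2)\in\mathbb C^2: z_1\ne z_2, z_1\ne0,z_2\neq 0\}$ $$\mu=z_1^{\alpha_1}z_2^{\alpha_2}(z_1-z_2)^{\alpha_{12}}\bar z_1^{\beta_1}\bar z_2^{\beta_2}(\bar z_1-\bar z_2)^{\beta_{12}}f(z_2/z_1),$$ $f\in F_{0,1,\infty}$, $\alpha$'s, $\beta$'s real with $\alpha_1-\beta_1,\alpha_2-\beta_2,\alpha_{12}-\beta_{12}\in\mathbb Z$. Its expansions, extended linearly, are: $\mu|_{|z_1|>|z_2|}$: expand $(z_1-z_2)^{\alpha_{12}}(\bar z_1-\bar z_2)^{\beta_{12}}$ binomially in non-negative powers of $z_2/z_1,\bar z_2/\bar z_1$ and replace $f(z_2/z_1)$ by $j(p,f)$ at $p=z_2/z_1$; $\mu|_{|z_2|>|z_1|}$: expand in non-negative powers of $z_1/z_2,\bar z_1/\bar z_2$ (with sign $(-1)^{\alpha_{12}-\beta_{12}}$) and replace $f(z_2/z_1)$ by $j(p^{-1},f)$ at $p=z_1/z_2$; $\mu|_{|z_2|>|z_1-z_2|}$: put $z_1=z_2+z_0$, expand $(z_2+z_0)^{\alpha_1}(\bar z_2+\bar z_0)^{\beta_1}$ in non-negative powers of $z_0/z_2,\bar z_0/\bar z_2$ and replace $f(z_2/z_1)$ by $j(1-p^{-1},f)$ at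 $p=-z_0/z_2$. **Full prevertex algebra.** An $\mathbb R^2$-graded complex vector space $F=\bigoplus_{h,\bar h\in\mathbb R}F_{h,\bar h}$ with a linear map $Y(-,\underline z):F\to\mathrm{End}(F)[[z,\bar z,|z|^{\mathbb R}]]$, $Y(a,\underline z)=\sum_{r,s\in\mathbb R}a(r,s)z^{-r-1}\bar z^{-s-1}$, and $\mathbf 1\in F_{0,0}$ such that: (PV1) for all $a,b$ there is $N$ with $a(r,s)b=0$ if $r\ge N$ or $s\ge N$; (PV2) $F_{h,\bar h}=0$ unless $h-\bar h\in\mathbb Z$; (PV3) $Y(a,\underline z)\mathbf 1\in F[[z,\bar z]]$ with constant term $a$; (PV4) $Y(\mathbf 1,\underline z)=\mathrm{id}$; (PV5) $F_{h,\bar h}(r,s)F_{h',\bar h'}\subset F_{h+h'-r-1,\bar h+\bar h'-s-1}$. It is translation covariant, with $D,\bar D\in\mathrm{End}\,F$, if $D\mathbf 1=\bar D\mathbf 1=0$, $[D,Y(a,\underline z)]=\frac{d}{dz}Y(a,\underline z)$ and $[\bar D,Y(a,\underline z)]=\frac{d}{d\bar z}Y(a,\underline z)$ for all $a$. Put $F^\vee=\bigoplus F_{h,\bar h}^*$. **Full vertex algebra.** A full prevertex algebra such that for all $a,b,c\in F$, $u\in F^\vee$ there is $\mu\in\mathrm{GCor}_2$ with $u(Y(a,\underline z_1)Y(b,\underline z_2)c)=\mu|_{|z_1|>|z_2|}$, $u(Y(Y(a,\underline z_0)b,\underline z_2)c)=\mu|_{|z_2|>|z_1-z_2|}$ ($z_0=z_1-z_2$),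 $u(Y(b,\underline z_2)Y(a,\underline z_1)c)=\mu|_{|z_2|>|z_1|}$. *)

theory Defs
  imports "HOL-Complex_Analysis.Complex_Analysis" "HOL-Library.Function_Algebras"
begin

section \<open>Formal series with real exponents and conformal singularities\<close>

text \<open>\<open>s (r, t)\<close> is the coefficient of \<open>z\<^sup>r zbar\<^sup>t\<close>.\<close>

type_synonym 'v rseries = "real \<times> real \<Rightarrow> 'v"

text \<open>The spaces \<open>V[[z,zbar,|z|\<^sup>R]]\<close> and \<open>V((z,zbar,|z|\<^sup>R))\<close>.\<close>

definition rpower_series :: "'v::zero rseries set" where
  "rpower_series = {s. countable {x. s x \<noteq> 0} \<and> (\<forall>r t. s (r, t) \<noteq> 0 \<longrightarrow> r - t \<in> \<int>)}"

definition rlaurent_series :: "'v::zero rseries set" where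
  "rlaurent_series =
     {s \<in> rpower_series. \<exists>N. \<forall>r t. s (r, t) \<noteq> 0 \<longrightarrow> r \<ge> N \<and> t \<ge> N}"

text \<open>The single-valued function \<open>z\<^sup>a zbar\<^sup>b = z\<^sup>(\<^sup>a\<^sup>-\<^sup>b\<^sup>) (z zbar)\<^sup>b\<close> on \<open>z \<noteq> 0\<close>,
  meaningful only when \<open>a - b\<close> is an integer.\<close>

definition zpow :: "real \<Rightarrow> real \<Rightarrow> complex \<Rightarrow> complex" where
  "zpow a b z = z powi \<lfloor>a - b\<rfloor> * complex_of_real (((cmod z)\<^sup>2) powr b)"

text \<open>\<open>s\<close> lies in \<open>C((p,pbar,|p|\<^sup>R))\<close> and converges absolutely and compactly to \<open>g\<close> in some
  punctured disc around \<open>0\<close>. Such an \<open>s\<close> is unique if it exists.\<close>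

definition expands_at_0 :: "(complex \<Rightarrow> complex) \<Rightarrow> complex rseries \<Rightarrow> bool" where
  "expands_at_0 g s \<longleftrightarrow> s \<in> rlaurent_series \<and>
     (\<exists>R>0. (\<forall>p\<in>ball 0 R - {0}. (\<lambda>(r, t). norm (s (r, t) * zpow r t p)) summable_on UNIV) \<and>
            (\<forall>K. compact K \<and> K \<subseteq> ball 0 R - {0} \<longrightarrow>
               uniform_limit K (\<lambda>S p. \<Sum>(r, t)\<in>S. s (r, t) * zpow r t p) g
                 (finite_subsets_at_top UNIV)))"

text \<open>Conformal singularity at a finite point \<open>\<alpha>\<close>: \<open>(U, \<phi>)\<close> ranges over the holomorphic charts
  at \<open>\<alpha>\<close> with \<open>\<phi> \<alpha> = 0\<close>; shrinking the disc makes the values of \<^const>\<open>inv_into\<close> outside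
  \<open>\<phi> ` U\<close> irrelevant.\<close>

definition conformal_singularity :: "(complex \<Rightarrow> complex) \<Rightarrow> complex \<Rightarrow> bool" where
  "conformal_singularity g \<alpha> \<longleftrightarrow>
     (\<forall>U \<phi>. open U \<and> \<alpha> \<in> U \<and> \<phi> holomorphic_on U \<and> inj_on \<phi> U \<and> \<phi> \<alpha> = 0 \<longrightarrow>
        (\<exists>s. expands_at_0 (g \<circ> inv_into U \<phi>) s))"

definition real_analytic_on :: "(complex \<Rightarrow> complex) \<Rightarrow> complex set \<Rightarrow> bool" where
  "real_analytic_on f S \<longleftrightarrow>
     (\<forall>z\<in>S. \<exists>a :: nat \<times> nat \<Rightarrow> complex. \<exists>R>0. \<forall>w\<in>ball 0 R.
        ((\<lambda>(m, n). a (m, n) * complex_of_real (Re w ^ m * Im w ^ n)) has_sum f (z + w)) UNIV)"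

text \<open>\<open>CP\<^sup>1 - {0, 1, \<infinity>}\<close> is \<open>- {0, 1}\<close> in the standard coordinate; values at \<open>0\<close> and \<open>1\<close> are
  never used. The charts at \<open>\<infinity>\<close> are exactly \<open>z \<mapsto> \<phi> (1 / z)\<close> with \<open>\<phi>\<close> a chart at \<open>0\<close>.\<close>

definition F01inf :: "(complex \<Rightarrow> complex) set" where
  "F01inf = {f. real_analytic_on f (- {0, 1}) \<and> conformal_singularity f 0 \<and>
                conformal_singularity f 1 \<and> conformal_singularity (\<lambda>w. f (1 / w)) 0}"

text \<open>\<open>is_j \<psi> f s\<close> says \<open>s = j(\<chi>, f)\<close> where \<open>\<psi>\<close> is the inverse of the chart
  \<open>\<chi>\<close>.\<close>

definition is_j :: "(complex \<Rightarrow> complex) \<Rightarrow> (complex \<Rightarrow> complex) \<Rightarrow> complex rseries \<Rightarrow> bool" where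
  "is_j \<psi> f s \<longleftrightarrow> expands_at_0 (f \<circ> \<psi>) s"


section \<open>Generalized two-point correlation functions and their expansions\<close>

definition Y2 :: "(complex \<times> complex) set" where
  "Y2 = {(z1, z2). z1 \<noteq> z2 \<and> z1 \<noteq> 0 \<and> z2 \<noteq> 0}"

text \<open>Functions on \<^const>\<open>Y2\<close> are extended by zero, so that equality of HOL functions is equality
  on \<^const>\<open>Y2\<close>.\<close>

definition gcor_gen ::
  "real \<Rightarrow> real \<Rightarrow> real \<Rightarrow> real \<Rightarrow> real \<Rightarrow> real \<Rightarrow> (complex \<Rightarrow> complex) \<Rightarrow> complex \<times> complex \<Rightarrow> complex"
where
  "gcor_gen \<alpha>1 \<alpha>2 \<alpha>12 \<beta>1 \<beta>2 \<beta>12 f = (\<lambda>(z1, z2).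
     if (z1, z2) \<in> Y2
     then zpow \<alpha>1 \<beta>1 z1 * zpow \<alpha>2 \<beta>2 z2 * zpow \<alpha>12 \<beta>12 (z1 - z2) * f (z2 / z1) else 0)"

definition gcor_data ::
  "real \<Rightarrow> real \<Rightarrow> real \<Rightarrow> real \<Rightarrow> real \<Rightarrow> real \<Rightarrow> (complex \<Rightarrow> complex) \<Rightarrow> bool" where
  "gcor_data \<alpha>1 \<alpha>2 \<alpha>12 \<beta>1 \<beta>2 \<beta>12 f \<longleftrightarrow>
     f \<in> F01inf \<and> \<alpha>1 - \<beta>1 \<in> \<int> \<and> \<alpha>2 - \<beta>2 \<in> \<int> \<and> \<alpha>12 - \<beta>12 \<in> \<int>"

definition GCor2 :: "(complex \<times> complex \<Rightarrow> complex) set" where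
  "GCor2 = module.span (\<lambda>c \<mu> z. c * \<mu> z)
     {gcor_gen \<alpha>1 \<alpha>2 \<alpha>12 \<beta>1 \<beta>2 \<beta>12 f | \<alpha>1 \<alpha>2 \<alpha>12 \<beta>1 \<beta>2 \<beta>12 f.
        gcor_data \<alpha>1 \<alpha>2 \<alpha>12 \<beta>1 \<beta>2 \<beta>12 f}"

text \<open>The product of \<open>(1 + \<epsilon> p)\<^sup>a (1 + \<epsilon> pbar)\<^sup>b\<close>, expanded in non-negative powers of \<open>p, pbar\<close>,
  with the series \<open>s\<close>. The sum is finite for \<open>s\<close> in \<^const>\<open>rlaurent_series\<close>.\<close>

definition binom_mult :: "complex \<Rightarrow> real \<Rightarrow> real \<Rightarrow> complex rseries \<Rightarrow> complex rseries" where
  "binom_mult \<epsilon> a b s = (\<lambda>(r, t).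
     \<Sum>(k, l) | s (r - real k, t - real l) \<noteq> 0.
       \<epsilon> ^ (k + l) * complex_of_real ((a gchoose k) * (b gchoose l)) * s (r - real k, t - real l))"

text \<open>Formal series in two pairs of variables: \<open>E (r, s, r', s')\<close> is the coefficient of
  \<open>z1\<^sup>r z1bar\<^sup>s z2\<^sup>r\<^sup>' z2bar\<^sup>s\<^sup>'\<close>, with \<open>z0\<close> in place of \<open>z1\<close> in \<open>gen_exp_0\<close>. The three
  expansions of a generator are a monomial times a series in \<open>z2/z1\<close>, \<open>z1/z2\<close> or \<open>z0/z2\<close> and its
  conjugate, so each is supported on fixed values of \<open>r + r'\<close> and \<open>s + s'\<close>.\<close>

type_synonym rseries2 = "real \<times> real \<times> real \<times> real \<Rightarrow> complex"

text \<open>Region \<open>|z1| > |z2|\<close>: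
  \<open>z1\<^sup>\<alpha>\<^sup>1\<^sup>+\<^sup>\<alpha>\<^sup>1\<^sup>2 z2\<^sup>\<alpha>\<^sup>2 (1 - z2/z1)\<^sup>\<alpha>\<^sup>1\<^sup>2 \<dots> j(p, f)\<close> at \<open>p = z2/z1\<close>.\<close>

definition gen_exp_12 ::
  "real \<Rightarrow> real \<Rightarrow> real \<Rightarrow> real \<Rightarrow> real \<Rightarrow> real \<Rightarrow> complex rseries \<Rightarrow> rseries2" where
  "gen_exp_12 \<alpha>1 \<alpha>2 \<alpha>12 \<beta>1 \<beta>2 \<beta>12 s = (\<lambda>(r1, s1, r2, s2).
     if r1 + r2 = \<alpha>1 + \<alpha>2 + \<alpha>12 \<and> s1 + s2 = \<beta>1 + \<beta>2 + \<beta>12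
     then binom_mult (- 1) \<alpha>12 \<beta>12 s (r2 - \<alpha>2, s2 - \<beta>2) else 0)"

text \<open>Region \<open>|z2| > |z1|\<close>:
  \<open>(-1)\<^sup>\<alpha>\<^sup>1\<^sup>2\<^sup>-\<^sup>\<beta>\<^sup>1\<^sup>2 z1\<^sup>\<alpha>\<^sup>1 z2\<^sup>\<alpha>\<^sup>2\<^sup>+\<^sup>\<alpha>\<^sup>1\<^sup>2 (1 - z1/z2)\<^sup>\<alpha>\<^sup>1\<^sup>2 \<dots> j(1/p, f)\<close> at \<open>p = z1/z2\<close>.\<close>

definition gen_exp_21 ::
  "real \<Rightarrow> real \<Rightarrow> real \<Rightarrow> real \<Rightarrow> real \<Rightarrow> real \<Rightarrow> complex rseries \<Rightarrow> rseries2" where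
  "gen_exp_21 \<alpha>1 \<alpha>2 \<alpha>12 \<beta>1 \<beta>2 \<beta>12 s = (\<lambda>(r1, s1, r2, s2).
     if r1 + r2 = \<alpha>1 + \<alpha>2 + \<alpha>12 \<and> s1 + s2 = \<beta>1 + \<beta>2 + \<beta>12
     then (- 1) powi \<lfloor>\<alpha>12 - \<beta>12\<rfloor> * binom_mult (- 1) \<alpha>12 \<beta>12 s (r1 - \<alpha>1, s1 - \<beta>1) else 0)"

text \<open>Region \<open>|z2| > |z1 - z2|\<close>, \<open>z1 = z2 + z0\<close>:
  \<open>z0\<^sup>\<alpha>\<^sup>1\<^sup>2 z2\<^sup>\<alpha>\<^sup>1\<^sup>+\<^sup>\<alpha>\<^sup>2 (1 + z0/z2)\<^sup>\<alpha>\<^sup>1 \<dots> j(1 - 1/p, f)\<close> at \<open>p = - z0/z2\<close>, where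
  \<open>(-p)\<^sup>r (-pbar)\<^sup>t = (-1)\<^sup>r\<^sup>-\<^sup>t p\<^sup>r pbar\<^sup>t\<close>.\<close>

definition gen_exp_0 ::
  "real \<Rightarrow> real \<Rightarrow> real \<Rightarrow> real \<Rightarrow> real \<Rightarrow> real \<Rightarrow> complex rseries \<Rightarrow> rseries2" where
  "gen_exp_0 \<alpha>1 \<alpha>2 \<alpha>12 \<beta>1 \<beta>2 \<beta>12 s = (\<lambda>(r0, s0, r2, s2).
     if r0 + r2 = \<alpha>1 + \<alpha>2 + \<alpha>12 \<and> s0 + s2 = \<beta>1 + \<beta>2 + \<beta>12
     then binom_mult 1 \<alpha>1 \<beta>1 (\<lambda>(r, t). (- 1) powi \<lfloor>r - t\<rfloor> * s (r, t)) (r0 - \<alpha>12, s0 - \<beta>12)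
     else 0)"

text \<open>The linear extension of an expansion to \<^const>\<open>GCor2\<close>, given by its graph: the span of the
  pairs (generator, expansion of the generator). The inverses of the charts \<open>p\<close>, \<open>1/p\<close>,
  \<open>1 - 1/p\<close> are \<open>q\<close>, \<open>1/q\<close>, \<open>1/(1 - q)\<close>.\<close>

definition pair_span ::
  "((complex \<times> complex \<Rightarrow> complex) \<times> rseries2) set \<Rightarrow> ((complex \<times> complex \<Rightarrow> complex) \<times> rseries2) set"
where
  "pair_span = module.span (\<lambda>c (\<mu>, E). (\<lambda>z. c * \<mu> z, \<lambda>x. c * E x))"

definition has_expansion_12 :: "(complex \<times> complex \<Rightarrow> complex) \<Rightarrow> rseries2 \<Rightarrow> bool" where
  "has_expansion_12 \<mu> E \<longleftrightarrow> (\<mu>, E) \<in> pair_span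
     {(gcor_gen \<alpha>1 \<alpha>2 \<alpha>12 \<beta>1 \<beta>2 \<beta>12 f, gen_exp_12 \<alpha>1 \<alpha>2 \<alpha>12 \<beta>1 \<beta>2 \<beta>12 s)
        | \<alpha>1 \<alpha>2 \<alpha>12 \<beta>1 \<beta>2 \<beta>12 f s.
        gcor_data \<alpha>1 \<alpha>2 \<alpha>12 \<beta>1 \<beta>2 \<beta>12 f \<and> is_j (\<lambda>q. q) f s}"

definition has_expansion_21 :: "(complex \<times> complex \<Rightarrow> complex) \<Rightarrow> rseries2 \<Rightarrow> bool" where
  "has_expansion_21 \<mu> E \<longleftrightarrow> (\<mu>, E) \<in> pair_span
     {(gcor_gen \<alpha>1 \<alpha>2 \<alpha>12 \<beta>1 \<beta>2 \<beta>12 f, gen_exp_21 \<alpha>1 \<alpha>2 \<alpha>12 \<beta>1 \<beta>2 \<beta>12 s)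
        | \<alpha>1 \<alpha>2 \<alpha>12 \<beta>1 \<beta>2 \<beta>12 f s.
        gcor_data \<alpha>1 \<alpha>2 \<alpha>12 \<beta>1 \<beta>2 \<beta>12 f \<and> is_j (\<lambda>q. 1 / q) f s}"

definition has_expansion_0 :: "(complex \<times> complex \<Rightarrow> complex) \<Rightarrow> rseries2 \<Rightarrow> bool" where
  "has_expansion_0 \<mu> E \<longleftrightarrow> (\<mu>, E) \<in> pair_span
     {(gcor_gen \<alpha>1 \<alpha>2 \<alpha>12 \<beta>1 \<beta>2 \<beta>12 f, gen_exp_0 \<alpha>1 \<alpha>2 \<alpha>12 \<beta>1 \<beta>2 \<beta>12 s)
        | \<alpha>1 \<alpha>2 \<alpha>12 \<beta>1 \<beta>2 \<beta>12 f s.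
        gcor_data \<alpha>1 \<alpha>2 \<alpha>12 \<beta>1 \<beta>2 \<beta>12 f \<and> is_j (\<lambda>q. 1 / (1 - q)) f s}"


section \<open>Full prevertex algebras and full vertex algebras\<close>

text \<open>\<open>Y a (r, s)\<close> is the coefficient of \<open>z\<^sup>r zbar\<^sup>s\<close> in \<open>Y(a, z)\<close>, so the mode \<open>a(r, s)\<close> is
  \<open>Y a (-r-1, -s-1)\<close>.\<close>

definition mode :: "('v \<Rightarrow> ('v \<Rightarrow> 'v) rseries) \<Rightarrow> 'v \<Rightarrow> real \<Rightarrow> real \<Rightarrow> 'v \<Rightarrow> 'v" where
  "mode Y a r s = Y a (- r - 1, - s - 1)"

locale full_prevertex_algebra = vector_space smul
  for smul :: "complex \<Rightarrow> 'v::ab_group_add \<Rightarrow> 'v" +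
  fixes F :: "real \<Rightarrow> real \<Rightarrow> 'v set"
    and Y :: "'v \<Rightarrow> ('v \<Rightarrow> 'v) rseries"
    and vac :: 'v
  assumes graded_subspace: "subspace (F h h')"
    and direct_sum: "\<exists>!c :: real \<times> real \<Rightarrow> 'v.
          (\<forall>h h'. c (h, h') \<in> F h h') \<and> finite {x. c x \<noteq> 0} \<and> v = (\<Sum>x | c x \<noteq> 0. c x)"
    and linear_Y_right: "Vector_Spaces.linear smul smul (Y a x)"
    and linear_Y_left: "Vector_Spaces.linear smul smul (\<lambda>a. Y a x b)"
    and Y_series: "Y a \<in> rpower_series"
    and vac_in: "vac \<in> F 0 0"
    and PV1: "\<exists>N. \<forall>r s. r \<ge> N \<or> s \<ge> N \<longrightarrow> mode Y a r s b = 0"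
    and PV2: "h - h' \<notin> \<int> \<Longrightarrow> F h h' = {0}"
    and PV3: "Y a (r, s) vac \<noteq> 0 \<Longrightarrow> r \<in> \<nat> \<and> s \<in> \<nat>" "Y a (0, 0) vac = a"
    and PV4: "Y vac x = (if x = (0, 0) then (\<lambda>b. b) else (\<lambda>b. 0))"
    and PV5: "a \<in> F h h' \<Longrightarrow> b \<in> F k k' \<Longrightarrow>
          mode Y a r s b \<in> F (h + k - r - 1) (h' + k' - s - 1)"

text \<open>The coefficient of \<open>z\<^sup>r zbar\<^sup>s\<close> in the \<open>z\<close>-derivative of \<open>Y(a, z)\<close> is
  \<open>(r + 1) Y a (r + 1, s)\<close>.\<close>

locale translation_covariant_full_prevertex_algebra = full_prevertex_algebra smul F Y vac
  for smul :: "complex \<Rightarrow> 'v::ab_group_add \<Rightarrow> 'v" and F Y vac +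
  fixes D D' :: "'v \<Rightarrow> 'v"
  assumes linear_D: "Vector_Spaces.linear smul smul D"
    and linear_D': "Vector_Spaces.linear smul smul D'"
    and D_vac: "D vac = 0"
    and D'_vac: "D' vac = 0"
    and D_comm: "D (Y a (r, s) b) - Y a (r, s) (D b) =
          smul (complex_of_real (r + 1)) (Y a (r + 1, s) b)"
    and D'_comm: "D' (Y a (r, s) b) - Y a (r, s) (D' b) =
          smul (complex_of_real (s + 1)) (Y a (r, s + 1) b)"

text \<open>The direct sum of the duals of the \<open>F h h'\<close>, as functionals on the whole space: those
  vanishing on all but finitely many homogeneous components.\<close>

definition restricted_dual ::
  "(complex \<Rightarrow> 'v::ab_group_add \<Rightarrow> 'v) \<Rightarrow> (real \<Rightarrow> real \<Rightarrow> 'v set) \<Rightarrow> ('v \<Rightarrow> complex) set" where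
  "restricted_dual smul F = {u. Vector_Spaces.linear smul (*) u \<and>
     finite {(h, h'). \<exists>v\<in>F h h'. u v \<noteq> 0}}"

definition full_locality ::
  "(complex \<Rightarrow> 'v::ab_group_add \<Rightarrow> 'v) \<Rightarrow> (real \<Rightarrow> real \<Rightarrow> 'v set) \<Rightarrow>
   ('v \<Rightarrow> ('v \<Rightarrow> 'v) rseries) \<Rightarrow> bool" where
  "full_locality smul F Y \<longleftrightarrow>
     (\<forall>a1 a2 a3. \<forall>u\<in>restricted_dual smul F. \<exists>\<mu>\<in>GCor2.
        has_expansion_12 \<mu> (\<lambda>(r1, s1, r2, s2). u (Y a1 (r1, s1) (Y a2 (r2, s2) a3))) \<and>
        has_expansion_21 \<mu> (\<lambda>(r1, s1, r2, s2). u (Y a2 (r2, s2) (Y a1 (r1, s1) a3))))"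

definition spectrum_bounded_below :: "(real \<Rightarrow> real \<Rightarrow> 'v::zero set) \<Rightarrow> bool" where
  "spectrum_bounded_below F \<longleftrightarrow> (\<exists>N. \<forall>h h'. h \<le> N \<or> h' \<le> N \<longrightarrow> F h h' = {0})"

locale full_vertex_algebra = full_prevertex_algebra smul F Y vac
  for smul :: "complex \<Rightarrow> 'v::ab_group_add \<Rightarrow> 'v" and F Y vac +
  assumes borcherds: "u \<in> restricted_dual smul F \<Longrightarrow> \<exists>\<mu>\<in>GCor2.
        has_expansion_12 \<mu> (\<lambda>(r1, s1, r2, s2). u (Y a (r1, s1) (Y b (r2, s2) c))) \<and>
        has_expansion_0 \<mu> (\<lambda>(r0, s0, r2, s2). u (Y (Y a (r0, s0) b) (r2, s2) c)) \<and>
        has_expansion_21 \<mu> (\<lambda>(r1, s1, r2, s2). u (Y b (r2, s2) (Y a (r1, s1) c)))"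

end

theory Submission
  imports Defs
begin

text \<open>
  The statement is proved by comparing functions on \<^const>\<open>Y2\<close> through convergent series. A formal
  series in two variables, the second one large, is related to a function by \<open>expands2\<close>: it
  converges absolutely to the function where \<open>0 < |z| < R |w|\<close> for some \<open>R > 0\<close>. Three
  analytic facts are used. The function determines the series (\<open>expands2_unique\<close>), although the
  exponents are real and may be dense. Two functions that are analytic along curves and agree for
  \<open>|z2| < R |z1|\<close> agree on all of \<^const>\<open>Y2\<close> (\<open>curve_analytic_identity\<close>). Each of the three
  expansions of an element \<open>\<mu>\<close> of \<^const>\<open>GCor2\<close> converges to \<open>\<mu>\<close> where the ratio of its variables is
  small, and one in the region \<open>|z2| > |z1 - z2|\<close> exists whenever one for \<open>|z1| > |z2|\<close> does
  (\<open>has_expansion_0_exists\<close>). Given \<open>\<mu>\<close> from locality for \<open>a, b, c, u\<close>, it therefore remains to show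
  that \<open>u (Y(Y(a, z0) b, z2) c)\<close> converges to \<open>\<mu> (z2 + z0, z2)\<close> for \<open>|z0|\<close> small compared with \<open>|z2|\<close>.

  Write \<open>exp(z D)\<close> for \<open>exp(z D + zbar D')\<close>. Translation covariance gives
  \<open>Y(a, z1) exp(z2 D) W(z2) = exp(z2 D) Y(a, z1 - z2) W(z2)\<close>. Because the spectrum is bounded
  below, \<open>u D\<^sup>n D'\<^sup>m = 0\<close> if \<open>n\<close> or \<open>m\<close> is large, so \<open>u exp(z2 D)\<close> is a polynomial in \<open>z2\<close> and its
  conjugate; this makes the identity one of convergent series (\<open>expands2_exp_translate\<close>).

  Skew symmetry, \<open>u (Y(b, z) a) = u (exp(z D) Y(a, - z) b)\<close>, comes from locality with the vacuum as
  third vector. As \<open>Y(b, z2) vac = exp(z2 D) b\<close>, the two orders of the product are, in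
  their regions, explicit finite sums, one in \<open>z1 - z2\<close> and \<open>z2\<close>, the other in \<open>z2 - z1\<close> and \<open>z1\<close>.
  By the identity theorem the first sum equals the correlation function everywhere, hence the two
  sums agree for small \<open>z1\<close>, and \<open>z1 \<rightarrow> 0\<close> gives skew symmetry of \<open>b\<close> and \<open>a\<close>.

  For associativity let \<open>\<nu>\<^sub>n\<^sub>m\<close> be the function that locality provides for \<open>a, c, b\<close> and
  \<open>u D\<^sup>n D'\<^sup>m / (n! m!)\<close>, and put \<open>S(z1, z2) = \<Sum> z2\<^sup>n z2bar\<^sup>m \<nu>\<^sub>n\<^sub>m(z1 - z2, - z2)\<close>. Skew symmetry turns
  \<open>u (Y(a, z1) Y(b, z2) c)\<close> into \<open>u (Y(a, z1) exp(z2 D) Y(c, - z2) b)\<close>, which converges to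
  \<open>S(z1, z2)\<close>, so \<open>S = \<mu>\<close> on \<^const>\<open>Y2\<close>. Applied to the outer product, it turns
  \<open>u (Y(Y(a, z0) b, z2) c)\<close> into \<open>u (exp(z2 D) Y(c, - z2) Y(a, z0) b)\<close>, which converges to
  \<open>S(z2 + z0, z2)\<close>.
\<close>

section \<open>Separating the terms of an absolutely convergent sum\<close>

lemma has_sum_diff:
  fixes f g :: "'a \<Rightarrow> 'b::real_normed_vector"
  assumes "(f has_sum a) A" "(g has_sum b) A"
  shows "((\<lambda>x. f x - g x) has_sum (a - b)) A"
  using has_sum_add[OF assms(1), of "\<lambda>x. - g x" "- b"] assms(2) by (simp add: has_sum_uminus)

text \<open>A total over the set of all \<open>x\<close> with \<open>P x\<close> vanishes if, for every finite \<open>S\<close>, there is a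
  bounded weight that agrees with the indicator of that set on \<open>S\<close> and whose weighted total is
  small: the terms outside a large \<open>S\<close> contribute little.\<close>

lemma has_sum_indicator_zero_by_approximation:
  fixes d :: "'a \<Rightarrow> complex"
  assumes d: "(\<lambda>x. norm (d x)) summable_on UNIV"
    and approx: "\<And>S e. finite S \<Longrightarrow> e > 0 \<Longrightarrow> \<exists>\<phi>. (\<forall>x\<in>S. d x \<noteq> 0 \<longrightarrow> \<phi> x = of_bool (P x)) \<and>
        (\<forall>x. d x \<noteq> 0 \<longrightarrow> norm (\<phi> x) \<le> 1) \<and> norm (\<Sum>\<^sub>\<infinity>x. d x * \<phi> x) \<le> e"
  shows "((\<lambda>x. if P x then d x else 0) has_sum 0) UNIV"
proof -
  define g where "g = (\<lambda>x. if P x then d x else 0)"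
  have g_sum: "(\<lambda>x. norm (g x)) summable_on UNIV"
    by (rule summable_on_comparison_test[OF d]) (auto simp: g_def)
  define S where "S = infsum g UNIV"
  have gS: "(g has_sum S) UNIV"
    unfolding S_def using abs_summable_summable[OF g_sum] by simp
  have bound: "norm S \<le> e" if e: "e > 0" for e
  proof -
    obtain A where A: "finite A" "dist (sum (\<lambda>x. norm (d x)) A) (\<Sum>\<^sub>\<infinity>x. norm (d x)) \<le> e/4"
      using has_sum_finite_approximation[OF has_sum_infsum[OF d], of "e/4"] e by auto
    obtain \<phi> where \<phi>: "\<And>x. x \<in> A \<Longrightarrow> d x \<noteq> 0 \<Longrightarrow> \<phi> x = of_bool (P x)"
        "\<And>x. d x \<noteq> 0 \<Longrightarrow> norm (\<phi> x) \<le> 1" "norm (\<Sum>\<^sub>\<infinity>x. d x * \<phi> x) \<le> e/2"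
      using approx[OF A(1), of "e/2"] e by force
    have "(\<lambda>x. norm (d x * \<phi> x)) summable_on UNIV"
    proof (rule summable_on_comparison_test[OF d])
      fix x show "norm (d x * \<phi> x) \<le> norm (d x)"
        using \<phi>(2)[of x] by (cases "d x = 0") (auto simp: norm_mult mult_left_le)
    qed auto
    then have d\<phi>: "((\<lambda>x. d x * \<phi> x) has_sum (\<Sum>\<^sub>\<infinity>x. d x * \<phi> x)) UNIV"
      using abs_summable_summable by force
    have diff: "((\<lambda>x. g x - d x * \<phi> x) has_sum (S - (\<Sum>\<^sub>\<infinity>x. d x * \<phi> x))) (UNIV - A)"
    proof -
      have "((\<lambda>x. g x - d x * \<phi> x) has_sum (S - (\<Sum>\<^sub>\<infinity>x. d x * \<phi> x))) UNIV"
        using has_sum_diff[OF gS d\<phi>] .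
      moreover have "g x - d x * \<phi> x = 0" if "x \<in> A" for x
        using \<phi>(1)[OF that] by (cases "d x = 0") (auto simp: g_def)
      ultimately show ?thesis
        by (subst has_sum_cong_neutral[where T = UNIV and g = "\<lambda>x. g x - d x * \<phi> x"]) auto
    qed
    have tail: "((\<lambda>x. norm (d x)) has_sum ((\<Sum>\<^sub>\<infinity>x. norm (d x)) - sum (\<lambda>x. norm (d x)) A)) (UNIV - A)"
      by (rule has_sum_Diff[OF has_sum_infsum[OF d]]) (use A in auto)
    have tail2: "((\<lambda>x. 2 * norm (d x)) has_sum
        (2 * ((\<Sum>\<^sub>\<infinity>x. norm (d x)) - sum (\<lambda>x. norm (d x)) A))) (UNIV - A)"
      using has_sum_cmult_right[OF tail] .
    have "norm (S - (\<Sum>\<^sub>\<infinity>x. d x * \<phi> x)) \<le> 2 * ((\<Sum>\<^sub>\<infinity>x. norm (d x)) - sum (\<lambda>x. norm (d x)) A)"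
    proof (rule norm_infsum_le[OF diff tail2])
      fix x
      have "norm (g x - d x * \<phi> x) \<le> norm (g x) + norm (d x * \<phi> x)"
        by (rule norm_triangle_ineq4)
      also have "\<dots> \<le> norm (d x) + norm (d x)"
        using \<phi>(2)[of x]
        by (cases "d x = 0") (auto intro!: add_mono simp: g_def norm_mult mult_left_le)
      finally show "norm (g x - d x * \<phi> x) \<le> 2 * norm (d x)" by simp
    qed
    also have "\<dots> \<le> e/2" using A(2) by (auto simp: dist_real_def abs_if split: if_splits)
    finally have "norm (S - (\<Sum>\<^sub>\<infinity>x. d x * \<phi> x)) \<le> e/2" .
    then show ?thesis using \<phi>(3) norm_triangle_ineq2[of S "\<Sum>\<^sub>\<infinity>x. d x * \<phi> x"] by linarith
  qed
  have "norm S \<le> 0"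
    by (rule field_le_epsilon) (use bound in auto)
  then show ?thesis using gS unfolding g_def by simp
qed

text \<open>If all moments vanish, then so does the total over each level set of \<open>u\<close>: a narrow tent
  around \<open>c\<close> separates \<open>c\<close> from the finitely many other values that matter and is uniformly
  approximated by polynomials in \<open>u\<close>. No discreteness of the values of \<open>u\<close> is needed.\<close>

lemma has_sum_level_set_real:
  fixes d :: "'a \<Rightarrow> complex" and u :: "'a \<Rightarrow> real"
  assumes d: "(\<lambda>x. norm (d x)) summable_on UNIV"
    and u: "\<And>x. d x \<noteq> 0 \<Longrightarrow> 0 \<le> u x \<and> u x \<le> 1"
    and moments: "\<And>k::nat. ((\<lambda>x. d x * of_real (u x) ^ k) has_sum 0) UNIV"
  shows "((\<lambda>x. if u x = c then d x else 0) has_sum 0) UNIV"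
proof (rule has_sum_indicator_zero_by_approximation[OF d])
  fix S :: "'a set" and e :: real
  assume S: "finite S" and e: "e > 0"
  define T where "T = (\<Sum>\<^sub>\<infinity>x. norm (d x))"
  have T0: "T \<ge> 0" unfolding T_def by (rule infsum_nonneg) auto
  define V where "V = (\<lambda>x. \<bar>u x - c\<bar>) ` {x\<in>S. u x \<noteq> c}"
  define \<delta> where "\<delta> = Min (insert 1 V)"
  have finV: "finite V" unfolding V_def using S by auto
  have \<delta>0: "\<delta> > 0" unfolding \<delta>_def using finV by (auto simp: V_def)
  have \<delta>le: "\<delta> \<le> \<bar>u x - c\<bar>" if "x \<in> S" "u x \<noteq> c" for x
    unfolding \<delta>_def by (rule Min_le) (use finV that in \<open>auto simp: V_def\<close>)
  define tent where "tent = (\<lambda>v::real. max 0 (1 - \<bar>v - c\<bar> / \<delta>))"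
  have "continuous_on {0..1} tent" unfolding tent_def
    by (intro continuous_intros) (use \<delta>0 in auto)
  then obtain p where p: "real_polynomial_function p" "\<And>v. v \<in> {0..1} \<Longrightarrow>
      \<bar>tent v - p v\<bar> < e / (T + 1)"
    using Stone_Weierstrass_real_polynomial_function[of "{0..1::real}" tent "e/(T+1)"] e T0 by auto
  obtain a n where pa: "p = (\<lambda>x. \<Sum>i\<le>n. a i * x ^ i)"
    using p(1) real_polynomial_function_iff_sum by auto
  have "((\<lambda>x. \<Sum>i\<le>n. of_real (a i) * (d x * of_real (u x) ^ i)) has_sum (\<Sum>i\<le>n. of_real (a i) * 0))
      UNIV"
  proof (induction n)
    case 0 show ?case using has_sum_cmult_right[OF moments[of 0], of "of_real (a 0)"] by simp
  next
    case (Suc n)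
    show ?case using has_sum_add[OF Suc has_sum_cmult_right[OF moments[of
        "Suc n"], of "of_real (a (Suc n))"]]
      by simp
  qed
  then have dp: "((\<lambda>x. d x * of_real (p (u x))) has_sum 0) UNIV"
    by (simp add: pa sum_distrib_left mult_ac)
  have tent01: "0 \<le> tent v" "tent v \<le> 1" for v
    unfolding tent_def using \<delta>0 by auto
  have "(\<lambda>x. norm (d x * of_real (tent (u x)))) summable_on UNIV"
    by (rule summable_on_comparison_test[OF d]) (auto simp: norm_mult tent01 mult_left_le)
  then have dt: "((\<lambda>x. d x * of_real (tent (u x))) has_sum (\<Sum>\<^sub>\<infinity>x. d x * of_real (tent (u x)))) UNIV"
    using abs_summable_summable by force
  have dd: "((\<lambda>x. norm (d x) * (e / (T+1))) has_sum (T * (e/(T+1)))) UNIV"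
    unfolding T_def by (rule has_sum_cmult_left) (rule has_sum_infsum[OF d])
  have "norm ((\<Sum>\<^sub>\<infinity>x. d x * of_real (tent (u x))) - 0) \<le> T * (e/(T+1))"
  proof (rule norm_infsum_le[OF has_sum_diff[OF dt dp] dd])
    fix x
    have "norm (d x * of_real (tent (u x)) - d x * of_real (p (u x))) =
        norm (d x) * \<bar>tent (u x) - p (u x)\<bar>"
      by (metis norm_mult norm_of_real of_real_diff right_diff_distrib)
    also have "\<dots> \<le> norm (d x) * (e / (T+1))"
    proof (cases "d x = 0")
      case False
      then show ?thesis
        using u[of x] p(2)[of "u x"] by (intro mult_left_mono) auto
    qed simp
    finally show "norm (d x * of_real (tent (u x)) - d x * of_real (p (u x))) \<le> norm (d x) *
        (e / (T+1))" .
  qed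
  also have "T * (e/(T+1)) \<le> e" using T0 e by (simp add: field_simps)
  finally have small: "norm (\<Sum>\<^sub>\<infinity>x. d x * of_real (tent (u x))) \<le> e" by simp
  have "tent (u x) = of_bool (u x = c)" if "x \<in> S" for x
    using \<delta>le[OF that] \<delta>0 by (auto simp: tent_def field_simps)
  then show "\<exists>\<phi>. (\<forall>x\<in>S. d x \<noteq> 0 \<longrightarrow> \<phi> x = of_bool (u x = c)) \<and>
        (\<forall>x. d x \<noteq> 0 \<longrightarrow> norm (\<phi> x) \<le> 1) \<and> norm (\<Sum>\<^sub>\<infinity>x. d x * \<phi> x) \<le> e"
    using small tent01 by (intro exI[of _ "\<lambda>x. of_real (tent (u x))"]) auto
qed

lemma sum_roots_of_unity_powi:
  fixes n :: int and M :: nat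
  assumes "M > 0"
  shows "(\<Sum>j<M. cis (2 * pi * real j / real M) powi n) = (if int M dvd n then of_nat M else 0)"
proof -
  define z where "z = cis (2 * pi * real_of_int n / real M)"
  have eq: "cis (2 * pi * real j / real M) powi n = z ^ j" for j
  proof -
    have "real_of_int n * (2 * pi * real j / real M) = real j * (2 * pi * real_of_int n / real M)"
      by simp
    then show ?thesis unfolding z_def cis_power_int Complex.DeMoivre by (rule arg_cong)
  qed
  have zM: "z ^ M = 1"
  proof -
    have "real M * (2 * pi * real_of_int n / real M) = 2 * pi * real_of_int n"
      using assms by simp
    then show ?thesis unfolding z_def Complex.DeMoivre by simp
  qed
  have z1: "z = 1 \<longleftrightarrow> int M dvd n"
  proof
    assume "z = 1"
    then have "cos (2 * pi * real_of_int n / real M) = 1"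
      unfolding z_def by (metis cis.simps(1) one_complex.simps(1))
    then obtain k :: int where "2 * pi * real_of_int n / real M = real_of_int k * 2 * pi"
      unfolding cos_one_2pi_int by auto
    then have "real_of_int n = real_of_int (k * int M)" using assms by (simp add: field_simps)
    then have "n = k * int M" by linarith
    then show "int M dvd n" by simp
  next
    assume "int M dvd n"
    then obtain k where "n = int M * k" by auto
    then have "2 * pi * real_of_int n / real M = 2 * pi * real_of_int k" using assms by simp
    then have "z = cis (2 * pi * real_of_int k)" unfolding z_def by (rule arg_cong)
    then show "z = 1" by (simp only: cis_multiple_2pi Ints_of_int)
  qed
  show ?thesis
  proof (cases "z = 1")
    case True then show ?thesis using z1 by (simp add: eq)
  next
    case False then show ?thesis using z1 zM by (simp add: eq geometric_sum)
  qed
qed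

text \<open>The analogue for integer frequencies: averaging over the \<open>M\<close>-th roots of unity selects the
  frequencies congruent to \<open>n\<close> modulo \<open>M\<close>.\<close>

lemma has_sum_level_set_int:
  fixes d :: "'a \<Rightarrow> complex" and \<nu> :: "'a \<Rightarrow> int"
  assumes d: "(\<lambda>x. norm (d x)) summable_on UNIV"
    and moments: "\<And>e. norm e = 1 \<Longrightarrow> ((\<lambda>x. d x * e powi \<nu> x) has_sum 0) UNIV"
  shows "((\<lambda>x. if \<nu> x = n then d x else 0) has_sum 0) UNIV"
proof (rule has_sum_indicator_zero_by_approximation[OF d])
  fix S :: "'a set" and e :: real
  assume S: "finite S" and e: "e > 0"
  define M where "M = nat (\<Sum>x\<in>S. \<bar>\<nu> x - n\<bar>) + 1"
  have M: "M > 0" by (simp add: M_def)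
  have big: "\<bar>\<nu> x - n\<bar> < int M" if "x \<in> S" for x
  proof -
    have "\<bar>\<nu> x - n\<bar> \<le> (\<Sum>x\<in>S. \<bar>\<nu> x - n\<bar>)"
      by (rule member_le_sum[OF that]) (use S in auto)
    then show ?thesis by (simp add: M_def)
  qed
  define \<zeta> where "\<zeta> = (\<lambda>j::nat. cis (2 * pi * real j / real M))"
  define \<phi> where "\<phi> = (\<lambda>x. if int M dvd \<nu> x - n then 1 else 0 :: complex)"
  have \<phi>_eq: "\<phi> x = (\<Sum>j<M. \<zeta> j powi (\<nu> x - n)) / of_nat M" for x
    using M by (simp add: \<phi>_def \<zeta>_def sum_roots_of_unity_powi)
  have "((\<lambda>x. \<Sum>j<m. (\<zeta> j powi (- n)) * (d x * \<zeta> j powi \<nu> x)) has_sum 0) UNIV" for m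
  proof (induction m)
    case 0 show ?case by simp
  next
    case (Suc m)
    have "norm (\<zeta> m) = 1" by (simp add: \<zeta>_def)
    from has_sum_add[OF Suc has_sum_cmult_right[OF moments[OF this], of "\<zeta> m powi (- n)"]]
    show ?case by simp
  qed
  from has_sum_cmult_right[OF this[of M], of "1 / of_nat M"]
  have "((\<lambda>x. d x * \<phi> x) has_sum 0) UNIV"
    unfolding \<phi>_eq
    by (simp add: \<zeta>_def power_int_diff power_int_minus sum_distrib_left sum_divide_distrib
        field_simps)
  then have "infsum (\<lambda>x. d x * \<phi> x) UNIV = 0" by (rule infsumI)
  moreover have "\<phi> x = of_bool (\<nu> x = n)" if "x \<in> S" for x
    using big[OF that] zdvd_imp_le[of "int M" "\<bar>\<nu> x - n\<bar>"] by (auto simp: \<phi>_def)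
  ultimately show "\<exists>\<phi>. (\<forall>x\<in>S. d x \<noteq> 0 \<longrightarrow> \<phi> x = of_bool (\<nu> x = n)) \<and>
        (\<forall>x. d x \<noteq> 0 \<longrightarrow> norm (\<phi> x) \<le> 1) \<and> norm (\<Sum>\<^sub>\<infinity>x. d x * \<phi> x) \<le> e"
    using e by (intro exI[of _ \<phi>]) (auto simp: \<phi>_def)
qed



section \<open>The single-valued power functions\<close>

lemma zpow_mult_base: "zpow a b (z * w) = zpow a b z * zpow a b w"
  by (simp add: zpow_def norm_mult power_mult_distrib powr_mult power_int_mult_distrib)

lemma zpow_nonzero [simp]: "z \<noteq> 0 \<Longrightarrow> zpow a b z \<noteq> 0"
  by (simp add: zpow_def)

lemma zpow_one [simp]: "zpow a b 1 = 1"
  by (simp add: zpow_def)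

lemma zpow_zero_exponents [simp]: "z \<noteq> 0 \<Longrightarrow> zpow 0 0 z = 1"
  by (simp add: zpow_def)

lemma zpow_add:
  assumes "z \<noteq> 0" "a - b \<in> \<int>"
  shows "zpow (a + c) (b + d) z = zpow a b z * zpow c d z"
proof -
  obtain n where n: "a - b = of_int n" using assms(2) by (elim Ints_cases)
  have "a + c - (b + d) = of_int n + (c - d)" using n by simp
  moreover have "\<lfloor>of_int n + (c - d)\<rfloor> = n + \<lfloor>c - d\<rfloor>" by simp
  ultimately have "\<lfloor>a + c - (b + d)\<rfloor> = n + \<lfloor>c - d\<rfloor>" by (simp only:)
  moreover have "\<lfloor>a - b\<rfloor> = n" using n by simp
  ultimately show ?thesis
    using assms(1) by (simp add: zpow_def power_int_add powr_add)
qed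

lemma zpow_nat:
  assumes "z \<noteq> 0"
  shows "zpow (real m) (real n) z = z ^ m * cnj z ^ n"
proof -
  have "\<lfloor>real m - real n\<rfloor> = int m - int n"
    by (metis floor_of_int of_int_diff of_int_of_nat_eq)
  moreover have "complex_of_real (((cmod z)\<^sup>2) powr real n) = (z * cnj z) ^ n"
    using assms by (simp add: powr_realpow complex_norm_square[symmetric] del: of_real_power flip:
        of_real_power)
  ultimately show ?thesis
    using assms by (simp add: zpow_def power_int_diff power_mult_distrib)
qed

lemma zpow_of_real:
  assumes "l > 0" "a - b \<in> \<int>"
  shows "zpow a b (complex_of_real l) = complex_of_real (l powr (a + b))"
proof -
  obtain n where n: "a - b = of_int n" using assms(2) by (elim Ints_cases)
  have "zpow a b (complex_of_real l) = complex_of_real (l powi n * (l ^ 2) powr b)"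
    using assms(1) by (simp add: zpow_def n)
  also have "l powi n * (l ^ 2) powr b = l powr (of_int n) * (l powr 2) powr b"
    using assms(1) by (simp add: powr_real_of_int')
  also have "\<dots> = l powr (a + b)"
    using n by (simp only: powr_powr flip: powr_add) (simp add: algebra_simps)
  finally show ?thesis .
qed

lemma zpow_unit: "norm e = 1 \<Longrightarrow> zpow a b e = e powi \<lfloor>a - b\<rfloor>"
  by (simp add: zpow_def)

lemma zpow_minus: "zpow a b (- z) = (- 1) powi \<lfloor>a - b\<rfloor> * zpow a b z"
  using zpow_mult_base[of a b "- 1" z] by (simp add: zpow_unit)

section \<open>Convergent two-variable series\<close>

text \<open>The supports that occur below, with \<open>(r, s)\<close> the exponents of the small variable and
  \<open>(r', s')\<close> those of the large one: the exponents of each variable and its conjugate differ by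
  integers, those of the small variable are bounded below, and the total degrees are bounded.\<close>

definition supp2 :: "rseries2 \<Rightarrow> bool" where
  "supp2 E \<longleftrightarrow> (\<exists>C. \<forall>r s r' s'. E (r, s, r', s') \<noteq> 0 \<longrightarrow>
      r - s \<in> \<int> \<and> r' - s' \<in> \<int> \<and> - C \<le> r \<and> - C \<le> s \<and> \<bar>r + r'\<bar> \<le> C \<and> \<bar>s + s'\<bar> \<le> C)"

text \<open>The monomial \<open>z\<^sup>r zbar\<^sup>s w\<^sup>r\<^sup>' wbar\<^sup>s\<^sup>'\<close>.\<close>

definition mono2 :: "complex \<Rightarrow> complex \<Rightarrow> real \<times> real \<times> real \<times> real \<Rightarrow> complex" where
  "mono2 z w = (\<lambda>(r, s, r', s'). zpow r s z * zpow r' s' w)"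

text \<open>\<open>E\<close> converges to \<open>m\<close> where \<open>|z|\<close> is small compared with \<open>|w|\<close>. For complex terms
  \<^const>\<open>has_sum\<close> includes absolute convergence.\<close>

definition expands2 :: "rseries2 \<Rightarrow> (complex \<Rightarrow> complex \<Rightarrow> complex) \<Rightarrow> bool" where
  "expands2 E m \<longleftrightarrow> supp2 E \<and> (\<exists>R>0. \<forall>z w. z \<noteq> 0 \<longrightarrow> norm z < R * norm w \<longrightarrow>
      ((\<lambda>x. E x * mono2 z w x) has_sum m z w) UNIV)"

lemma supp2_add:
  assumes "supp2 E" "supp2 E'"
  shows "supp2 (\<lambda>x. E x + E' x)"
proof -
  obtain C where C: "\<And>r s r' s'. E (r, s, r', s') \<noteq> 0 \<Longrightarrow>
      r - s \<in> \<int> \<and> r' - s' \<in> \<int> \<and> - C \<le> r \<and> - C \<le> s \<and> \<bar>r + r'\<bar> \<le> C \<and> \<bar>s + s'\<bar> \<le> C"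
    using assms(1) unfolding supp2_def by blast
  obtain C' where C': "\<And>r s r' s'. E' (r, s, r', s') \<noteq> 0 \<Longrightarrow>
      r - s \<in> \<int> \<and> r' - s' \<in> \<int> \<and> - C' \<le> r \<and> - C' \<le> s \<and> \<bar>r + r'\<bar> \<le> C' \<and> \<bar>s + s'\<bar> \<le> C'"
    using assms(2) unfolding supp2_def by blast
  show ?thesis unfolding supp2_def
  proof (intro exI[of _ "max C C'"] allI impI)
    fix r s r' s' assume "E (r, s, r', s') + E' (r, s, r', s') \<noteq> 0"
    then have "E (r, s, r', s') \<noteq> 0 \<or> E' (r, s, r', s') \<noteq> 0" by auto
    then show "r - s \<in> \<int> \<and> r' - s' \<in> \<int> \<and> - max C C' \<le> r \<and> - max C C' \<le> s \<and>
        \<bar>r + r'\<bar> \<le> max C C' \<and> \<bar>s + s'\<bar> \<le> max C C'"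
      using C[of r s r' s'] C'[of r s r' s'] by (auto simp: max_def)
  qed
qed

lemma supp2_cmult: "supp2 E \<Longrightarrow> supp2 (\<lambda>x. c x * E x)"
  unfolding supp2_def by (metis mult_zero_right)

lemma expands2_add:
  assumes "expands2 E m" "expands2 E' m'"
  shows "expands2 (\<lambda>x. E x + E' x) (\<lambda>z w. m z w + m' z w)"
proof -
  obtain R where R: "R > 0" "\<And>z w. z \<noteq> 0 \<Longrightarrow> norm z < R * norm w \<Longrightarrow>
      ((\<lambda>x. E x * mono2 z w x) has_sum m z w) UNIV"
    using assms(1) unfolding expands2_def by blast
  obtain R' where R': "R' > 0" "\<And>z w. z \<noteq> 0 \<Longrightarrow> norm z < R' * norm w \<Longrightarrow>
      ((\<lambda>x. E' x * mono2 z w x) has_sum m' z w) UNIV"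
    using assms(2) unfolding expands2_def by blast
  have "((\<lambda>x. (E x + E' x) * mono2 z w x) has_sum (m z w + m' z w)) UNIV"
    if z: "z \<noteq> 0" "norm z < min R R' * norm w" for z w
  proof -
    have "norm z < R * norm w" "norm z < R' * norm w"
      using z(2) by (meson less_le_trans min.cobounded1 min.cobounded2 mult_right_mono
          norm_ge_zero)+
    from has_sum_add[OF R(2)[OF z(1) this(1)] R'(2)[OF z(1) this(2)]]
    show ?thesis by (simp add: algebra_simps)
  qed
  then show ?thesis
    unfolding expands2_def using supp2_add[of E E'] assms R(1) R'(1)
    by (auto simp: expands2_def intro!: exI[of _ "min R R'"])
qed

lemma expands2_cmult:
  assumes "expands2 E m"
  shows "expands2 (\<lambda>x. c * E x) (\<lambda>z w. c * m z w)"
proof -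
  obtain R where R: "R > 0" "\<And>z w. z \<noteq> 0 \<Longrightarrow> norm z < R * norm w \<Longrightarrow>
      ((\<lambda>x. E x * mono2 z w x) has_sum m z w) UNIV"
    using assms(1) unfolding expands2_def by blast
  then show ?thesis
    using assms supp2_cmult[of E "\<lambda>_. c"] has_sum_cmult_right[OF R(2), of _ _ c]
    unfolding expands2_def by (auto intro!: exI[of _ R] simp: mult.assoc)
qed

lemma expands2_zero: "expands2 (\<lambda>x. 0) (\<lambda>z w. 0)"
  unfolding expands2_def supp2_def by (auto intro!: exI[of _ 1])

lemma expands2_sum:
  assumes "\<And>i. i \<in> I \<Longrightarrow> expands2 (E i) (m i)"
  shows "expands2 (\<lambda>x. \<Sum>i\<in>I. E i x) (\<lambda>z w. \<Sum>i\<in>I. m i z w)"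
proof (cases "finite I")
  case True
  then show ?thesis using assms
    by (induction I rule: finite_induct) (auto intro: expands2_zero expands2_add)
qed (auto intro: expands2_zero)

lemma expands2_cong:
  assumes "expands2 E m" "R > 0" "\<And>z w. z \<noteq> 0 \<Longrightarrow> norm z < R * norm w \<Longrightarrow> m z w = m' z w"
  shows "expands2 E m'"
proof -
  obtain R1 where R1: "R1 > 0" "\<And>z w. z \<noteq> 0 \<Longrightarrow> norm z < R1 * norm w \<Longrightarrow>
      ((\<lambda>x. E x * mono2 z w x) has_sum m z w) UNIV"
    using assms(1) unfolding expands2_def by blast
  have "((\<lambda>x. E x * mono2 z w x) has_sum m' z w) UNIV"
    if z: "z \<noteq> 0" "norm z < min R R1 * norm w" for z w
  proof -
    have "norm z < R * norm w" "norm z < R1 * norm w"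
      using z(2) by (meson less_le_trans min.cobounded1 min.cobounded2 mult_right_mono
          norm_ge_zero)+
    then show ?thesis using R1(2)[OF z(1), of w] assms(3)[OF z(1), of w] by simp
  qed
  then show ?thesis
    using assms(1,2) R1(1) unfolding expands2_def by (auto intro!: exI[of _ "min R R1"])
qed

lemma mono2_dilation:
  assumes "r - s \<in> \<int>" "r' - s' \<in> \<int>" "l > 0" "k > 0" "norm e = 1" "norm e' = 1"
  shows "mono2 (of_real l * of_real k * e * z) (of_real k * e' * w) (r, s, r', s') =
    of_real (l powr (r + s)) * of_real (k powr (r + s + r' + s')) *
    e powi \<lfloor>r - s\<rfloor> * e' powi \<lfloor>r' - s'\<rfloor> * mono2 z w (r, s, r', s')"
proof -
  have "k powr (r + s + r' + s') = k powr (r + s) * k powr (r' + s')"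
    by (simp flip: powr_add add: algebra_simps)
  then show ?thesis
    using assms by (simp add: mono2_def zpow_mult_base zpow_of_real zpow_unit)
qed

text \<open>A convergent series with value zero is zero. Rotating and shrinking \<open>z\<close> and \<open>w\<close> multiplies
  the terms by powers of four characters of the exponents: two phases, recording \<open>r - s\<close> and
  \<open>r' - s'\<close>, and two moduli, recording \<open>r + s\<close> and the total degree. Restricting to one level set
  of each character in turn isolates a single term.\<close>

lemma expands2_zero_imp_zero:
  assumes "expands2 d (\<lambda>z w. 0)"
  shows "d x0 = 0"
proof -
  obtain R where R: "R > 0" "\<And>z w. z \<noteq> 0 \<Longrightarrow> norm z < R * norm w \<Longrightarrow>
      ((\<lambda>x. d x * mono2 z w x) has_sum 0) UNIV"
    using assms unfolding expands2_def by blast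
  obtain C where C: "\<And>r s r' s'. d (r, s, r', s') \<noteq> 0 \<Longrightarrow>
      r - s \<in> \<int> \<and> r' - s' \<in> \<int> \<and> - C \<le> r \<and> - C \<le> s \<and> \<bar>r + r'\<bar> \<le> C \<and> \<bar>s + s'\<bar> \<le> C"
    using assms unfolding expands2_def supp2_def by blast
  define z0 where "z0 = complex_of_real (R/2)"
  define g where "g = (\<lambda>x. d x * mono2 z0 1 x)"
  \<comment> \<open>The summand \<open>2 * C\<close> normalizes the moduli to values in \<open>[0, 1]\<close>.\<close>
  define u where "u = (\<lambda>(r :: real, s :: real, r' :: real, s' :: real). (1/2 :: real) powr (r +
      s + 2 * C))"
  define v where "v = (\<lambda>(r :: real, s :: real, r' :: real, s' :: real). (1/2 :: real) powr (r +
      s + r' + s' + 2 * C))"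
  define \<nu> where "\<nu> = (\<lambda>(r :: real, s :: real, r' :: real, s' :: real). \<lfloor>r - s\<rfloor>)"
  define \<nu>' where "\<nu>' = (\<lambda>(r :: real, s :: real, r' :: real, s' :: real). \<lfloor>r' - s'\<rfloor>)"
  have base: "((\<lambda>x. g x * of_real (u x) ^ j * of_real (v x) ^ k * e powi \<nu> x *
      e' powi \<nu>' x) has_sum 0) UNIV"
    if e: "norm e = 1" "norm e' = 1" for e e' :: complex and j k :: nat
  proof -
    define l m where "l = (1/2 :: real) ^ j" and "m = (1/2 :: real) ^ k"
    have lm: "l > 0" "m > 0" "l \<le> 1" by (auto simp: l_def m_def power_le_one)
    define z w where "z = of_real l * of_real m * e * z0" and "w = of_real m * e' * (1::complex)"
    have "l * (R / 2) \<le> R/2" using lm R(1) by simp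
    also have "\<dots> < R" using R(1) by simp
    finally have "l * m * (R/2) < R * m" using lm by simp
    then have "((\<lambda>x. d x * mono2 z w x) has_sum 0) UNIV"
      using e lm R(1) by (intro R(2)) (auto simp: z_def w_def z0_def norm_mult)
    from has_sum_cmult_right[OF this, of "of_real (l powr (2*C) * m powr (2 * C))"]
    have "((\<lambda>x. of_real (l powr (2*C) * m powr (2 * C)) * (d x * mono2 z w x)) has_sum 0) UNIV"
      by simp
    moreover have "of_real (l powr (2*C) * m powr (2 * C)) * (d x * mono2 z w x) =
        g x * of_real (u x) ^ j * of_real (v x) ^ k * e powi \<nu> x * e' powi \<nu>' x" for x
    proof -
      obtain r s r' s' where x: "x = (r, s, r', s')" by (cases x)
      show ?thesis
      proof (cases "d x = 0")
        case False
        have int: "r - s \<in> \<int>" "r' - s' \<in> \<int>" using C False by (auto simp: x)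
        have pw: "((1/2) powr a :: real) ^ i = ((1/2)^i) powr a" for a i
          by (simp add: powr_realpow[symmetric] powr_powr mult.commute)
        have "u x ^ j = l powr (2*C) * l powr (r + s)" "v x ^ k = m powr (2*C) *
            m powr (r + s + r' + s')"
          by (simp_all add: u_def v_def x pw l_def m_def add.commute flip: powr_add)
        then show ?thesis
          unfolding z_def w_def g_def x mono2_dilation[OF int lm(1,2) e]
          by (simp add: \<nu>_def \<nu>'_def flip: of_real_power)
      qed (simp add: g_def)
    qed
    ultimately show ?thesis by simp
  qed
  have u01: "0 \<le> u x \<and> u x \<le> 1" and v01: "0 \<le> v x \<and> v x \<le> 1" if gx: "g x \<noteq> 0" for x
  proof -
    obtain r s r' s' where x: "x = (r, s, r', s')" by (cases x)
    have "d (r, s, r', s') \<noteq> 0" using gx by (auto simp: g_def x)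
    from C[OF this] have "r + s + 2 * C \<ge> 0" "r + s + r' + s' + 2 * C \<ge> 0" by auto
    then show "0 \<le> u x \<and> u x \<le> 1" "0 \<le> v x \<and> v x \<le> 1"
      using powr_mono'[of 0 _ "1/2 :: real"] by (auto simp: u_def v_def x)
  qed
  have g_sum: "(\<lambda>x. norm (g x)) summable_on UNIV"
    using base[of 1 1 0 0]
        by (simp add: has_sum_imp_summable flip: summable_on_iff_abs_summable_on_complex)
  have sub: "(\<lambda>x. norm (h x)) summable_on UNIV" if "\<And>x. norm (h x) \<le> norm (g x)" for h ::
      "_ \<Rightarrow> complex"
    by (rule summable_on_comparison_test[OF g_sum]) (use that in auto)
  have nu: "norm (e powi n) = 1" if "norm e = 1" for e :: complex and n
    using that by (simp add: norm_power_int)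
  have mono: "a * b \<le> a" if "0 \<le> a" "0 \<le> b" "b \<le> 1" for a b :: real
    using that by (simp add: mult_left_le)
  define g1 where "g1 = (\<lambda>x. if \<nu>' x = \<nu>' x0 then g x else 0)"
  have s1: "((\<lambda>x. g1 x * of_real (u x) ^ j * of_real (v x) ^ k * e powi \<nu> x) has_sum 0) UNIV"
    if e: "norm e = 1" for e :: complex and j k :: nat
  proof -
    have "((\<lambda>x. if \<nu>' x = \<nu>' x0 then g x * of_real (u x) ^ j * of_real (v x) ^ k *
        e powi \<nu> x else 0) has_sum 0) UNIV"
    proof (rule has_sum_level_set_int[OF sub])
      fix x
      show "norm (g x * of_real (u x) ^ j * of_real (v x) ^ k * e powi \<nu> x) \<le> norm (g x)"
      proof (cases "g x = 0")
        case False
        then have "u x ^ j * v x ^ k \<le> 1"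
          using u01[of x] v01[of x] by (intro mult_le_one power_le_one zero_le_power) auto
        then show ?thesis using u01[of x] v01[of x] False nu[OF e]
          by (simp add: norm_mult norm_power mult.assoc)
      qed simp
    qed (use base[OF e] in auto)
    then show ?thesis by (rule has_sum_cong[THEN iffD1, rotated]) (simp add: g1_def)
  qed
  define g2 where "g2 = (\<lambda>x. if \<nu> x = \<nu> x0 then g1 x else 0)"
  have g1_le: "norm (g1 x) \<le> norm (g x)" for x by (simp add: g1_def)
  have s2: "((\<lambda>x. g2 x * of_real (u x) ^ j * of_real (v x) ^ k) has_sum 0) UNIV" for j k :: nat
  proof -
    have "((\<lambda>x. if \<nu> x = \<nu> x0 then g1 x * of_real (u x) ^ j * of_real (v x) ^ k else 0) has_sum
        0) UNIV"
    proof (rule has_sum_level_set_int[OF sub])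
      fix x
      show "norm (g1 x * of_real (u x) ^ j * of_real (v x) ^ k) \<le> norm (g x)"
      proof (cases "g x = 0")
        case False
        then have "norm (g1 x * of_real (u x) ^ j * of_real (v x) ^ k) \<le> norm (g1 x)"
          using u01[of x] v01[of x] mult_le_one[OF power_le_one zero_le_power power_le_one, of "u
              x" "v x" j k]
          by (simp add: norm_mult norm_power mult.assoc) (intro mono, auto)
        then show ?thesis using g1_le[of x] by linarith
      qed (simp add: g1_def)
    qed (use s1 in auto)
    then show ?thesis by (rule has_sum_cong[THEN iffD1, rotated]) (simp add: g2_def)
  qed
  define g3 where "g3 = (\<lambda>x. if v x = v x0 then g2 x else 0)"
  have g2_le: "norm (g2 x) \<le> norm (g x)" for x by (simp add: g1_def g2_def)
  have s3: "((\<lambda>x. g3 x * of_real (u x) ^ j) has_sum 0) UNIV" for j :: nat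
  proof -
    have "((\<lambda>x. if v x = v x0 then g2 x * of_real (u x) ^ j else 0) has_sum 0) UNIV"
    proof (rule has_sum_level_set_real[OF sub])
      fix x
      show "norm (g2 x * of_real (u x) ^ j) \<le> norm (g x)"
      proof (cases "g x = 0")
        case False
        then have "norm (g2 x * of_real (u x) ^ j) \<le> norm (g2 x)"
          using u01[of x] by (simp add: norm_mult norm_power) (intro mono, auto intro: power_le_one)
        then show ?thesis using g2_le[of x] by linarith
      qed (simp add: g1_def g2_def)
      show "0 \<le> v x \<and> v x \<le> 1" if "g2 x * of_real (u x) ^ j \<noteq> 0"
        using that v01[of x] by (auto simp: g2_def g1_def split: if_splits)
    qed (use s2 in \<open>auto\<close>)
    then show ?thesis by (rule has_sum_cong[THEN iffD1, rotated]) (simp add: g3_def)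
  qed
  have g3_le: "norm (g3 x) \<le> norm (g x)" for x by (simp add: g1_def g2_def g3_def)
  have "((\<lambda>x. if u x = u x0 then g3 x else 0) has_sum 0) UNIV"
    by (rule has_sum_level_set_real[OF sub])
       (use s3 u01 in \<open>auto simp: g1_def g2_def g3_def split: if_splits\<close>)
  moreover have "(if u x = u x0 then g3 x else 0) = (if x = x0 then g x0 else 0)"
      if d0: "d x0 \<noteq> 0" for x
  proof -
    have only: "x = x0" if "g3 x \<noteq> 0" "u x = u x0"
    proof -
      have eqs: "\<nu> x = \<nu> x0" "\<nu>' x = \<nu>' x0" "u x = u x0" "v x = v x0" and dx: "d x \<noteq> 0"
        using that by (auto simp: g3_def g2_def g1_def g_def split: if_splits)
      obtain r s r' s' where x: "x = (r, s, r', s')" by (cases x)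
      obtain a b a' b' where x0: "x0 = (a, b, a', b')" by (cases x0)
      have "r - s \<in> \<int>" "r' - s' \<in> \<int>" "a - b \<in> \<int>" "a' - b' \<in> \<int>"
        using C dx d0 by (auto simp: x x0)
      then have "r - s = a - b" "r' - s' = a' - b'"
        using eqs(1,2) by (auto simp: \<nu>_def \<nu>'_def x x0 elim!: Ints_cases)
      moreover have "r + s = a + b" "r + s + r' + s' = a + b + a' + b'"
        using eqs(3,4) by (auto simp: u_def v_def x x0 powr_inj)
      ultimately show ?thesis by (auto simp: x x0)
    qed
    show ?thesis
    proof (cases "x = x0")
      case False
      then show ?thesis using only by auto
    qed (simp add: g3_def g2_def g1_def)
  qed
  ultimately have "((\<lambda>x. if x = x0 then g x0 else 0) has_sum 0) UNIV" if "d x0 \<noteq> 0"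
    using that by auto
  moreover have "((\<lambda>x. if x = x0 then g x0 else 0) has_sum g x0) UNIV"
    by (rule has_sum_finite_neutralI[of "{x0}"]) auto
  ultimately have "d x0 \<noteq> 0 \<Longrightarrow> g x0 = 0" using has_sum_unique by blast
  moreover have "mono2 z0 1 x0 \<noteq> 0"
    using R(1) by (cases x0) (simp add: mono2_def z0_def)
  ultimately show ?thesis by (auto simp: g_def)
qed

lemma expands2_unique:
  assumes "expands2 E m" "expands2 E' m'" "R > 0"
    and "\<And>z w. z \<noteq> 0 \<Longrightarrow> norm z < R * norm w \<Longrightarrow> m z w = m' z w"
  shows "E = E'"
proof
  fix x
  have "expands2 (\<lambda>x. E x + (- 1) * E' x) (\<lambda>z w. m z w + (- 1) * m' z w)"
    by (intro expands2_add expands2_cmult assms)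
  then have "expands2 (\<lambda>x. E x + (- 1) * E' x) (\<lambda>z w. 0)"
    by (rule expands2_cong[OF _ assms(3)]) (simp add: assms(4))
  from expands2_zero_imp_zero[OF this, of x] show "E x = E' x" by simp
qed

section \<open>Real analytic functions along curves\<close>

text \<open>A complex function of a real parameter is analytic at \<open>t\<close> when near \<open>t\<close> it is the
  restriction of a function holomorphic near \<open>t\<close>.\<close>

definition param_analytic :: "(real \<Rightarrow> complex) \<Rightarrow> real \<Rightarrow> bool" where
  "param_analytic h t \<longleftrightarrow> (\<exists>H. H analytic_on {complex_of_real t} \<and>
      (\<forall>\<^sub>F s in nhds t. h s = H (complex_of_real s)))"

lemma param_analyticI:
  assumes "H analytic_on {complex_of_real t}" "\<And>s. h s = H (complex_of_real s)"
  shows "param_analytic h t"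
  using assms unfolding param_analytic_def by auto

lemma param_analytic_const: "param_analytic (\<lambda>_. c) t"
  by (rule param_analyticI[of "\<lambda>_. c"]) auto

lemma param_analytic_of_real: "param_analytic complex_of_real t"
  by (rule param_analyticI[of "\<lambda>x. x"]) auto

lemma param_analytic_add:
  assumes "param_analytic f t" "param_analytic g t"
  shows "param_analytic (\<lambda>s. f s + g s) t"
proof -
  obtain F G where F: "F analytic_on {complex_of_real t}" "\<forall>\<^sub>F s in nhds t. f s =
      F (complex_of_real s)"
    and G: "G analytic_on {complex_of_real t}" "\<forall>\<^sub>F s in nhds t. g s = G (complex_of_real s)"
    using assms unfolding param_analytic_def by blast
  from F(2) G(2) have "\<forall>\<^sub>F s in nhds t. f s + g s = F (complex_of_real s) + G (complex_of_real s)"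
    by eventually_elim simp
  then show ?thesis unfolding param_analytic_def
    using analytic_on_add[OF F(1) G(1)] by (intro exI[of _ "\<lambda>x. F x + G x"]) simp
qed

lemma param_analytic_mult:
  assumes "param_analytic f t" "param_analytic g t"
  shows "param_analytic (\<lambda>s. f s * g s) t"
proof -
  obtain F G where F: "F analytic_on {complex_of_real t}" "\<forall>\<^sub>F s in nhds t. f s =
      F (complex_of_real s)"
    and G: "G analytic_on {complex_of_real t}" "\<forall>\<^sub>F s in nhds t. g s = G (complex_of_real s)"
    using assms unfolding param_analytic_def by blast
  from F(2) G(2) have "\<forall>\<^sub>F s in nhds t. f s * g s = F (complex_of_real s) * G (complex_of_real s)"
    by eventually_elim simp
  then show ?thesis unfolding param_analytic_def
    using analytic_on_mult[OF F(1) G(1)] by (intro exI[of _ "\<lambda>x. F x * G x"]) simp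
qed

lemma param_analytic_minus: "param_analytic f t \<Longrightarrow> param_analytic (\<lambda>s. - f s) t"
  using param_analytic_mult[OF param_analytic_const[of "- 1"], of f t] by simp

lemma param_analytic_diff:
  "param_analytic f t \<Longrightarrow> param_analytic g t \<Longrightarrow> param_analytic (\<lambda>s. f s - g s) t"
  using param_analytic_add[of f t "\<lambda>s. - g s"] param_analytic_minus[of g t] by auto

lemma param_analytic_sum:
  "(\<And>i. i \<in> I \<Longrightarrow> param_analytic (f i) t) \<Longrightarrow> param_analytic (\<lambda>s. \<Sum>i\<in>I. f i s) t"
  by (induction I rule: infinite_finite_induct) (auto intro: param_analytic_const
      param_analytic_add)

lemma param_analytic_power: "param_analytic f t \<Longrightarrow> param_analytic (\<lambda>s. f s ^ n) t"
  by (induction n) (auto intro: param_analytic_const param_analytic_mult)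

lemmas param_analytic_intros = param_analytic_const param_analytic_of_real param_analytic_add
  param_analytic_diff param_analytic_minus param_analytic_mult param_analytic_sum
      param_analytic_power

lemma param_analytic_compose:
  assumes "param_analytic f t" "G analytic_on {f t}"
  shows "param_analytic (\<lambda>s. G (f s)) t"
proof -
  obtain F where F: "F analytic_on {complex_of_real t}" "\<forall>\<^sub>F s in nhds t. f s =
      F (complex_of_real s)"
    using assms unfolding param_analytic_def by blast
  have ft: "f t = F (complex_of_real t)" using eventually_nhds_x_imp_x[OF F(2)] .
  have "(G \<circ> F) analytic_on {complex_of_real t}"
    by (rule analytic_on_compose[OF F(1)]) (use assms(2) ft in simp)
  moreover from F(2) have "\<forall>\<^sub>F s in nhds t. G (f s) = (G \<circ> F) (complex_of_real s)"
    by eventually_elim simp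
  ultimately show ?thesis unfolding param_analytic_def by blast
qed

lemma param_analytic_cnj:
  assumes "param_analytic f t"
  shows "param_analytic (\<lambda>s. cnj (f s)) t"
proof -
  obtain F where F: "F analytic_on {complex_of_real t}" "\<forall>\<^sub>F s in nhds t. f s =
      F (complex_of_real s)"
    using assms unfolding param_analytic_def by blast
  obtain e where e: "e > 0" "F holomorphic_on ball (complex_of_real t) e"
    using F(1) unfolding analytic_on_def by auto
  have "cnj ` ball (complex_of_real t) e = ball (complex_of_real t) e"
  proof -
    have "cnj x \<in> ball (complex_of_real t) e \<longleftrightarrow> x \<in> ball (complex_of_real t) e" for x
      by (metis complex_cnj_complex_of_real complex_cnj_diff complex_mod_cnj dist_norm mem_ball)
    then show ?thesis by (intro equalityI subsetI) (auto intro!: image_eqI[of _ cnj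
        "cnj _"] simp del: mem_ball)
  qed
  then have "(cnj \<circ> F \<circ> cnj) holomorphic_on ball (complex_of_real t) e"
    by (intro holomorphic_on_compose_cnj_cnj) (use e in auto)
  then have "(cnj \<circ> F \<circ> cnj) analytic_on {complex_of_real t}"
    using e(1) unfolding analytic_on_def by auto
  moreover from F(2) have "\<forall>\<^sub>F s in nhds t. cnj (f s) = (cnj \<circ> F \<circ> cnj) (complex_of_real s)"
    by eventually_elim simp
  ultimately show ?thesis unfolding param_analytic_def by blast
qed

lemma param_analytic_isCont:
  assumes "param_analytic f t"
  shows "isCont f t"
proof -
  obtain F where F: "F analytic_on {complex_of_real t}" "\<forall>\<^sub>F s in nhds t. f s =
      F (complex_of_real s)"
    using assms unfolding param_analytic_def by blast
  have "isCont (\<lambda>s. F (complex_of_real s)) t"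
    by (rule isCont_o2[where f = complex_of_real and g =
        F]) (use analytic_at_imp_isCont[OF F(1)] in auto)
  then show ?thesis using F(2) by (simp add: isCont_cong)
qed

lemma param_analytic_divide:
  assumes "param_analytic f t" "param_analytic g t" "g t \<noteq> 0"
  shows "param_analytic (\<lambda>s. f s / g s) t"
proof -
  have "param_analytic (\<lambda>s. inverse (g s)) t"
    by (rule param_analytic_compose[OF assms(2)]) (use assms(3) in \<open>auto intro!: analytic_intros\<close>)
  from param_analytic_mult[OF assms(1) this] show ?thesis by (simp add: divide_inverse)
qed

lemma param_analytic_zpow:
  assumes f: "param_analytic f t" and nz: "f t \<noteq> 0"
  shows "param_analytic (\<lambda>s. zpow a b (f s)) t"
proof -
  have "param_analytic (\<lambda>s. f s powi \<lfloor>a - b\<rfloor>) t"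
    by (rule param_analytic_compose[OF f]) (use nz in \<open>auto intro!: analytic_intros\<close>)
  moreover have "param_analytic (\<lambda>s. (f s * cnj (f s)) powr of_real b) t"
  proof (rule param_analytic_compose[where f = "\<lambda>s. f s * cnj (f s)" and G =
      "\<lambda>z. z powr of_real b"])
    have "f t * cnj (f t) \<notin> \<real>\<^sub>\<le>\<^sub>0"
    proof -
      have "f t * cnj (f t) = complex_of_real ((cmod (f t))\<^sup>2)"
          by (simp add: complex_norm_square del: of_real_power)
      moreover have "(cmod (f t))\<^sup>2 > 0" using nz by simp
      ultimately show ?thesis by (simp only: complex_nonpos_Reals_iff) simp
    qed
    then show "(\<lambda>z. z powr of_real b) analytic_on {f t * cnj (f t)}"
      by (intro analytic_intros) auto
  qed (intro param_analytic_intros param_analytic_cnj f)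
  moreover have "(z * cnj z) powr of_real b = complex_of_real (((cmod z)\<^sup>2) powr b)" for z
  proof -
    have "z * cnj z = complex_of_real ((cmod z)\<^sup>2)"
        by (simp add: complex_norm_square del: of_real_power)
    then show ?thesis by (simp only: powr_of_real zero_le_power2)
  qed
  ultimately show ?thesis unfolding zpow_def using param_analytic_mult by force
qed

text \<open>Replacing \<open>Re\<close> and \<open>Im\<close> of a point of the curve by holomorphic functions of a complexified
  parameter turns the real power series of \<open>f\<close> into a locally uniformly convergent series of
  holomorphic functions.\<close>

lemma real_analytic_on_compose_param:
  assumes f: "real_analytic_on f S" and h: "param_analytic h t" and ht: "h t \<in> S"
  shows "param_analytic (\<lambda>s. f (h s)) t"
proof -
  obtain a R where R: "R > 0" and a: "\<And>w. w \<in> ball 0 R \<Longrightarrow>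
      ((\<lambda>(m, n). a (m, n) * complex_of_real (Re w ^ m * Im w ^ n)) has_sum f (h t + w)) UNIV"
    using f ht unfolding real_analytic_on_def by blast
  define z where "z = h t"
  have "param_analytic (\<lambda>s. (h s - z + cnj (h s - z)) / 2) t"
      "param_analytic (\<lambda>s. (h s - z - cnj (h s - z)) / (2 * \<i>)) t"
    using h by (intro param_analytic_intros param_analytic_cnj param_analytic_divide; simp)+
  then obtain X Y where
    X: "X analytic_on {complex_of_real t}" "\<forall>\<^sub>F s in nhds t. (h s - z + cnj (h s - z)) / 2 =
        X (complex_of_real s)"
    and Y: "Y analytic_on {complex_of_real t}" "\<forall>\<^sub>F s in nhds t. (h s - z - cnj (h s - z)) / (2 *
        \<i>) = Y (complex_of_real s)"
    unfolding param_analytic_def by blast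
  have hc: "isCont h t" by (rule param_analytic_isCont[OF h])
  have reX: "(c + cnj c) / 2 = complex_of_real (Re c)" and imY: "(c - cnj c) / (2 * \<i>) =
      complex_of_real (Im c)" for c
    by (auto simp: complex_add_cnj complex_diff_cnj complex_eq_iff)
  have X0: "X (complex_of_real t) = 0" and Y0: "Y (complex_of_real t) = 0"
    using eventually_nhds_x_imp_x[OF X(2)] eventually_nhds_x_imp_x[OF Y(2)] by (auto simp: z_def)
  \<comment> \<open>At \<open>w = \<rho> + \<i> \<rho>\<close>, still in the disc, the real power series yields a majorant on
    \<open>|X|, |Y| < \<rho>\<close>.\<close>
  define \<rho> where "\<rho> = R / 2"
  have \<rho>: "\<rho> > 0" using R by (simp add: \<rho>_def)
  have w0: "Complex \<rho> \<rho> \<in> ball 0 R"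
  proof -
    have "norm (Complex \<rho> \<rho>) = sqrt 2 * \<rho>"
      using \<rho> by (simp add: cmod_def real_sqrt_mult flip: mult_2)
    also have "\<dots> < R" using R sqrt2_less_2 by (simp add: \<rho>_def)
    finally show ?thesis by simp
  qed
  have asum: "(\<lambda>mn. norm (a mn) * \<rho> ^ (fst mn + snd mn)) summable_on UNIV"
  proof -
    have "(\<lambda>(m, n). a (m, n) * complex_of_real (\<rho> ^ m * \<rho> ^ n)) summable_on UNIV"
      using a[OF w0] has_sum_imp_summable by auto
    then have "(\<lambda>mn. norm (case mn of (m, n) \<Rightarrow> a (m, n) * complex_of_real (\<rho> ^ m * \<rho> ^ n)))
        summable_on UNIV"
      by (simp add: summable_on_iff_abs_summable_on_complex)
    then show ?thesis
      by (rule summable_on_cong[THEN iffD1, rotated])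
         (use \<rho> in \<open>auto simp: norm_mult norm_power power_add\<close>)
  qed
  obtain e where e: "e > 0" "X holomorphic_on ball (complex_of_real t) e"
      "Y holomorphic_on ball (complex_of_real t) e"
  proof -
    obtain e1 e2 where "e1 > 0" "X holomorphic_on ball (complex_of_real t) e1" "e2 > 0"
        "Y holomorphic_on ball (complex_of_real t) e2"
      using X(1) Y(1) unfolding analytic_on_def by auto
    then show ?thesis
      by (intro that[of "min e1 e2"]) (auto intro: holomorphic_on_subset)
  qed
  have "\<forall>\<^sub>F x in nhds (complex_of_real t). norm (X x) < \<rho> \<and> norm (Y x) < \<rho> \<and>
      dist x (complex_of_real t) < e"
  proof (intro eventually_conj)
    have "isCont X (complex_of_real t)" "isCont Y (complex_of_real t)"
      using X(1) Y(1) analytic_at_imp_isCont by auto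
    then have "((\<lambda>x. norm (X x)) \<longlongrightarrow> 0) (nhds (complex_of_real t))"
        "((\<lambda>x. norm (Y x)) \<longlongrightarrow> 0) (nhds (complex_of_real t))"
      using X0 Y0 by (auto simp: isCont_def tendsto_nhds_iff intro!: tendsto_norm_zero)
    then show "\<forall>\<^sub>F x in nhds (complex_of_real t). norm (X x) < \<rho>"
        "\<forall>\<^sub>F x in nhds (complex_of_real t). norm (Y x) < \<rho>"
      using \<rho> order_tendstoD(2) by blast+
    show "\<forall>\<^sub>F x in nhds (complex_of_real t). dist x (complex_of_real t) < e"
      using e(1) eventually_nhds_metric by blast
  qed
  then obtain d where d: "d > 0" "\<And>x. dist x (complex_of_real t) < d \<Longrightarrow> norm (X x) < \<rho> \<and>
      norm (Y x) < \<rho> \<and> dist x (complex_of_real t) < e"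
    unfolding eventually_nhds_metric by blast
  define K where "K = (\<lambda>x. \<Sum>\<^sub>\<infinity>mn. a mn * (X x ^ fst mn * Y x ^ snd mn))"
  have sub: "cball (complex_of_real t) (d/2) \<subseteq> ball (complex_of_real t) e"
    using d by (force simp: dist_commute)
  have unif: "uniform_limit (cball (complex_of_real t) (d/2)) (\<lambda>F x. \<Sum>mn\<in>F. a mn *
      (X x ^ fst mn * Y x ^ snd mn)) K (finite_subsets_at_top UNIV)"
    unfolding K_def
  proof (rule Weierstrass_m_test_general[OF _ asum])
    fix mn x assume "x \<in> cball (complex_of_real t) (d/2)"
    then have "norm (X x) < \<rho> \<and> norm (Y x) < \<rho>" using d(1) d(2)[of x] by (auto simp: dist_commute)
    then show "norm (a mn * (X x ^ fst mn * Y x ^ snd mn)) \<le> norm (a mn) * \<rho> ^ (fst mn + snd mn)"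
      using \<rho> by (auto simp: norm_mult norm_power power_add intro!: mult_left_mono mult_mono
          power_mono)
  qed
  have "K holomorphic_on ball (complex_of_real t) (d/2)"
  proof (rule holomorphic_uniform_limit[OF _ unif])
    have holo: "(\<lambda>x. \<Sum>mn\<in>F. a mn * (X x ^ fst mn * Y x ^ snd mn)) holomorphic_on ball
        (complex_of_real t) e" for F
      by (intro holomorphic_intros e)
    show "\<forall>\<^sub>F F in finite_subsets_at_top UNIV. continuous_on (cball (complex_of_real t) (d / 2))
        (\<lambda>x. \<Sum>mn\<in>F. a mn * (X x ^ fst mn * Y x ^ snd mn)) \<and>
       (\<lambda>x. \<Sum>mn\<in>F. a mn * (X x ^ fst mn * Y x ^ snd mn)) holomorphic_on ball (complex_of_real t)
           (d / 2)"
      using holomorphic_on_imp_continuous_on[OF holo] holo sub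
      by (intro always_eventually allI conjI) (meson continuous_on_subset, meson ball_subset_cball
          holomorphic_on_subset order_trans)
  qed auto
  then have "K analytic_on {complex_of_real t}"
    using d(1) unfolding analytic_on_def by (auto intro!: exI[of _ "d/2"])
  moreover have "\<forall>\<^sub>F s in nhds t. dist (h s) (h t) < R"
    by (rule tendstoD) (use hc R in \<open>auto simp: isCont_def tendsto_nhds_iff\<close>)
  with X(2) Y(2) have "\<forall>\<^sub>F s in nhds t. f (h s) = K (complex_of_real s)"
  proof eventually_elim
    case (elim s)
    define w where "w = h s - z"
    have "w \<in> ball 0 R" using elim(3) by (simp add: w_def z_def dist_norm norm_minus_commute)
    moreover have "X (complex_of_real s) = complex_of_real (Re w)" "Y (complex_of_real s) =
        complex_of_real (Im w)"
      using elim(1,2) by (metis reX w_def, metis imY w_def)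
    ultimately have "K (complex_of_real s) = f (h t + w)"
      unfolding K_def using a[of w] by (intro infsumI) (simp add: case_prod_beta')
    then show ?case by (simp add: w_def z_def)
  qed
  ultimately show ?thesis unfolding param_analytic_def by blast
qed

text \<open>The set of parameters near which \<open>h\<close> vanishes is open and closed in \<open>[0, 1]\<close>.\<close>

lemma param_analytic_identity:
  assumes h: "\<And>t. 0 \<le> t \<Longrightarrow> t \<le> 1 \<Longrightarrow> param_analytic h t"
    and zero: "\<forall>\<^sub>F t in nhds 0. h t = 0"
  shows "h 1 = 0"
proof -
  have "\<forall>\<^sub>F t in nhds 1. h t = 0"
  proof (rule connected_induction_simple[of "{0..1::real}" 0 1 "\<lambda>x. \<forall>\<^sub>F t in nhds x. h t = 0"])
    fix t :: real assume t: "t \<in> {0..1}"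
    then obtain H where H: "H analytic_on {complex_of_real t}" "\<forall>\<^sub>F s in nhds t. h s =
        H (complex_of_real s)"
      using h[of t] unfolding param_analytic_def by auto
    obtain e1 where e1: "e1 > 0" "H holomorphic_on ball (complex_of_real t) e1"
      using H(1) unfolding analytic_on_def by auto
    obtain e2 where e2: "e2 > 0" "\<And>s. dist s t < e2 \<Longrightarrow> h s = H (complex_of_real s)"
      using H(2) unfolding eventually_nhds_metric by auto
    define e where "e = min e1 e2"
    have e: "e > 0" "H holomorphic_on ball (complex_of_real t) e" "\<And>s. dist s t < e \<Longrightarrow> h s =
        H (complex_of_real s)"
      using e1 e2 by (auto simp: e_def intro: holomorphic_on_subset)
    have "\<forall>\<^sub>F s in nhds y. h s = 0" if x: "x \<in> ball t e" "\<forall>\<^sub>F s in nhds x. h s =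
        0" and y: "y \<in> ball t e" for x y
    proof -
      obtain d where d: "d > 0" "\<And>s. dist s x < d \<Longrightarrow> h s = 0"
        using x(2) unfolding eventually_nhds_metric by auto
      define U where "U = complex_of_real ` (ball x d \<inter> ball t e)"
      have H0: "H z = 0" if "z \<in> ball (complex_of_real t) e" for z
      proof (rule analytic_continuation[of H "ball (complex_of_real t) e" U "complex_of_real x"])
        show "U \<subseteq> ball (complex_of_real t) e"
          by (auto simp: U_def dist_of_real)
        show "complex_of_real x \<in> ball (complex_of_real t) e" using x by (simp add: dist_of_real)
        show "complex_of_real x islimpt U"
        proof -
          have "x islimpt (ball x d \<inter> ball t e)"
            by (rule interior_limit_point) (use x d in \<open>simp add: interior_open open_Int\<close>)
          then obtain \<sigma> where \<sigma>: "\<And>n. \<sigma> n \<in> (ball x d \<inter> ball t e) - {x}" "\<sigma> \<longlonglongrightarrow> x"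
            unfolding islimpt_sequential by auto
          then have "\<And>n. complex_of_real (\<sigma> n) \<in> U - {complex_of_real x}"
              "(\<lambda>n. complex_of_real (\<sigma> n)) \<longlonglongrightarrow> complex_of_real x"
            unfolding U_def by (auto intro: tendsto_of_real)
          then show ?thesis unfolding islimpt_sequential
            by (intro exI[of _ "\<lambda>n. complex_of_real (\<sigma> n)"]) auto
        qed
        show "H z = 0" if "z \<in> U" for z
          using that e(3) d(2) unfolding U_def by (auto simp: dist_commute) metis
      qed (use e that in auto)
      have "\<forall>\<^sub>F s in nhds y. s \<in> ball t e"
        using y by (intro eventually_nhds_in_open) auto
      then show ?thesis
        by eventually_elim (use e(3) H0 in \<open>simp add: dist_commute dist_of_real\<close>)
    qed
    note * = this
    show "\<exists>T. openin (top_of_set {0..1}) T \<and> t \<in> T \<and>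
        (\<forall>x\<in>T. \<forall>y\<in>T. (\<forall>\<^sub>F s in nhds x. h s = 0) \<longrightarrow> (\<forall>\<^sub>F s in nhds y. h s = 0))"
    proof (intro exI[of _ "{0..1} \<inter> ball t e"] conjI ballI impI)
      show "openin (top_of_set {0..1}) ({0..1} \<inter> ball t e)" by (simp add: openin_open_Int)
      show "t \<in> {0..1} \<inter> ball t e" using t e(1) by simp
    qed (rule *, auto)
  qed (simp_all add: zero)
  then show ?thesis by (rule eventually_nhds_x_imp_x)
qed

text \<open>Functions on \<^const>\<open>Y2\<close> whose pullback along every analytic curve in \<^const>\<open>Y2\<close> is analytic.
  This form of real analyticity is visibly stable under algebraic operations and holomorphic
  changes of coordinates.\<close>

definition curve_analytic :: "(complex \<Rightarrow> complex \<Rightarrow> complex) \<Rightarrow> bool" where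
  "curve_analytic m \<longleftrightarrow> (\<forall>\<gamma> \<delta> t. param_analytic \<gamma> t \<longrightarrow> param_analytic \<delta> t \<longrightarrow> (\<gamma> t, \<delta> t) \<in> Y2 \<longrightarrow>
      param_analytic (\<lambda>s. m (\<gamma> s) (\<delta> s)) t)"

text \<open>The point \<open>(w, z)\<close> is joined to the region \<open>|z| < R |w|\<close> by moving \<open>z / w\<close> along a segment
  inside a half plane bounded by the real axis, so that it avoids \<open>0\<close> and \<open>1\<close>.\<close>

lemma curve_analytic_identity:
  assumes m: "curve_analytic m" and m': "curve_analytic m'" and R: "R > 0"
    and eq: "\<And>w z. z \<noteq> 0 \<Longrightarrow> norm z < R * norm w \<Longrightarrow> m w z = m' w z"
    and wz: "(w, z) \<in> Y2"
  shows "m w z = m' w z"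
proof -
  define q where "q = z / w"
  have w: "w \<noteq> 0" "z \<noteq> 0" "z \<noteq> w" using wz by (auto simp: Y2_def)
  then have q: "q \<noteq> 0" "q \<noteq> 1" by (auto simp: q_def)
  define c where "c = (if Im q \<ge> 0 then \<i> else - \<i>) * of_real (R / 2)"
  define \<gamma> where "\<gamma> = (\<lambda>t. (1 - complex_of_real t) * c + complex_of_real t * q)"
  have \<gamma>_nz: "\<gamma> t \<noteq> 0 \<and> \<gamma> t \<noteq> 1" if t: "0 \<le> t" "t \<le> 1" for t
  proof (cases "t = 1")
    case True then show ?thesis using q by (simp add: \<gamma>_def)
  next
    case False
    have "Im (\<gamma> t) = (1 - t) * Im c + t * Im q" by (simp add: \<gamma>_def)
    moreover have "(1 - t) * (R / 2) > 0" using False t R by simp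
    moreover have "t * Im q \<ge> 0" if "Im q \<ge> 0" using t that by simp
    moreover have "t * Im q \<le> 0" if "Im q \<le> 0" using t that by (simp add: mult_nonneg_nonpos)
    ultimately have "Im (\<gamma> t) \<noteq> 0"
      by (auto simp: c_def split: if_splits)
    then show ?thesis by auto
  qed
  define h where "h = (\<lambda>t. m w (w * \<gamma> t) - m' w (w * \<gamma> t))"
  have "h 1 = 0"
  proof (rule param_analytic_identity)
    fix t :: real assume t: "0 \<le> t" "t \<le> 1"
    have "param_analytic \<gamma> t" unfolding \<gamma>_def by (intro param_analytic_intros)
    then have "param_analytic (\<lambda>s. w * \<gamma> s) t" by (intro param_analytic_intros)
    moreover have "(w, w * \<gamma> t) \<in> Y2" using w \<gamma>_nz[OF t] by (auto simp: Y2_def)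
    ultimately show "param_analytic h t"
      using m m' param_analytic_const[of w t] unfolding h_def curve_analytic_def
          by (intro param_analytic_diff) auto
  next
    have "isCont (\<lambda>t. norm (\<gamma> t)) 0" unfolding \<gamma>_def by (intro continuous_intros)
    moreover have "norm (\<gamma> 0) = R / 2" using R by (simp add: \<gamma>_def c_def norm_mult)
    ultimately have lim: "((\<lambda>t. norm (\<gamma> t)) \<longlongrightarrow> R / 2) (nhds 0)"
      by (simp add: isCont_def tendsto_nhds_iff)
    have "\<forall>\<^sub>F t in nhds 0. norm (\<gamma> t) < R" "\<forall>\<^sub>F t in nhds 0. norm (\<gamma> t) > 0"
      by (rule order_tendstoD[OF lim], use R in simp)+
    then show "\<forall>\<^sub>F t in nhds 0. h t = 0"
    proof eventually_elim
      case (elim t)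
      then show ?case using eq[of "w * \<gamma> t" w] w by (simp add: h_def norm_mult mult.commute)
    qed
  qed
  then show ?thesis using w by (simp add: h_def \<gamma>_def q_def)
qed

lemma curve_analyticD:
  "curve_analytic m \<Longrightarrow> param_analytic \<gamma> t \<Longrightarrow> param_analytic \<delta> t \<Longrightarrow> (\<gamma> t, \<delta> t) \<in> Y2 \<Longrightarrow>
     param_analytic (\<lambda>s. m (\<gamma> s) (\<delta> s)) t"
  unfolding curve_analytic_def by blast

lemma curve_analytic_gcor_gen:
  assumes "gcor_data \<alpha>1 \<alpha>2 \<alpha>12 \<beta>1 \<beta>2 \<beta>12 f"
  shows "curve_analytic (\<lambda>w z. gcor_gen \<alpha>1 \<alpha>2 \<alpha>12 \<beta>1 \<beta>2 \<beta>12 f (w, z))"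
  unfolding curve_analytic_def
proof (intro allI impI)
  fix \<gamma> \<delta> t assume \<gamma>: "param_analytic \<gamma> t" and \<delta>: "param_analytic \<delta> t" and Y2: "(\<gamma> t, \<delta> t) \<in> Y2"
  have nz: "\<gamma> t \<noteq> 0" "\<delta> t \<noteq> 0" "\<gamma> t - \<delta> t \<noteq> 0" "\<delta> t / \<gamma> t \<in> - {0, 1}"
    using Y2 by (auto simp: Y2_def)
  have "real_analytic_on f (- {0, 1})" using assms by (auto simp: gcor_data_def F01inf_def)
  then have "param_analytic (\<lambda>s. f (\<delta> s / \<gamma> s)) t"
    by (rule real_analytic_on_compose_param) (use \<gamma> \<delta> nz param_analytic_divide in auto)
  then have an: "param_analytic (\<lambda>s. zpow \<alpha>1 \<beta>1 (\<gamma> s) * zpow \<alpha>2 \<beta>2 (\<delta> s) *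
      zpow \<alpha>12 \<beta>12 (\<gamma> s - \<delta> s) * f (\<delta> s / \<gamma> s)) t"
    using \<gamma> \<delta> nz by (intro param_analytic_mult param_analytic_zpow param_analytic_diff)
  have ev: "\<forall>\<^sub>F s in nhds t. k s \<noteq> 0" if "param_analytic k t" "k t \<noteq> 0" for k
    using param_analytic_isCont[OF that(1)] that(2) tendsto_imp_eventually_ne[of k "k t" "nhds t" 0]
    by (simp add: isCont_def tendsto_nhds_iff)
  have "\<forall>\<^sub>F s in nhds t. \<gamma> s \<noteq> 0" "\<forall>\<^sub>F s in nhds t. \<delta> s \<noteq> 0" "\<forall>\<^sub>F s in nhds t. \<gamma> s - \<delta> s \<noteq> 0"
    by (intro ev[OF \<gamma> nz(1)] ev[OF \<delta> nz(2)] ev[OF param_analytic_diff[OF \<gamma> \<delta>] nz(3)])+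
  then have ev_eq: "\<forall>\<^sub>F s in nhds t. gcor_gen \<alpha>1 \<alpha>2 \<alpha>12 \<beta>1 \<beta>2 \<beta>12 f (\<gamma> s, \<delta> s) =
      zpow \<alpha>1 \<beta>1 (\<gamma> s) * zpow \<alpha>2 \<beta>2 (\<delta> s) * zpow \<alpha>12 \<beta>12 (\<gamma> s - \<delta> s) * f (\<delta> s / \<gamma> s)"
    by eventually_elim (auto simp: gcor_gen_def Y2_def)
  obtain H where H: "H analytic_on {complex_of_real t}" "\<forall>\<^sub>F s in nhds t. zpow \<alpha>1 \<beta>1 (\<gamma> s) *
      zpow \<alpha>2 \<beta>2 (\<delta> s) *
      zpow \<alpha>12 \<beta>12 (\<gamma> s - \<delta> s) * f (\<delta> s / \<gamma> s) = H (complex_of_real s)"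
    using an unfolding param_analytic_def by blast
  from ev_eq H(2) have "\<forall>\<^sub>F s in nhds t. gcor_gen \<alpha>1 \<alpha>2 \<alpha>12 \<beta>1 \<beta>2 \<beta>12 f (\<gamma> s, \<delta> s) =
      H (complex_of_real s)"
    by eventually_elim simp
  then show "param_analytic (\<lambda>s. gcor_gen \<alpha>1 \<alpha>2 \<alpha>12 \<beta>1 \<beta>2 \<beta>12 f (\<gamma> s, \<delta> s)) t"
    using H(1) unfolding param_analytic_def by blast
qed

section \<open>Binomial expansions\<close>

lemma abs_gbinomial_le_pochhammer: "\<bar>a gchoose k\<bar> \<le> pochhammer \<bar>a :: real\<bar> k / fact k"
proof -
  have "\<bar>pochhammer (- a) k\<bar> \<le> pochhammer \<bar>a\<bar> k"
    unfolding pochhammer_prod abs_prod by (rule prod_mono) auto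
  then show ?thesis
    by (simp add: gbinomial_pochhammer abs_mult divide_right_mono)
qed

lemma summable_abs_gbinomial:
  fixes a y :: real
  assumes y: "0 \<le> y" "y < 1"
  shows "(\<lambda>k. \<bar>a gchoose k\<bar> * y ^ k) summable_on UNIV"
    and "(\<Sum>\<^sub>\<infinity>k. \<bar>a gchoose k\<bar> * y ^ k) \<le> (1 - y) powr (- \<bar>a\<bar>)"
proof -
  have "(\<lambda>k. (- \<bar>a\<bar> gchoose k) * (- y) ^ k) sums (1 + - y) powr (- \<bar>a\<bar>)"
    by (rule gen_binomial_real) (use y in auto)
  moreover have "(- \<bar>a\<bar> gchoose k) * (- y) ^ k = pochhammer \<bar>a\<bar> k / fact k * y ^ k" for k
  proof -
    have "(- 1) ^ k * (- y) ^ k = y ^ k" by (simp flip: power_mult_distrib)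
    then show ?thesis by (simp add: gbinomial_pochhammer)
  qed
  ultimately have "(\<lambda>k. pochhammer \<bar>a\<bar> k / fact k * y ^ k) sums (1 - y) powr (- \<bar>a\<bar>)" by simp
  moreover have poch: "pochhammer \<bar>a\<bar> k \<ge> 0" for k by (simp add: pochhammer_prod prod_nonneg)
  ultimately have hs: "((\<lambda>k. pochhammer \<bar>a\<bar> k / fact k * y ^ k) has_sum (1 - y) powr (- \<bar>a\<bar>)) UNIV"
    using y by (intro sums_nonneg_imp_has_sum) auto
  have le: "\<bar>a gchoose k\<bar> * y ^ k \<le> pochhammer \<bar>a\<bar> k / fact k * y ^ k" for k
    using y by (intro mult_right_mono abs_gbinomial_le_pochhammer) auto
  show sm: "(\<lambda>k. \<bar>a gchoose k\<bar> * y ^ k) summable_on UNIV"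
    by (rule summable_on_comparison_test[OF has_sum_imp_summable[OF hs] le]) (use y in auto)
  show "(\<Sum>\<^sub>\<infinity>k. \<bar>a gchoose k\<bar> * y ^ k) \<le> (1 - y) powr (- \<bar>a\<bar>)"
    using infsum_mono[OF sm has_sum_imp_summable[OF hs] le] infsumI[OF hs] by simp
qed

lemma of_real_gbinomial_complex: "complex_of_real (a gchoose k) = (complex_of_real a gchoose k)"
  by (simp add: gbinomial_prod_rev)

lemma has_sum_binomial_powr:
  fixes p :: complex
  assumes "norm p < 1"
  shows "((\<lambda>k. complex_of_real (a gchoose k) * p ^ k) has_sum (1 + p) powr (of_real a)) UNIV"
proof (rule norm_summable_imp_has_sum)
  have "(\<lambda>k. \<bar>a gchoose k\<bar> * norm p ^ k) summable_on UNIV"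
    by (rule summable_abs_gbinomial) (use assms in auto)
  then show "summable (\<lambda>k. norm (complex_of_real (a gchoose k) * p ^ k))"
    by (simp add: norm_mult norm_power summable_on_imp_summable)
  show "(\<lambda>k. complex_of_real (a gchoose k) * p ^ k) sums (1 + p) powr (of_real a)"
    using gen_binomial_complex[OF assms, of "complex_of_real a"]
        by (simp add: of_real_gbinomial_complex)
qed

lemma has_sum_product:
  fixes f :: "'a \<Rightarrow> complex" and g :: "'b \<Rightarrow> complex"
  assumes f: "(f has_sum F) A" and g: "(g has_sum G) B"
  shows "((\<lambda>(x, y). f x * g y) has_sum (F * G)) (A \<times> B)"
proof (rule has_sum_SigmaI)
  show "((\<lambda>y. case (x, y) of (x, y) \<Rightarrow> f x * g y) has_sum f x * G) B" for x
    using has_sum_cmult_right[OF g] by simp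
  show "((\<lambda>x. f x * G) has_sum F * G) A" by (rule has_sum_cmult_left[OF f])
  have fa: "(\<lambda>x. norm (f x)) summable_on A" and ga: "(\<lambda>y. norm (g y)) summable_on B"
    using f g by (simp_all add: has_sum_imp_summable flip: summable_on_iff_abs_summable_on_complex)
  have "(\<lambda>xy. norm (case xy of (x, y) \<Rightarrow> f x * g y)) summable_on A \<times> B"
    by (rule Infinite_Sum.abs_summable_on_Sigma_iff[THEN iffD2])
       (use fa ga in \<open>auto simp: norm_mult infsum_nonneg infsum_cmult_right' intro!:
           summable_on_cmult_left summable_on_cmult_right\<close>)
  then show "(\<lambda>(x, y). f x * g y) summable_on A \<times> B"
    by (rule abs_summable_summable)
qed

lemma zpow_one_plus:
  assumes p: "norm p < 1" and ab: "a - b \<in> \<int>"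
  shows "zpow a b (1 + p) = (1 + p) powr of_real a * (1 + cnj p) powr of_real b"
proof -
  define w where "w = 1 + p"
  have "Re p > - 1" using abs_Re_le_cmod[of p] p by linarith
  then have re: "Re w > 0" by (simp add: w_def)
  then have w0: "w \<noteq> 0" and wR: "w \<notin> \<real>\<^sub>\<le>\<^sub>0" by (auto simp: complex_nonpos_Reals_iff)
  obtain n where n: "a - b = of_int n" using ab by (elim Ints_cases)
  have "w powr of_real a = w powr (of_real b + of_int n)"
  proof -
    have "complex_of_real a = complex_of_real (b + of_int n)" using n
        by (intro arg_cong[of _ _ complex_of_real]) simp
    then show ?thesis by (simp only: of_real_add of_real_of_int_eq)
  qed
  also have "\<dots> = w powr of_real b * w powi n"
    using w0 by (simp add: powr_add powr_of_int power_int_def power_inverse)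
  finally have 1: "w powr of_real a = w powr of_real b * w powi n" .
  have "cnj w powr of_real b = cnj (w powr of_real b)"
    using w0 re by (simp add: cnj_powr)
  then have "w powr of_real b * cnj w powr of_real b =
      complex_of_real ((norm (w powr of_real b))\<^sup>2)"
    by (simp only: complex_norm_square)
  also have "(norm (w powr of_real b))\<^sup>2 = ((cmod w)\<^sup>2) powr b"
    using w0 by (simp add: norm_powr_real_powr' powr_powr power2_eq_square powr_mult)
  finally have 2: "w powr of_real b * cnj w powr of_real b =
      complex_of_real (((cmod w)\<^sup>2) powr b)" .
  have "w powr of_real a * cnj w powr of_real b = zpow a b w"
    unfolding zpow_def 2[symmetric] 1 using n by (simp add: mult_ac)
  then show ?thesis by (simp add: w_def)
qed

text \<open>The coefficient of \<open>p\<^sup>k pbar\<^sup>l\<close> in \<open>(1 + \<epsilon> p)\<^sup>a (1 + \<epsilon> pbar)\<^sup>b\<close>.\<close>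

definition zpow_coeff :: "complex \<Rightarrow> real \<Rightarrow> real \<Rightarrow> nat \<times> nat \<Rightarrow> complex" where
  "zpow_coeff \<epsilon> a b = (\<lambda>(k, l). \<epsilon> ^ (k + l) * complex_of_real ((a gchoose k) * (b gchoose l)))"

lemma has_sum_zpow_one_plus:
  assumes p: "norm p < 1" and ab: "a - b \<in> \<int>" and \<epsilon>: "\<epsilon> = 1 \<or> \<epsilon> = - 1"
  shows "((\<lambda>(k, l). zpow_coeff \<epsilon> a b (k, l) * (p ^ k * cnj p ^ l)) has_sum zpow a b (1 + \<epsilon> * p))
      UNIV"
proof -
  have n: "norm (\<epsilon> * p) < 1" and c: "cnj (\<epsilon> * p) = \<epsilon> * cnj p" using p \<epsilon> by auto
  have n': "norm (\<epsilon> * cnj p) < 1" using n c by (metis complex_mod_cnj)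
  have "((\<lambda>(k, l). complex_of_real (a gchoose k) * (\<epsilon> * p) ^ k * (complex_of_real (b gchoose l) *
      (\<epsilon> * cnj p) ^ l))
      has_sum ((1 + \<epsilon> * p) powr of_real a * (1 + \<epsilon> * cnj p) powr of_real b)) (UNIV \<times> UNIV)"
    by (rule has_sum_product[OF has_sum_binomial_powr[OF n] has_sum_binomial_powr[OF n']])
  then show ?thesis
    unfolding zpow_one_plus[OF n ab] c
    by (simp add: zpow_coeff_def power_mult_distrib power_add mult_ac)
qed

lemma summable_norm_zpow_coeff:
  assumes y: "0 \<le> y" "y < 1" and \<epsilon>: "\<epsilon> = 1 \<or> \<epsilon> = - 1"
  shows "(\<lambda>(k, l). norm (zpow_coeff \<epsilon> a b (k, l)) * y ^ (k + l)) summable_on UNIV"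
    and "(\<Sum>\<^sub>\<infinity>(k, l). norm (zpow_coeff \<epsilon> a b (k, l)) * y ^ (k + l)) \<le> (1 - y) powr (- (\<bar>a\<bar> + \<bar>b\<bar>))"
proof -
  define f where "f = (\<lambda>a k. \<bar>a gchoose k\<bar> * y ^ k)"
  have f: "f a summable_on UNIV" "infsum (f a) UNIV \<le> (1 - y) powr (- \<bar>a\<bar>)" "\<And>k. f a k \<ge> 0" for a
    using summable_abs_gbinomial[OF y, of a] y by (auto simp: f_def)
  have "norm \<epsilon> = 1" using \<epsilon> by auto
  then have eq: "norm (zpow_coeff \<epsilon> a b (k, l)) * y ^ (k + l) = f a k * f b l" for k l
    by (simp add: zpow_coeff_def f_def norm_mult norm_power power_add abs_mult mult_ac)
  have "((\<lambda>(k, l). complex_of_real (f a k) * complex_of_real (f b l)) has_sum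
      (complex_of_real (infsum (f a) UNIV) * complex_of_real (infsum (f b) UNIV))) (UNIV \<times> UNIV)"
    by (intro has_sum_product) (use has_sum_of_real[OF has_sum_infsum[OF f(1)[of a]]]
        has_sum_of_real[OF has_sum_infsum[OF f(1)[of b]]] in auto)
  then have "((\<lambda>x. complex_of_real (case x of (k, l) \<Rightarrow> f a k * f b l)) has_sum
      complex_of_real (infsum (f a) UNIV * infsum (f b) UNIV)) UNIV"
    by (simp add: case_prod_beta')
  then have hs: "((\<lambda>(k, l). f a k * f b l) has_sum (infsum (f a) UNIV * infsum (f b) UNIV)) UNIV"
    by (subst (asm) has_sum_of_real_iff)
  then show "(\<lambda>(k, l). norm (zpow_coeff \<epsilon> a b (k, l)) * y ^ (k + l)) summable_on UNIV"
    unfolding eq by (rule has_sum_imp_summable)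
  have "(\<Sum>\<^sub>\<infinity>(k, l). norm (zpow_coeff \<epsilon> a b (k, l)) * y ^ (k + l)) = infsum (f a) UNIV *
      infsum (f b) UNIV"
    unfolding eq by (rule infsumI[OF hs])
  also have "\<dots> \<le> (1 - y) powr (- \<bar>a\<bar>) * (1 - y) powr (- \<bar>b\<bar>)"
    by (intro mult_mono f infsum_nonneg) auto
  finally show "(\<Sum>\<^sub>\<infinity>(k, l). norm (zpow_coeff \<epsilon> a b (k, l)) * y ^ (k + l)) \<le>
      (1 - y) powr (- (\<bar>a\<bar> + \<bar>b\<bar>))"
    by (simp flip: powr_add)
qed


text \<open>The exponents of a monomial that yields the given one after multiplication by
  \<open>(z/w)\<^sup>k\<close> and the \<open>l\<close>-th power of the conjugate of \<open>z/w\<close>.\<close>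

definition shift2 :: "nat \<times> nat \<Rightarrow> real \<times> real \<times> real \<times> real \<Rightarrow> real \<times> real \<times> real \<times> real" where
  "shift2 = (\<lambda>(k, l) (r, s, r', s'). (r - real k, s - real l, r' + real k, s' + real l))"

lemma shift2_simp [simp]: "shift2 (k, l) (r, s, r', s') =
    (r - real k, s - real l, r' + real k, s' + real l)"
  by (simp add: shift2_def)

lemma finite_shift2_support:
  assumes "supp2 E"
  shows "finite {kl. E (shift2 kl x) \<noteq> 0}"
proof -
  obtain C where C: "\<And>r s r' s'. E (r, s, r', s') \<noteq> 0 \<Longrightarrow> - C \<le> r \<and> - C \<le> s"
    using assms unfolding supp2_def by blast
  obtain r s r' s' where x: "x = (r, s, r', s')" by (cases x)
  have "{kl. E (shift2 kl x) \<noteq> 0} \<subseteq> {..nat \<lceil>r + C\<rceil>} \<times> {..nat \<lceil>s + C\<rceil>}"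
  proof (clarsimp simp: x)
    fix k l assume "E (r - real k, s - real l, r' + real k, s' + real l) \<noteq> 0"
    from C[OF this] have "real k \<le> r + C" "real l \<le> s + C" by auto
    then show "k \<le> nat \<lceil>r + C\<rceil> \<and> l \<le> nat \<lceil>s + C\<rceil>" by linarith
  qed
  then show ?thesis by (rule finite_subset) auto
qed

lemma mono2_shift2:
  assumes "z \<noteq> 0" "w \<noteq> 0" "E (shift2 (k, l) x) \<noteq> 0" "supp2 E"
  shows "mono2 z w (shift2 (k, l) x) * ((z / w) ^ k * cnj (z / w) ^ l) = mono2 z w x"
proof -
  obtain r s r' s' where x: "x = (r, s, r', s')" by (cases x)
  have int: "(r - real k) - (s - real l) \<in> \<int>" "(r' + real k) - (s' + real l) \<in> \<int>"
    using assms(3,4) unfolding supp2_def x by auto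
  then have "r' - s' \<in> \<int>"
    using Ints_diff[OF int(2), of "real k - real l"] by (auto simp: algebra_simps)
  then have w: "zpow (r' + real k) (s' + real l) w = zpow r' s' w * (w ^ k * cnj w ^ l)"
    using assms by (simp add: zpow_add zpow_nat)
  have z: "zpow r s z = zpow (r - real k) (s - real l) z * (z ^ k * cnj z ^ l)"
    using zpow_add[OF assms(1) int(1), of "real k" "real l"] assms(1) by (simp add: zpow_nat)
  show ?thesis
    using assms(1,2) by (simp add: x mono2_def w z power_divide)
qed

text \<open>Multiplication of each monomial \<open>x\<close> of \<open>E\<close> by \<open>(1 + \<epsilon> p)\<^sup>A (1 + \<epsilon> pbar)\<^sup>B\<close>, \<open>p = z / w\<close>,
  expanded in non-negative powers of \<open>p\<close> and \<open>pbar\<close>, where \<open>A\<close> and \<open>B\<close> may depend on \<open>x\<close>.\<close>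

definition binom_transform :: "complex \<Rightarrow> (real \<times> real \<times> real \<times> real \<Rightarrow> real) \<Rightarrow>
    (real \<times> real \<times> real \<times> real \<Rightarrow> real) \<Rightarrow> rseries2 \<Rightarrow> rseries2" where
  "binom_transform \<epsilon> A B E = (\<lambda>x. \<Sum>kl | E (shift2 kl x) \<noteq> 0.
      zpow_coeff \<epsilon> (A (shift2 kl x)) (B (shift2 kl x)) kl * E (shift2 kl x))"

text \<open>Rearrangement of the double series over monomials and binomial expansions. Its absolute
  convergence holds because the moduli of the binomial terms sum to at most
  \<open>(1 - |p|)\<^sup>-\<^sup>|\<^sup>A\<^sup>|\<^sup>-\<^sup>|\<^sup>B\<^sup>|\<close>.\<close>

lemma has_sum_binom_transform:
  assumes z: "z \<noteq> 0" "norm z < norm w" and \<epsilon>: "\<epsilon> = 1 \<or> \<epsilon> = - 1"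
    and E: "supp2 E"
    and AB: "\<And>x. E x \<noteq> 0 \<Longrightarrow> A x - B x \<in> \<int>"
    and sum: "(\<lambda>x. norm (E x * mono2 z w x) * (1 - norm z / norm w) powr (- (\<bar>A x\<bar> + \<bar>B x\<bar>)))
        summable_on UNIV"
    and hs: "((\<lambda>x. E x * mono2 z w x * zpow (A x) (B x) (1 + \<epsilon> * (z / w))) has_sum S) UNIV"
  shows "((\<lambda>x. binom_transform \<epsilon> A B E x * mono2 z w x) has_sum S) UNIV"
proof -
  have w0: "w \<noteq> 0" using z by auto
  define p where "p = z / w"
  define y where "y = norm p"
  have y: "0 \<le> y" "y < 1" "norm p < 1" using z w0 by (auto simp: y_def p_def norm_divide)
  define f where "f = (\<lambda>(x, kl). E x * mono2 z w x * (zpow_coeff \<epsilon> (A x) (B x) kl *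
      (p ^ fst kl * cnj p ^ snd kl)))"
  have nf: "norm (f (x, (k, l))) = norm (E x * mono2 z w x) *
      (norm (zpow_coeff \<epsilon> (A x) (B x) (k, l)) * y ^ (k + l))" for x k l
    by (simp add: f_def y_def norm_mult norm_power power_add)
  have inner: "((\<lambda>kl. f (x, kl)) has_sum (E x * mono2 z w x * zpow (A x) (B x) (1 + \<epsilon> * p))) UNIV"
      for x
  proof (cases "E x = 0")
    case False
    from has_sum_cmult_right[OF has_sum_zpow_one_plus[OF y(3) AB[OF False] \<epsilon>], of "E x *
        mono2 z w x"]
    show ?thesis by (simp add: f_def case_prod_beta')
  qed (simp add: f_def)
  have abs: "(\<lambda>xkl. norm (f xkl)) summable_on UNIV \<times> UNIV"
  proof (rule Infinite_Sum.abs_summable_on_Sigma_iff[THEN iffD2], intro conjI ballI)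
    fix x
    have "(\<lambda>kl. norm (E x * mono2 z w x) *
        (case kl of (k, l) \<Rightarrow> norm (zpow_coeff \<epsilon> (A x) (B x) (k, l)) * y ^ (k + l))) summable_on
        UNIV"
      by (intro summable_on_cmult_right summable_norm_zpow_coeff y \<epsilon>)
    moreover have "norm (E x * mono2 z w x) *
        (case kl of (k, l) \<Rightarrow> norm (zpow_coeff \<epsilon> (A x) (B x) (k, l)) * y ^ (k + l)) =
        norm (f (x, kl))" for kl
      by (cases kl) (simp add: nf)
    ultimately show "(\<lambda>kl. norm (f (x, kl))) summable_on UNIV" by simp
  next
    have "(\<Sum>\<^sub>\<infinity>kl. norm (f (x, kl))) \<le> norm (E x * mono2 z w x) * (1 - y) powr (- (\<bar>A x\<bar> + \<bar>B x\<bar>))"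
        for x
    proof -
      have "(\<Sum>\<^sub>\<infinity>kl. norm (f (x, kl))) = (\<Sum>\<^sub>\<infinity>kl. norm (E x * mono2 z w x) *
          (case kl of (k, l) \<Rightarrow> norm (zpow_coeff \<epsilon> (A x) (B x) (k, l)) * y ^ (k + l)))"
        by (rule infsum_cong) (auto simp: nf)
      also have "\<dots> = norm (E x * mono2 z w x) *
          (\<Sum>\<^sub>\<infinity>(k, l). norm (zpow_coeff \<epsilon> (A x) (B x) (k, l)) * y ^ (k + l))"
        by (rule infsum_cmult_right')
      also have "\<dots> \<le> norm (E x * mono2 z w x) * (1 - y) powr (- (\<bar>A x\<bar> + \<bar>B x\<bar>))"
        by (intro mult_left_mono summable_norm_zpow_coeff y \<epsilon>) auto
      finally show ?thesis .
    qed
    then show "(\<lambda>x. norm (\<Sum>\<^sub>\<infinity>kl. norm (f (x, kl)))) summable_on UNIV"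
      by (intro summable_on_comparison_test[OF sum]) (auto simp: infsum_nonneg y_def p_def
          norm_divide)
  qed
  have f_sum: "(f has_sum S) (UNIV \<times> UNIV)"
    by (rule has_sum_SigmaI[OF inner]) (use hs abs_summable_summable[OF abs] in \<open>simp_all add:
        p_def\<close>)
  have "((\<lambda>(x, kl). f (shift2 kl x, kl)) has_sum S) (UNIV \<times> UNIV) \<longleftrightarrow> (f has_sum S) (UNIV \<times> UNIV)"
    by (rule has_sum_reindex_bij_witness[where
          j = "\<lambda>(x, kl). (shift2 kl x, kl)" and
          i = "\<lambda>((r, s, r', s'), (k, l)). ((r + real k, s + real l, r' - real k, s' - real l),
              (k, l))"]) auto
  then have g_sum: "((\<lambda>(x, kl). f (shift2 kl x, kl)) has_sum S) (UNIV \<times> UNIV)" using f_sum by simp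
  show ?thesis
  proof (rule has_sum_SigmaD[OF g_sum])
    fix x
    show "((\<lambda>kl. case (x, kl) of (x, kl) \<Rightarrow> f (shift2 kl x, kl)) has_sum
        binom_transform \<epsilon> A B E x * mono2 z w x) UNIV"
    proof (rule has_sum_finite_neutralI[OF finite_shift2_support[OF E, of x]])
      have "f (shift2 kl x, kl) = zpow_coeff \<epsilon> (A (shift2 kl x)) (B (shift2 kl x)) kl *
          E (shift2 kl x) * mono2 z w x"
        if "E (shift2 kl x) \<noteq> 0" for kl
      proof -
        obtain k l where kl: "kl = (k, l)" by (cases kl)
        have "f (shift2 kl x, kl) = zpow_coeff \<epsilon> (A (shift2 kl x)) (B (shift2 kl x)) kl *
            E (shift2 kl x) *
            (mono2 z w (shift2 (k, l) x) * ((z / w) ^ k * cnj (z / w) ^ l))"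
          by (simp only: f_def p_def kl prod.case fst_conv snd_conv mult_ac)
        also have "mono2 z w (shift2 (k, l) x) * ((z / w) ^ k * cnj (z / w) ^ l) = mono2 z w x"
          by (rule mono2_shift2[OF z(1) w0 that[unfolded kl] E])
        finally show ?thesis .
      qed
      then show "binom_transform \<epsilon> A B E x * mono2 z w x =
          (\<Sum>kl | E (shift2 kl x) \<noteq> 0. case (x, kl) of (x, kl) \<Rightarrow> f (shift2 kl x, kl))"
        by (simp add: binom_transform_def sum_distrib_right)
    qed (auto simp: f_def)
  qed
qed

lemma supp2_binom_transform:
  assumes "supp2 E"
  shows "supp2 (binom_transform \<epsilon> A B E)"
proof -
  obtain C where C: "\<And>r s r' s'. E (r, s, r', s') \<noteq> 0 \<Longrightarrow>
      r - s \<in> \<int> \<and> r' - s' \<in> \<int> \<and> - C \<le> r \<and> - C \<le> s \<and> \<bar>r + r'\<bar> \<le> C \<and> \<bar>s + s'\<bar> \<le> C"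
    using assms unfolding supp2_def by blast
  show ?thesis unfolding supp2_def
  proof (intro exI[of _ C] allI impI)
    fix r s r' s' assume "binom_transform \<epsilon> A B E (r, s, r', s') \<noteq> 0"
    then have "\<exists>kl. E (shift2 kl (r, s, r', s')) \<noteq> 0"
      unfolding binom_transform_def by (metis (mono_tags, lifting) mult_zero_right sum.neutral)
    then obtain k l where kl: "E (r - real k, s - real l, r' + real k, s' + real l) \<noteq> 0" by auto
    note c = C[OF kl]
    have "r - s = (r - real k - (s - real l)) + (real k - real l)" "r' - s' =
        (r' + real k - (s' + real l)) - (real k - real l)"
      by simp_all
    then have "r - s \<in> \<int>" "r' - s' \<in> \<int>" using c by (metis Ints_add Ints_diff Ints_of_nat)+
    then show "r - s \<in> \<int> \<and> r' - s' \<in> \<int> \<and> - C \<le> r \<and> - C \<le> s \<and> \<bar>r + r'\<bar> \<le> C \<and> \<bar>s + s'\<bar> \<le> C"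
      using c by auto
  qed
qed

lemma expands2_summable:
  assumes "expands2 E m"
  shows "\<exists>R>0. R \<le> 1 \<and> (\<forall>z w. z \<noteq> 0 \<longrightarrow> norm z < R * norm w \<longrightarrow>
      ((\<lambda>x. E x * mono2 z w x) has_sum m z w) UNIV \<and> (\<lambda>x. norm (E x * mono2 z w x)) summable_on
          UNIV)"
proof -
  obtain R where R: "R > 0" "\<And>z w. z \<noteq> 0 \<Longrightarrow> norm z < R * norm w \<Longrightarrow>
      ((\<lambda>x. E x * mono2 z w x) has_sum m z w) UNIV"
    using assms unfolding expands2_def by blast
  show ?thesis
  proof (intro exI[of _ "min R 1"] conjI allI impI)
    fix z w :: complex assume z: "z \<noteq> 0" "norm z < min R 1 * norm w"
    have "min R 1 * norm w \<le> R * norm w" by (intro mult_right_mono) auto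
    then show "((\<lambda>x. E x * mono2 z w x) has_sum m z w) UNIV" using R(2) z by auto
    from has_sum_imp_summable[OF this]
    show "(\<lambda>x. norm (E x * mono2 z w x)) summable_on UNIV"
      by (simp only: summable_on_iff_abs_summable_on_complex)
  qed (use R(1) in auto)
qed

text \<open>Multiplication by a fixed power of \<open>1 \<plusminus> z / w\<close>.\<close>

lemma expands2_mult_zpow_one_plus:
  assumes E: "expands2 E m" and ab: "a - b \<in> \<int>" and \<epsilon>: "\<epsilon> = 1 \<or> \<epsilon> = - 1"
  shows "expands2 (binom_transform \<epsilon> (\<lambda>_. a) (\<lambda>_. b) E) (\<lambda>z w. zpow a b (1 + \<epsilon> * (z / w)) * m z w)"
proof -
  obtain R where R: "R > 0" "R \<le> 1" "\<And>z w. z \<noteq> 0 \<Longrightarrow> norm z < R * norm w \<Longrightarrow>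
      ((\<lambda>x. E x * mono2 z w x) has_sum m z w) UNIV \<and> (\<lambda>x. norm (E x * mono2 z w x)) summable_on
          UNIV"
    using expands2_summable[OF E] by blast
  have supp: "supp2 E" using E by (simp add: expands2_def)
  have "((\<lambda>x. binom_transform \<epsilon> (\<lambda>_. a) (\<lambda>_. b) E x * mono2 z w x) has_sum
      (zpow a b (1 + \<epsilon> * (z / w)) * m z w)) UNIV" if z: "z \<noteq> 0" "norm z < R * norm w" for z w
  proof (rule has_sum_binom_transform[OF z(1) _ \<epsilon> supp ab])
    have "R * norm w \<le> 1 * norm w" using R(2) by (intro mult_right_mono) auto
    then show "norm z < norm w" using z(2) by linarith
    show "(\<lambda>x. norm (E x * mono2 z w x) * (1 - norm z / norm w) powr (- (\<bar>a\<bar> + \<bar>b\<bar>))) summable_on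
        UNIV"
      by (intro summable_on_cmult_left) (use R(3)[OF z] in auto)
    show "((\<lambda>x. E x * mono2 z w x * zpow a b (1 + \<epsilon> * (z / w))) has_sum
        (zpow a b (1 + \<epsilon> * (z / w)) * m z w)) UNIV"
      using has_sum_cmult_left[OF conjunct1[OF R(3)[OF z]], of "zpow a b (1 + \<epsilon> * (z / w))"]
      by (simp add: mult.commute)
  qed
  then show ?thesis
    unfolding expands2_def using supp2_binom_transform[OF supp] R(1) by blast
qed

text \<open>Re-expansion after the substitution \<open>w \<mapsto> w - z\<close>. Since the total degrees are bounded and the
  exponents of \<open>z\<close> are bounded below, the exponents of \<open>w\<close> are bounded above by some \<open>C\<close>; hence
  \<open>(1 - |z/w|)\<^sup>-\<^sup>|\<^sup>a\<^sup>|\<close> is at most \<open>(1 - |z/w|)\<^sup>a\<close> times a constant, and absolute convergence at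
  \<open>(z, (1 - |z/w|) w)\<close> suffices.\<close>

lemma expands2_translate:
  assumes E: "expands2 E m"
  shows "expands2 (binom_transform (- 1) (\<lambda>(r, s, r', s'). r') (\<lambda>(r, s, r', s'). s') E)
      (\<lambda>z w. m z (w - z))"
proof -
  obtain R where R: "R > 0" "R \<le> 1" "\<And>z w. z \<noteq> 0 \<Longrightarrow> norm z < R * norm w \<Longrightarrow>
      ((\<lambda>x. E x * mono2 z w x) has_sum m z w) UNIV \<and> (\<lambda>x. norm (E x * mono2 z w x)) summable_on
          UNIV"
    using expands2_summable[OF E] by blast
  have supp: "supp2 E" using E by (simp add: expands2_def)
  then obtain C where C: "\<And>r s r' s'. E (r, s, r', s') \<noteq> 0 \<Longrightarrow>
      r - s \<in> \<int> \<and> r' - s' \<in> \<int> \<and> - C \<le> r \<and> - C \<le> s \<and> \<bar>r + r'\<bar> \<le> C \<and> \<bar>s + s'\<bar> \<le> C"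
    unfolding supp2_def by blast
  have "((\<lambda>x. binom_transform (- 1) (\<lambda>(r, s, r', s'). r') (\<lambda>(r, s, r', s'). s') E x *
      mono2 z w x) has_sum
      m z (w - z)) UNIV" if z: "z \<noteq> 0" "norm z < R / 2 * norm w" for z w
  proof (rule has_sum_binom_transform[OF z(1) _ _ supp])
    have w: "w \<noteq> 0" using z by auto
    have "R / 2 * norm w \<le> 1 / 2 * norm w" using R(2) by (intro mult_right_mono) auto
    then have zw: "norm z < norm w / 2" using z(2) by linarith
    then show "norm z < norm w" using norm_ge_zero[of w] by linarith
    define q where "q = 1 - norm z / norm w"
    have "norm z / norm w < 1 / 2" using zw w by (simp add: field_simps)
    moreover have "0 \<le> norm z / norm w" by simp
    ultimately have q: "0 < q" "q \<le> 1" "q > 1 / 2" unfolding q_def by linarith+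
    have small: "norm z < R * (c * norm w)" if "c \<ge> 1/2" for c
    proof -
      have "R / 2 * norm w \<le> R * (c * norm w)"
        using R(1) that mult_right_mono[of "1/2" c "R * norm w"] by (simp add: mult_ac)
      then show ?thesis using z(2) by linarith
    qed
    show "(case x of (r, s, r', s') \<Rightarrow> r') - (case x of (r, s, r', s') \<Rightarrow> s') \<in> \<int>" if "E x \<noteq> 0" for x
      using C that by (cases x) auto
    show "(\<lambda>x. norm (E x * mono2 z w x) * (1 - norm z / norm w) powr
        - (\<bar>case x of (r, s, r', s') \<Rightarrow> r'\<bar> + \<bar>case x of (r, s, r', s') \<Rightarrow> s'\<bar>)) summable_on UNIV"
    proof (rule summable_on_comparison_test)
      have "norm z < R * norm (of_real q * w)" using small[of q] q by (simp add: norm_mult)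
      then show "(\<lambda>x. norm (E x * mono2 z (of_real q * w) x) * q powr (- 8 * \<bar>C\<bar>)) summable_on UNIV"
        by (intro summable_on_cmult_left) (use R(3)[OF z(1)] in auto)
      show "norm (E x * mono2 z w x) * (1 - norm z / norm w) powr
          - (\<bar>case x of (r, s, r', s') \<Rightarrow> r'\<bar> + \<bar>case x of (r, s, r', s') \<Rightarrow> s'\<bar>)
          \<le> norm (E x * mono2 z (of_real q * w) x) * q powr (- 8 * \<bar>C\<bar>)" for x
      proof (cases "E x = 0")
        case False
        obtain r s r' s' where x: "x = (r, s, r', s')" by (cases x)
        note c = C[OF False[unfolded x]]
        have eq: "mono2 z (of_real q * w) x = of_real (q powr (r' + s')) * mono2 z w x"
          using c q(1) by (simp add: x mono2_def zpow_mult_base zpow_of_real)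
        moreover have "q powr (- (\<bar>r'\<bar> + \<bar>s'\<bar>)) \<le> q powr (r' + s' + (- 8 * \<bar>C\<bar>))"
        proof (rule powr_mono')
          have "r' \<le> 2 * \<bar>C\<bar>" "s' \<le> 2 * \<bar>C\<bar>" using c by linarith+
          then show "r' + s' + (- 8 * \<bar>C\<bar>) \<le> - (\<bar>r'\<bar> + \<bar>s'\<bar>)" by linarith
        qed (use q in auto)
        ultimately have "norm (E x * mono2 z w x) * q powr (- (\<bar>r'\<bar> + \<bar>s'\<bar>)) \<le>
            norm (E x * mono2 z w x) * q powr (r' + s' + (- 8 * \<bar>C\<bar>))"
          by (intro mult_left_mono) auto
        also have "\<dots> = norm (E x * mono2 z (of_real q * w) x) * q powr (- 8 * \<bar>C\<bar>)"
          using powr_add[of q "r' + s'" "- 8 * \<bar>C\<bar>"] unfolding eq by (simp add: norm_mult)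
        finally show ?thesis by (simp only: x prod.case q_def)
      qed simp
    qed auto
    have wz: "w - z = w * (1 - z / w)" using w by (simp add: algebra_simps)
    have "norm z < R * norm (w - z)"
    proof -
      have "R * (1/2 * norm w) \<le> R * norm (w - z)"
        using R(1) zw norm_triangle_ineq2[of w z] by (intro mult_left_mono) auto
      then show ?thesis using small[of "1/2"] by linarith
    qed
    then have "((\<lambda>x. E x * mono2 z (w - z) x) has_sum m z (w - z)) UNIV" using R(3)[OF z(1)]
        by blast
    moreover have "mono2 z (w - z) x = mono2 z w x * zpow (case x of (r, s, r', s') \<Rightarrow> r')
        (case x of (r, s, r', s') \<Rightarrow> s')
        (1 + - 1 * (z / w))" for x
      by (cases x) (simp add: mono2_def wz zpow_mult_base)
    ultimately show
        "((\<lambda>x. E x * mono2 z w x * zpow (case x of (r, s, r', s') \<Rightarrow> r') (case x of (r, s, r', s')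
        \<Rightarrow> s')
        (1 + - 1 * (z / w))) has_sum m z (w - z)) UNIV"
      by (simp add: mult.assoc)
  qed auto
  then show ?thesis
    unfolding expands2_def using supp2_binom_transform[OF supp] R(1)
    by (intro conjI exI[of _ "R/2"]) auto
qed



section \<open>Convergence of the expansions of correlation functions\<close>

text \<open>Pointwise convergence of a series to \<open>g\<close> in a punctured disc around \<open>0\<close>.\<close>

definition series_at_0 :: "(complex \<Rightarrow> complex) \<Rightarrow> complex rseries \<Rightarrow> bool" where
  "series_at_0 g s \<longleftrightarrow> s \<in> rlaurent_series \<and> (\<exists>R>0. \<forall>p. p \<noteq> 0 \<longrightarrow> norm p < R \<longrightarrow>
      ((\<lambda>(r, t). s (r, t) * zpow r t p) has_sum g p) UNIV)"

lemma expands_at_0_imp_series_at_0: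
  assumes "expands_at_0 g s"
  shows "series_at_0 g s"
proof -
  obtain R where R: "R > 0" and lim: "\<And>K. compact K \<Longrightarrow> K \<subseteq> ball 0 R - {0} \<Longrightarrow>
      uniform_limit K (\<lambda>S p. \<Sum>(r, t)\<in>S. s (r, t) * zpow r t p) g (finite_subsets_at_top UNIV)"
    using assms unfolding expands_at_0_def by blast
  have "((\<lambda>(r, t). s (r, t) * zpow r t p) has_sum g p) UNIV" if "p \<noteq> 0" "norm p < R" for p
    unfolding has_sum_def using tendsto_uniform_limitI[OF lim[of "{p}"], of p] that by auto
  then show ?thesis using assms R unfolding series_at_0_def expands_at_0_def by blast
qed

lemma series_at_0_reflect:
  assumes "series_at_0 g s"
  shows "series_at_0 (\<lambda>p. g (- p)) (\<lambda>(r, t). (- 1) powi \<lfloor>r - t\<rfloor> * s (r, t))"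
proof -
  obtain R where R: "R > 0" "\<And>p. p \<noteq> 0 \<Longrightarrow> norm p < R \<Longrightarrow>
      ((\<lambda>(r, t). s (r, t) * zpow r t p) has_sum g p) UNIV"
    using assms unfolding series_at_0_def by blast
  have "((\<lambda>(r, t). (case (r, t) of (r, t) \<Rightarrow> (- 1) powi \<lfloor>r - t\<rfloor> * s (r, t)) * zpow r t p) has_sum
      g (- p)) UNIV"
    if "p \<noteq> 0" "norm p < R" for p
  proof -
    have "(\<lambda>(r, t). s (r, t) * zpow r t (- p)) =
        (\<lambda>(r, t). (case (r, t) of (r, t) \<Rightarrow> (- 1) powi \<lfloor>r - t\<rfloor> * s (r, t)) * zpow r t p)"
      by (auto simp: zpow_minus)
    moreover have "((\<lambda>(r, t). s (r, t) * zpow r t (- p)) has_sum g (- p)) UNIV"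
      using that by (intro R(2)) auto
    ultimately show ?thesis by (simp only:)
  qed
  moreover have "(\<lambda>(r, t). (- 1) powi \<lfloor>r - t\<rfloor> * s (r, t)) \<in> rlaurent_series"
  proof -
    have "{x. (case x of (r, t) \<Rightarrow> (- 1) powi \<lfloor>r - t\<rfloor> * s (r, t)) \<noteq> 0} = {x. s x \<noteq> 0}" by auto
    then show ?thesis
      using assms unfolding series_at_0_def rlaurent_series_def rpower_series_def by simp
  qed
  ultimately show ?thesis unfolding series_at_0_def using R(1) by blast
qed

lemma zpow_diff_exponents:
  assumes "z \<noteq> 0" "w \<noteq> 0" "r - t \<in> \<int>" "a - b \<in> \<int>" "c - d \<in> \<int>"
  shows "zpow (r + a) (t + b) z * zpow (c - r) (d - t) w = zpow a b z * zpow c d w *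
      zpow r t (z / w)"
proof -
  have "c - r - (d - t) \<in> \<int>" using Ints_diff[OF assms(5,3)] by (simp add: algebra_simps)
  from zpow_add[OF assms(2) this, of r t]
  have w: "zpow c d w = zpow (c - r) (d - t) w * zpow r t w" by simp
  have "zpow r t z = zpow r t (z / w) * zpow r t w"
    using assms(2) zpow_mult_base[of r t "z / w" w] by simp
  then show ?thesis using zpow_add[OF assms(1,3), of a b] by (simp add: w)
qed

text \<open>The series of \<open>z\<^sup>\<rho> zbar\<^sup>\<sigma> w\<^sup>A\<^sup>-\<^sup>\<rho> wbar\<^sup>B\<^sup>-\<^sup>\<sigma> g(z / w)\<close>, which is homogeneous of degree
  \<open>(A, B)\<close>.\<close>

lemma expands2_monomial_series:
  assumes s: "series_at_0 g s" and int: "\<rho> - \<sigma> \<in> \<int>" "(A - \<rho>) - (B - \<sigma>) \<in> \<int>"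
  shows "expands2 (\<lambda>(r, t, r', t'). if r + r' = A \<and> t + t' = B then s (r - \<rho>, t - \<sigma>) else 0)
      (\<lambda>z w. zpow \<rho> \<sigma> z * zpow (A - \<rho>) (B - \<sigma>) w * g (z / w))"
    (is "expands2 ?E ?m")
proof -
  obtain R where R: "R > 0" "\<And>p. p \<noteq> 0 \<Longrightarrow> norm p < R \<Longrightarrow>
      ((\<lambda>(r, t). s (r, t) * zpow r t p) has_sum g p) UNIV"
    using s unfolding series_at_0_def by blast
  obtain N where N: "\<And>r t. s (r, t) \<noteq> 0 \<Longrightarrow> r - t \<in> \<int> \<and> r \<ge> N \<and> t \<ge> N"
    using s unfolding series_at_0_def rlaurent_series_def rpower_series_def by blast
  have "supp2 ?E" unfolding supp2_def
  proof (intro exI[of _ "\<bar>N\<bar> + \<bar>\<rho>\<bar> + \<bar>\<sigma>\<bar> + \<bar>A\<bar> + \<bar>B\<bar>"] allI impI)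
    fix r t r' t' assume "?E (r, t, r', t') \<noteq> 0"
    then have AB: "r' = A - r" "t' = B - t" and "s (r - \<rho>, t - \<sigma>) \<noteq> 0" by (auto split: if_splits)
    note n = N[OF this(3)]
    have 1: "r - t \<in> \<int>" using Ints_add[OF conjunct1[OF n] int(1)] by (simp add: algebra_simps)
    have "r' - t' \<in> \<int>" using Ints_diff[OF Ints_add[OF int] 1] by (simp add: AB algebra_simps)
    with 1 show "r - t \<in> \<int> \<and> r' - t' \<in> \<int> \<and> - (\<bar>N\<bar> + \<bar>\<rho>\<bar> + \<bar>\<sigma>\<bar> + \<bar>A\<bar> + \<bar>B\<bar>) \<le> r \<and>
        - (\<bar>N\<bar> + \<bar>\<rho>\<bar> + \<bar>\<sigma>\<bar> + \<bar>A\<bar> + \<bar>B\<bar>) \<le> t \<and> \<bar>r + r'\<bar> \<le> \<bar>N\<bar> + \<bar>\<rho>\<bar> + \<bar>\<sigma>\<bar> + \<bar>A\<bar> + \<bar>B\<bar> \<and>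
        \<bar>t + t'\<bar> \<le> \<bar>N\<bar> + \<bar>\<rho>\<bar> + \<bar>\<sigma>\<bar> + \<bar>A\<bar> + \<bar>B\<bar>"
      using n by (auto simp: AB)
  qed
  moreover have "((\<lambda>x. ?E x * mono2 z w x) has_sum ?m z w) UNIV" if z: "z \<noteq> 0" "norm z < R *
      norm w" for z w
  proof -
    have w: "w \<noteq> 0" using z by auto
    define h where "h = (\<lambda>(r, t). (r + \<rho>, t + \<sigma>, (A - \<rho>) - r, (B - \<sigma>) - t))"
    have inj: "inj h" by (auto simp: h_def inj_def)
    have "norm (z / w) < R" using z w by (simp add: norm_divide field_simps)
    then have "((\<lambda>(r, t). s (r, t) * zpow r t (z / w)) has_sum g (z / w)) UNIV"
      using z(1) w by (intro R(2)) auto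
    from has_sum_cmult_right[OF this, of "zpow \<rho> \<sigma> z * zpow (A - \<rho>) (B - \<sigma>) w"]
    have "((\<lambda>x. ?E (h x) * mono2 z w (h x)) has_sum ?m z w) UNIV"
    proof (rule has_sum_cong[THEN iffD1, rotated])
      fix x :: "real \<times> real"
      obtain r t where x: "x = (r, t)" by (cases x)
      show "zpow \<rho> \<sigma> z * zpow (A - \<rho>) (B - \<sigma>) w * (case x of (r, t) \<Rightarrow> s (r, t) * zpow r t (z / w)) =
          ?E (h x) * mono2 z w (h x)"
      proof (cases "s (r, t) = 0")
        case False
        then have "r - t \<in> \<int>" using N by blast
        from zpow_diff_exponents[OF z(1) w this int(1,2)]
        show ?thesis by (simp add: x h_def mono2_def)
      qed (simp add: x h_def)
    qed
    then have "((\<lambda>x. ?E x * mono2 z w x) has_sum ?m z w) (range h)"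
      using has_sum_reindex[OF inj, of "\<lambda>x. ?E x * mono2 z w x"] by (simp add: o_def)
    then show ?thesis
    proof (rule has_sum_cong_neutral[THEN iffD1, rotated -1])
      fix x assume "x \<in> UNIV - range h"
      obtain r t r' t' where x: "x = (r, t, r', t')" by (cases x)
      have "x = h (r - \<rho>, t - \<sigma>)" if "r + r' = A" "t + t' = B" using that by (auto simp: x h_def)
      then show "?E x * mono2 z w x = 0" using \<open>x \<in> UNIV - range h\<close> by (auto simp: x)
    qed auto
  qed
  ultimately show ?thesis unfolding expands2_def using R(1) by blast
qed

lemma expands2_monomial_binom_mult:
  assumes s: "series_at_0 g s" and int: "\<rho> - \<sigma> \<in> \<int>" "(A - \<rho>) - (B - \<sigma>) \<in> \<int>" "a - b \<in> \<int>"
    and \<epsilon>: "\<epsilon> = 1 \<or> \<epsilon> = - 1"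
  shows "expands2 (\<lambda>(r, t, r', t'). if r + r' = A \<and> t + t' =
      B then binom_mult \<epsilon> a b s (r - \<rho>, t - \<sigma>) else 0)
      (\<lambda>z w. zpow a b (1 + \<epsilon> * (z / w)) * (zpow \<rho> \<sigma> z * zpow (A - \<rho>) (B - \<sigma>) w * g (z / w)))"
proof -
  define E where "E = (\<lambda>(r, t, r', t'). if r + r' = A \<and> t + t' = B then s (r - \<rho>, t - \<sigma>) else 0)"
  have "binom_transform \<epsilon> (\<lambda>_. a) (\<lambda>_. b) E = (\<lambda>(r, t, r', t'). if r + r' = A \<and> t + t' = B
      then binom_mult \<epsilon> a b s (r - \<rho>, t - \<sigma>) else 0)"
  proof (rule ext, clarify)
    fix r t r' t' :: real
    have "E (shift2 kl (r, t, r', t')) = (if r + r' = A \<and> t + t' = B then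
        s (r - \<rho> - real (fst kl), t - \<sigma> - real (snd kl)) else 0)" for kl
      by (cases kl) (simp add: E_def algebra_simps)
    then show "binom_transform \<epsilon> (\<lambda>_. a) (\<lambda>_. b) E (r, t, r', t') = (if r + r' = A \<and> t + t' = B
      then binom_mult \<epsilon> a b s (r - \<rho>, t - \<sigma>) else 0)"
      by (simp add: binom_transform_def binom_mult_def zpow_coeff_def case_prod_beta')
  qed
  then show ?thesis
    using expands2_mult_zpow_one_plus[OF expands2_monomial_series[OF s int(1,2)] int(3) \<epsilon>]
    unfolding E_def by simp
qed

lemma zpow_mult_one_plus:
  assumes "w \<noteq> 0" "c - d \<in> \<int>" "a - b \<in> \<int>"
  shows "zpow (c + a) (d + b) w * zpow a b (1 + z / w) = zpow c d w * zpow a b (w + z)"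
proof -
  have "w + z = w * (1 + z / w)" using assms(1) by (simp add: algebra_simps)
  then show ?thesis using assms by (simp add: zpow_add zpow_mult_base)
qed

text \<open>The factor \<open>1\<close> is the radius \<open>R\<close> of \<open>expands2_cong\<close>.\<close>

lemma norm_less_imp_Y2: "z \<noteq> 0 \<Longrightarrow> norm z < 1 * norm w \<Longrightarrow> z \<noteq> w \<and> w \<noteq> (0 :: complex) \<and> w + z \<noteq> 0"
proof -
  assume z: "z \<noteq> 0" "norm z < 1 * norm w"
  then have "w + z \<noteq> 0" by (metis add_eq_0_iff less_irrefl mult_1 norm_minus_cancel)
  then show "z \<noteq> w \<and> w \<noteq> 0 \<and> w + z \<noteq> 0" using z by auto
qed

lemma expands2_gen_exp_12:
  assumes d: "gcor_data \<alpha>1 \<alpha>2 \<alpha>12 \<beta>1 \<beta>2 \<beta>12 f" and j: "is_j (\<lambda>q. q) f s"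
  shows "expands2 (\<lambda>(r, t, r', t'). gen_exp_12 \<alpha>1 \<alpha>2 \<alpha>12 \<beta>1 \<beta>2 \<beta>12 s (r', t', r, t))
      (\<lambda>z w. gcor_gen \<alpha>1 \<alpha>2 \<alpha>12 \<beta>1 \<beta>2 \<beta>12 f (w, z))"
proof -
  have s: "series_at_0 f s"
    using expands_at_0_imp_series_at_0 j by (simp add: is_j_def comp_def)
  have int: "\<alpha>1 - \<beta>1 \<in> \<int>" "\<alpha>2 - \<beta>2 \<in> \<int>" "\<alpha>12 - \<beta>12 \<in> \<int>" using d by (auto simp: gcor_data_def)
  have int': "(\<alpha>1 + \<alpha>2 + \<alpha>12 - \<alpha>2) - (\<beta>1 + \<beta>2 + \<beta>12 - \<beta>2) \<in> \<int>"
    using Ints_add[OF int(1,3)] by (simp add: algebra_simps)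
  have "(\<lambda>(r, t, r', t'). gen_exp_12 \<alpha>1 \<alpha>2 \<alpha>12 \<beta>1 \<beta>2 \<beta>12 s (r', t', r, t)) =
      (\<lambda>(r, t, r', t'). if r + r' = \<alpha>1 + \<alpha>2 + \<alpha>12 \<and> t + t' = \<beta>1 + \<beta>2 + \<beta>12
         then binom_mult (- 1) \<alpha>12 \<beta>12 s (r - \<alpha>2, t - \<beta>2) else 0)"
    by (auto simp: gen_exp_12_def add.commute)
  then show ?thesis
  proof (simp only:, intro expands2_cong[OF expands2_monomial_binom_mult[OF s int(2) int' int(3)]
      zero_less_one])
    fix z w :: complex assume zw: "z \<noteq> 0" "norm z < 1 * norm w"
    have "zpow (\<alpha>1 + \<alpha>12) (\<beta>1 + \<beta>12) w * zpow \<alpha>12 \<beta>12 (1 + - z / w) = zpow \<alpha>1 \<beta>1 w *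
        zpow \<alpha>12 \<beta>12 (w + - z)"
      using zw by (intro zpow_mult_one_plus int) auto
    then show "zpow \<alpha>12 \<beta>12 (1 + - 1 * (z / w)) * (zpow \<alpha>2 \<beta>2 z *
        zpow (\<alpha>1 + \<alpha>2 + \<alpha>12 - \<alpha>2) (\<beta>1 + \<beta>2 + \<beta>12 - \<beta>2) w * f (z / w)) =
        gcor_gen \<alpha>1 \<alpha>2 \<alpha>12 \<beta>1 \<beta>2 \<beta>12 f (w, z)"
      using norm_less_imp_Y2[OF zw] zw by (auto simp: gcor_gen_def Y2_def algebra_simps)
  qed auto
qed

lemma expands2_gen_exp_21:
  assumes d: "gcor_data \<alpha>1 \<alpha>2 \<alpha>12 \<beta>1 \<beta>2 \<beta>12 f" and j: "is_j (\<lambda>q. 1 / q) f s"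
  shows "expands2 (gen_exp_21 \<alpha>1 \<alpha>2 \<alpha>12 \<beta>1 \<beta>2 \<beta>12 s)
      (\<lambda>z w. gcor_gen \<alpha>1 \<alpha>2 \<alpha>12 \<beta>1 \<beta>2 \<beta>12 f (z, w))"
proof -
  have s: "series_at_0 (\<lambda>q. f (1 / q)) s"
    using expands_at_0_imp_series_at_0 j by (simp add: is_j_def comp_def)
  have int: "\<alpha>1 - \<beta>1 \<in> \<int>" "\<alpha>2 - \<beta>2 \<in> \<int>" "\<alpha>12 - \<beta>12 \<in> \<int>" using d by (auto simp: gcor_data_def)
  have int': "(\<alpha>1 + \<alpha>2 + \<alpha>12 - \<alpha>1) - (\<beta>1 + \<beta>2 + \<beta>12 - \<beta>1) \<in> \<int>"
    using Ints_add[OF int(2,3)] by (simp add: algebra_simps)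
  have "gen_exp_21 \<alpha>1 \<alpha>2 \<alpha>12 \<beta>1 \<beta>2 \<beta>12 s =
      (\<lambda>x. (- 1) powi \<lfloor>\<alpha>12 - \<beta>12\<rfloor> * (case x of (r, t, r', t') \<Rightarrow> if r + r' = \<alpha>1 + \<alpha>2 + \<alpha>12 \<and> t +
          t' = \<beta>1 + \<beta>2 + \<beta>12
         then binom_mult (- 1) \<alpha>12 \<beta>12 s (r - \<alpha>1, t - \<beta>1) else 0))"
    by (auto simp: gen_exp_21_def)
  then show ?thesis
  proof (simp only:, intro expands2_cong[OF expands2_cmult[OF expands2_monomial_binom_mult[OF s
      int(1) int' int(3)]] zero_less_one])
    fix z w :: complex assume zw: "z \<noteq> 0" "norm z < 1 * norm w"
    have 1: "zpow (\<alpha>2 + \<alpha>12) (\<beta>2 + \<beta>12) w * zpow \<alpha>12 \<beta>12 (1 + - z / w) = zpow \<alpha>2 \<beta>2 w *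
        zpow \<alpha>12 \<beta>12 (w + - z)"
      using zw by (intro zpow_mult_one_plus int) auto
    have 2: "(- 1) powi \<lfloor>\<alpha>12 - \<beta>12\<rfloor> * zpow \<alpha>12 \<beta>12 (w + - z) = zpow \<alpha>12 \<beta>12 (z - w)"
      using zpow_minus[of \<alpha>12 \<beta>12 "w - z"] by simp
    have "(- 1) powi \<lfloor>\<alpha>12 - \<beta>12\<rfloor> * (zpow \<alpha>12 \<beta>12 (1 + - 1 * (z / w)) * (zpow \<alpha>1 \<beta>1 z *
        zpow (\<alpha>1 + \<alpha>2 + \<alpha>12 - \<alpha>1) (\<beta>1 + \<beta>2 + \<beta>12 - \<beta>1) w * f (1 / (z / w)))) =
       (- 1) powi \<lfloor>\<alpha>12 - \<beta>12\<rfloor> * (zpow (\<alpha>2 + \<alpha>12) (\<beta>2 + \<beta>12) w * zpow \<alpha>12 \<beta>12 (1 + - z / w)) *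
           (zpow \<alpha>1 \<beta>1 z * f (w / z))"
      by (simp add: algebra_simps)
    also have "\<dots> = zpow \<alpha>2 \<beta>2 w * zpow \<alpha>12 \<beta>12 (z - w) * (zpow \<alpha>1 \<beta>1 z * f (w / z))"
      unfolding 1 2[symmetric] by (simp add: algebra_simps)
    also have "\<dots> = gcor_gen \<alpha>1 \<alpha>2 \<alpha>12 \<beta>1 \<beta>2 \<beta>12 f (z, w)"
      using norm_less_imp_Y2[OF zw] zw by (simp add: gcor_gen_def Y2_def)
    finally show "(- 1) powi \<lfloor>\<alpha>12 - \<beta>12\<rfloor> * (zpow \<alpha>12 \<beta>12 (1 + - 1 * (z / w)) * (zpow \<alpha>1 \<beta>1 z *
        zpow (\<alpha>1 + \<alpha>2 + \<alpha>12 - \<alpha>1) (\<beta>1 + \<beta>2 + \<beta>12 - \<beta>1) w * f (1 / (z / w)))) =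
        gcor_gen \<alpha>1 \<alpha>2 \<alpha>12 \<beta>1 \<beta>2 \<beta>12 f (z, w)" .
  qed auto
qed

lemma expands2_gen_exp_0:
  assumes d: "gcor_data \<alpha>1 \<alpha>2 \<alpha>12 \<beta>1 \<beta>2 \<beta>12 f" and j: "is_j (\<lambda>q. 1 / (1 - q)) f s"
  shows "expands2 (gen_exp_0 \<alpha>1 \<alpha>2 \<alpha>12 \<beta>1 \<beta>2 \<beta>12 s)
      (\<lambda>z w. gcor_gen \<alpha>1 \<alpha>2 \<alpha>12 \<beta>1 \<beta>2 \<beta>12 f (w + z, w))"
proof -
  have "series_at_0 (\<lambda>q. f (1 / (1 - q))) s"
    using expands_at_0_imp_series_at_0 j by (simp add: is_j_def comp_def)
  then have s: "series_at_0 (\<lambda>q. f (1 / (1 + q))) (\<lambda>(r, t). (- 1) powi \<lfloor>r - t\<rfloor> * s (r, t))"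
    using series_at_0_reflect by fastforce
  have int: "\<alpha>1 - \<beta>1 \<in> \<int>" "\<alpha>2 - \<beta>2 \<in> \<int>" "\<alpha>12 - \<beta>12 \<in> \<int>" using d by (auto simp: gcor_data_def)
  have int': "(\<alpha>1 + \<alpha>2 + \<alpha>12 - \<alpha>12) - (\<beta>1 + \<beta>2 + \<beta>12 - \<beta>12) \<in> \<int>"
    using Ints_add[OF int(1,2)] by (simp add: algebra_simps)
  show ?thesis unfolding gen_exp_0_def
  proof (intro expands2_cong[OF expands2_monomial_binom_mult[OF s int(3) int' int(1)]
      zero_less_one])
    fix z w :: complex assume zw: "z \<noteq> 0" "norm z < 1 * norm w"
    have Y: "w \<noteq> 0" "w + z \<noteq> 0" using norm_less_imp_Y2[OF zw] by auto
    have "zpow (\<alpha>2 + \<alpha>1) (\<beta>2 + \<beta>1) w * zpow \<alpha>1 \<beta>1 (1 + z / w) = zpow \<alpha>2 \<beta>2 w * zpow \<alpha>1 \<beta>1 (w + z)"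
      using zw by (intro zpow_mult_one_plus int) auto
    moreover have "1 / (1 + z / w) = w / (w + z)" using Y by (simp add: field_simps)
    ultimately show "zpow \<alpha>1 \<beta>1 (1 + 1 * (z / w)) * (zpow \<alpha>12 \<beta>12 z *
        zpow (\<alpha>1 + \<alpha>2 + \<alpha>12 - \<alpha>12) (\<beta>1 + \<beta>2 + \<beta>12 - \<beta>12) w * f (1 / (1 + z / w))) =
        gcor_gen \<alpha>1 \<alpha>2 \<alpha>12 \<beta>1 \<beta>2 \<beta>12 f (w + z, w)"
      using Y zw by (simp add: gcor_gen_def Y2_def algebra_simps)
  qed auto
qed

text \<open>The module structure underlying \<^const>\<open>pair_span\<close>.\<close>

interpretation pair_module: module "\<lambda>c (\<mu> :: complex \<times> complex \<Rightarrow> complex, E :: rseries2).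
    (\<lambda>z. c * \<mu> z, \<lambda>x. c * E x)"
  by unfold_locales (auto simp: algebra_simps fun_eq_iff)

lemma pair_span_induct:
  assumes "(\<mu>, E) \<in> pair_span S" "P (\<lambda>_. 0) (\<lambda>_. 0)"
    and "\<And>c m e \<mu> E. (m, e) \<in> S \<Longrightarrow> P \<mu> E \<Longrightarrow> P (\<lambda>z. c * m z + \<mu> z) (\<lambda>x. c * e x + E x)"
  shows "P \<mu> E"
proof -
  have "case_prod P (\<mu>, E)"
  proof (rule pair_module.span_induct_alt[of "(\<mu>, E)" S])
    show "(\<mu>, E) \<in> pair_module.span S" using assms(1) by (simp add: pair_span_def)
    show "case_prod P 0" using assms(2) by (simp add: zero_prod_def zero_fun_def)
    show "case_prod P ((case x of (\<mu>, E) \<Rightarrow> (\<lambda>z. c * \<mu> z, \<lambda>x. c * E x)) + y)"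
        if "x \<in> S" "case_prod P y" for c x y
      using assms(3)[of "fst x" "snd x" "fst y" "snd y" c] that
          by (auto simp: plus_fun_def case_prod_beta')
  qed
  then show ?thesis by simp
qed

lemma pair_span_zero: "(\<lambda>_. 0, \<lambda>_. 0) \<in> pair_span S"
  using pair_module.span_zero[of S] by (simp add: pair_span_def zero_prod_def zero_fun_def)

lemma pair_span_add_scaled:
  assumes "(m, e) \<in> S" "(\<mu>, E) \<in> pair_span S"
  shows "(\<lambda>z. c * m z + \<mu> z, \<lambda>x. c * e x + E x) \<in> pair_span S"
  using pair_module.span_add[OF pair_module.span_scale[OF pair_module.span_base[OF assms(1)]]
      assms(2)[unfolded pair_span_def], of c]
  by (simp add: pair_span_def plus_fun_def)

lemma has_expansion_12_imp_expands2:
  assumes "has_expansion_12 \<mu> E"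
  shows "expands2 (\<lambda>(r, t, r', t'). E (r', t', r, t)) (\<lambda>z w. \<mu> (w, z))"
  using assms unfolding has_expansion_12_def
proof (rule pair_span_induct)
  show "expands2 (\<lambda>(r, t, r', t'). 0) (\<lambda>z w. 0)" using expands2_zero by (simp add: case_prod_beta')
  fix c m e and \<mu> :: "complex \<times> complex \<Rightarrow> complex" and E :: rseries2
  assume me: "(m, e) \<in> {(gcor_gen \<alpha>1 \<alpha>2 \<alpha>12 \<beta>1 \<beta>2 \<beta>12 f, gen_exp_12 \<alpha>1 \<alpha>2 \<alpha>12 \<beta>1 \<beta>2 \<beta>12 s)
        | \<alpha>1 \<alpha>2 \<alpha>12 \<beta>1 \<beta>2 \<beta>12 f s.
        gcor_data \<alpha>1 \<alpha>2 \<alpha>12 \<beta>1 \<beta>2 \<beta>12 f \<and> is_j (\<lambda>q. q) f s}"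
    and E: "expands2 (\<lambda>(r, t, r', t'). E (r', t', r, t)) (\<lambda>z w. \<mu> (w, z))"
  have "expands2 (\<lambda>(r, t, r', t'). e (r', t', r, t)) (\<lambda>z w. m (w, z))"
    using me expands2_gen_exp_12 by auto
  from expands2_add[OF expands2_cmult[OF this, of c] E]
  show "expands2 (\<lambda>(r, t, r', t'). c * e (r', t', r, t) + E (r', t', r, t)) (\<lambda>z w. c * m (w, z) +
      \<mu> (w, z))"
    by (simp add: case_prod_beta')
qed

lemma has_expansion_12_imp_curve_analytic:
  assumes "has_expansion_12 \<mu> E"
  shows "curve_analytic (\<lambda>w z. \<mu> (w, z))"
  using assms unfolding has_expansion_12_def
proof (rule pair_span_induct[where P = "\<lambda>\<mu> E. curve_analytic (\<lambda>w z. \<mu> (w, z))"])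
  show "curve_analytic (\<lambda>w z. 0)" by (simp add: curve_analytic_def param_analytic_const)
  fix c m e and \<mu> :: "complex \<times> complex \<Rightarrow> complex" and E :: rseries2
  assume me: "(m, e) \<in> {(gcor_gen \<alpha>1 \<alpha>2 \<alpha>12 \<beta>1 \<beta>2 \<beta>12 f, gen_exp_12 \<alpha>1 \<alpha>2 \<alpha>12 \<beta>1 \<beta>2 \<beta>12 s)
        | \<alpha>1 \<alpha>2 \<alpha>12 \<beta>1 \<beta>2 \<beta>12 f s.
        gcor_data \<alpha>1 \<alpha>2 \<alpha>12 \<beta>1 \<beta>2 \<beta>12 f \<and> is_j (\<lambda>q. q) f s}"
    and \<mu>: "curve_analytic (\<lambda>w z. \<mu> (w, z))"
  have m: "curve_analytic (\<lambda>w z. m (w, z))" using me curve_analytic_gcor_gen by auto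
  show "curve_analytic (\<lambda>w z. c * m (w, z) + \<mu> (w, z))"
    unfolding curve_analytic_def
    by (intro allI impI param_analytic_intros curve_analyticD[OF m] curve_analyticD[OF \<mu>])
qed

lemma has_expansion_21_imp_expands2:
  assumes "has_expansion_21 \<mu> E"
  shows "expands2 E (\<lambda>z w. \<mu> (z, w))"
  using assms unfolding has_expansion_21_def
proof (rule pair_span_induct)
  show "expands2 (\<lambda>_. 0) (\<lambda>z w. 0)" by (rule expands2_zero)
  fix c m e and \<mu> :: "complex \<times> complex \<Rightarrow> complex" and E :: rseries2
  assume me: "(m, e) \<in> {(gcor_gen \<alpha>1 \<alpha>2 \<alpha>12 \<beta>1 \<beta>2 \<beta>12 f, gen_exp_21 \<alpha>1 \<alpha>2 \<alpha>12 \<beta>1 \<beta>2 \<beta>12 s)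
        | \<alpha>1 \<alpha>2 \<alpha>12 \<beta>1 \<beta>2 \<beta>12 f s.
        gcor_data \<alpha>1 \<alpha>2 \<alpha>12 \<beta>1 \<beta>2 \<beta>12 f \<and> is_j (\<lambda>q. 1 / q) f s}"
    and E: "expands2 E (\<lambda>z w. \<mu> (z, w))"
  have "expands2 e (\<lambda>z w. m (z, w))"
    using me expands2_gen_exp_21 by auto
  from expands2_add[OF expands2_cmult[OF this, of c] E]
  show "expands2 (\<lambda>x. c * e x + E x) (\<lambda>z w. c * m (z, w) + \<mu> (z, w))" .
qed

lemma has_expansion_0_imp_expands2:
  assumes "has_expansion_0 \<mu> E"
  shows "expands2 E (\<lambda>z w. \<mu> (w + z, w))"
  using assms unfolding has_expansion_0_def
proof (rule pair_span_induct)
  show "expands2 (\<lambda>_. 0) (\<lambda>z w. 0)" by (rule expands2_zero)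
  fix c m e and \<mu> :: "complex \<times> complex \<Rightarrow> complex" and E :: rseries2
  assume me: "(m, e) \<in> {(gcor_gen \<alpha>1 \<alpha>2 \<alpha>12 \<beta>1 \<beta>2 \<beta>12 f, gen_exp_0 \<alpha>1 \<alpha>2 \<alpha>12 \<beta>1 \<beta>2 \<beta>12 s)
        | \<alpha>1 \<alpha>2 \<alpha>12 \<beta>1 \<beta>2 \<beta>12 f s.
        gcor_data \<alpha>1 \<alpha>2 \<alpha>12 \<beta>1 \<beta>2 \<beta>12 f \<and> is_j (\<lambda>q. 1 / (1 - q)) f s}"
    and E: "expands2 E (\<lambda>z w. \<mu> (w + z, w))"
  have "expands2 e (\<lambda>z w. m (w + z, w))"
    using me expands2_gen_exp_0 by auto
  from expands2_add[OF expands2_cmult[OF this, of c] E]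
  show "expands2 (\<lambda>x. c * e x + E x) (\<lambda>z w. c * m (w + z, w) + \<mu> (w + z, w))" .
qed

lemma expands_at_0_cong:
  assumes "expands_at_0 g s" "R > 0" "\<And>p. p \<noteq> 0 \<Longrightarrow> norm p < R \<Longrightarrow> g p = g' p"
  shows "expands_at_0 g' s"
proof -
  obtain R1 where R1: "R1 > 0" "\<forall>p\<in>ball 0 R1 - {0}. (\<lambda>(r, t). norm (s (r, t) * zpow r t p))
      summable_on UNIV"
      "\<And>K. compact K \<Longrightarrow> K \<subseteq> ball 0 R1 - {0} \<Longrightarrow>
        uniform_limit K (\<lambda>S p. \<Sum>(r, t)\<in>S. s (r, t) * zpow r t p) g (finite_subsets_at_top UNIV)"
    using assms(1) unfolding expands_at_0_def by blast
  have "uniform_limit K (\<lambda>S p. \<Sum>(r, t)\<in>S. s (r, t) * zpow r t p) g' (finite_subsets_at_top UNIV)"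
    if K: "compact K" "K \<subseteq> ball 0 (min R R1) - {0}" for K
  proof (rule uniform_limit_cong'[THEN iffD1, OF _ _ R1(3)[OF K(1)]])
    fix x assume "x \<in> K"
    then have "x \<in> ball 0 (min R R1) - {0}" using K(2) by blast
    then show "g x = g' x" using assms(3)[of x] by simp
  qed (use K(2) in auto)
  then show ?thesis
    using assms(1,2) R1 unfolding expands_at_0_def by (intro conjI exI[of _ "min R R1"]) auto
qed

lemma F01inf_is_j_at_1:
  assumes "f \<in> F01inf"
  shows "\<exists>s. is_j (\<lambda>q. 1 / (1 - q)) f s"
proof -
  define U where "U = {z :: complex. Re z > 0}"
  define \<phi> where "\<phi> = (\<lambda>z :: complex. 1 - 1 / z)"
  have inj: "inj_on \<phi> U" by (auto simp: inj_on_def \<phi>_def)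
  have "open U" unfolding U_def by (rule open_halfspace_Re_gt)
  moreover have "\<phi> holomorphic_on U" unfolding \<phi>_def U_def by (intro holomorphic_intros) auto
  ultimately obtain s where s: "expands_at_0 (f \<circ> inv_into U \<phi>) s"
  proof -
    assume U: "open U" "\<phi> holomorphic_on U"
      and thesis: "\<And>s. expands_at_0 (f \<circ> inv_into U \<phi>) s \<Longrightarrow> thesis"
    have "conformal_singularity f 1" using assms by (simp add: F01inf_def)
    moreover have "1 \<in> U" "\<phi> 1 = 0" by (auto simp: U_def \<phi>_def)
    ultimately show thesis
      using U inj thesis unfolding conformal_singularity_def by blast
  qed
  have "expands_at_0 (f \<circ> (\<lambda>q. 1 / (1 - q))) s"
  proof (rule expands_at_0_cong[OF s zero_less_one])
    fix p :: complex assume p: "p \<noteq> 0" "norm p < 1"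
    have "Re (1 - p) > 0" using complex_Re_le_cmod[of p] p(2) by simp
    then have "1 / (1 - p) \<in> U" by (simp add: U_def Re_divide)
       (intro divide_pos_pos add_pos_nonneg; auto)
    moreover have "\<phi> (1 / (1 - p)) = p" by (simp add: \<phi>_def)
    ultimately have "inv_into U \<phi> p = 1 / (1 - p)" using inv_into_f_f[OF inj] by metis
    then show "(f \<circ> inv_into U \<phi>) p = (f \<circ> (\<lambda>q. 1 / (1 - q))) p" by simp
  qed
  then show ?thesis unfolding is_j_def by blast
qed

text \<open>The graph of the linear extension lists only functions given with a representation by
  generators; any representation that yields one of the other expansions can be used, as each \<open>f\<close>
  in \<^const>\<open>F01inf\<close> has a series at \<open>1\<close>.\<close>

lemma has_expansion_0_exists:
  assumes "has_expansion_12 \<mu> E"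
  shows "\<exists>E0. has_expansion_0 \<mu> E0"
  using assms unfolding has_expansion_12_def
proof (rule pair_span_induct[where P = "\<lambda>\<mu> E. \<exists>E0. has_expansion_0 \<mu> E0"])
  show "\<exists>E0. has_expansion_0 (\<lambda>_. 0) E0" unfolding has_expansion_0_def using pair_span_zero by blast
  fix c m e and \<mu> :: "complex \<times> complex \<Rightarrow> complex" and E :: rseries2
  assume me: "(m, e) \<in> {(gcor_gen \<alpha>1 \<alpha>2 \<alpha>12 \<beta>1 \<beta>2 \<beta>12 f, gen_exp_12 \<alpha>1 \<alpha>2 \<alpha>12 \<beta>1 \<beta>2 \<beta>12 s)
        | \<alpha>1 \<alpha>2 \<alpha>12 \<beta>1 \<beta>2 \<beta>12 f s.
        gcor_data \<alpha>1 \<alpha>2 \<alpha>12 \<beta>1 \<beta>2 \<beta>12 f \<and> is_j (\<lambda>q. q) f s}"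
    and "\<exists>E0. has_expansion_0 \<mu> E0"
  then obtain E0 where E0: "has_expansion_0 \<mu> E0" by blast
  from me obtain \<alpha>1 \<alpha>2 \<alpha>12 \<beta>1 \<beta>2 \<beta>12 f where m: "m = gcor_gen \<alpha>1 \<alpha>2 \<alpha>12 \<beta>1 \<beta>2 \<beta>12 f"
      "gcor_data \<alpha>1 \<alpha>2 \<alpha>12 \<beta>1 \<beta>2 \<beta>12 f" by auto
  then obtain s where "is_j (\<lambda>q. 1 / (1 - q)) f s"
    using F01inf_is_j_at_1[of f] by (auto simp: gcor_data_def)
  with m have "(m, gen_exp_0 \<alpha>1 \<alpha>2 \<alpha>12 \<beta>1 \<beta>2 \<beta>12 s) \<in>
     {(gcor_gen \<alpha>1 \<alpha>2 \<alpha>12 \<beta>1 \<beta>2 \<beta>12 f, gen_exp_0 \<alpha>1 \<alpha>2 \<alpha>12 \<beta>1 \<beta>2 \<beta>12 s)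
        | \<alpha>1 \<alpha>2 \<alpha>12 \<beta>1 \<beta>2 \<beta>12 f s.
        gcor_data \<alpha>1 \<alpha>2 \<alpha>12 \<beta>1 \<beta>2 \<beta>12 f \<and> is_j (\<lambda>q. 1 / (1 - q)) f s}" by blast
  from pair_span_add_scaled[OF this E0[unfolded has_expansion_0_def]]
  show "\<exists>E0. has_expansion_0 (\<lambda>z. c * m z + \<mu> z) E0" unfolding has_expansion_0_def by blast
qed

section \<open>Operations on convergent series\<close>

lemma expands2_value_unique:
  assumes "expands2 E m" "expands2 E m'"
  shows "\<exists>R>0. \<forall>z w. z \<noteq> 0 \<longrightarrow> norm z < R * norm w \<longrightarrow> m z w = m' z w"
proof -
  obtain R where R: "R > 0" "\<And>z w. z \<noteq> 0 \<Longrightarrow> norm z < R * norm w \<Longrightarrow>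
      ((\<lambda>x. E x * mono2 z w x) has_sum m z w) UNIV"
    using assms(1) unfolding expands2_def by blast
  obtain R' where R': "R' > 0" "\<And>z w. z \<noteq> 0 \<Longrightarrow> norm z < R' * norm w \<Longrightarrow>
      ((\<lambda>x. E x * mono2 z w x) has_sum m' z w) UNIV"
    using assms(2) unfolding expands2_def by blast
  show ?thesis
  proof (intro exI[of _ "min R R'"] conjI allI impI)
    fix z w :: complex assume z: "z \<noteq> 0" "norm z < min R R' * norm w"
    have "min R R' * norm w \<le> R * norm w" "min R R' * norm w \<le> R' * norm w"
      by (intro mult_right_mono; simp)+
    then show "m z w = m' z w"
      using has_sum_unique[OF R(2)[OF z(1)] R'(2)[OF z(1)]] z(2) by auto
  qed (use R R' in auto)
qed

text \<open>Common form of the shift and reflection lemmas: a bijection \<open>h\<close> of the exponents that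
  matches the terms up to a factor \<open>c\<close> and unimodular rescalings \<open>\<sigma>, \<tau>\<close> of the variables.\<close>

lemma expands2_reindex:
  assumes E: "expands2 E m" and bij: "bij h" and supp: "supp2 (\<lambda>x. E' x)"
    and eq: "\<And>z w x. z \<noteq> 0 \<Longrightarrow> w \<noteq> 0 \<Longrightarrow> E' (h x) * mono2 z w (h x) =
        c z w * (E x * mono2 (\<sigma> * z) (\<tau> * w) x)"
    and st: "norm \<sigma> = 1" "norm \<tau> = 1"
  shows "expands2 E' (\<lambda>z w. c z w * m (\<sigma> * z) (\<tau> * w))"
proof -
  obtain R where R: "R > 0" "\<And>z w. z \<noteq> 0 \<Longrightarrow> norm z < R * norm w \<Longrightarrow>
      ((\<lambda>x. E x * mono2 z w x) has_sum m z w) UNIV"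
    using E unfolding expands2_def by blast
  have "((\<lambda>x. E' x * mono2 z w x) has_sum (c z w * m (\<sigma> * z) (\<tau> * w))) UNIV"
    if z: "z \<noteq> 0" "norm z < R * norm w" for z w
  proof -
    have w: "w \<noteq> 0" using z by auto
    have "((\<lambda>x. E x * mono2 (\<sigma> * z) (\<tau> * w) x) has_sum m (\<sigma> * z) (\<tau> * w)) UNIV"
      by (rule R(2)) (use z st in \<open>auto simp: norm_mult\<close>)
    from has_sum_cmult_right[OF this, of "c z w"]
    have "((\<lambda>x. E' (h x) * mono2 z w (h x)) has_sum (c z w * m (\<sigma> * z) (\<tau> * w))) UNIV"
      by (simp only: eq[OF z(1) w])
    then show ?thesis
      using has_sum_reindex_bij_betw[of h UNIV UNIV "\<lambda>x. E' x * mono2 z w x"] bij by simp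
  qed
  then show ?thesis unfolding expands2_def using supp R(1) by blast
qed

lemma supp2_shift:
  assumes "supp2 E"
  shows "supp2 (\<lambda>(r, s, r', s'). E (r - real n, s - real m, r' - real n', s' - real m'))"
proof -
  obtain C where C: "\<And>r s r' s'. E (r, s, r', s') \<noteq> 0 \<Longrightarrow>
      r - s \<in> \<int> \<and> r' - s' \<in> \<int> \<and> - C \<le> r \<and> - C \<le> s \<and> \<bar>r + r'\<bar> \<le> C \<and> \<bar>s + s'\<bar> \<le> C"
    using assms unfolding supp2_def by blast
  show ?thesis unfolding supp2_def
  proof (intro exI[of _ "C + real n + real m + real n' + real m'"] allI impI)
    fix r s r' s'
    assume "(case (r, s, r', s') of (r, s, r', s') \<Rightarrow> E (r - real n, s - real m, r' - real n', s' -
        real m')) \<noteq> 0"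
    then have c: "E (r - real n, s - real m, r' - real n', s' - real m') \<noteq> 0" by simp
    note c = C[OF c]
    have "r - s = (r - real n - (s - real m)) + (real n - real m)"
      "r' - s' = (r' - real n' - (s' - real m')) + (real n' - real m')" by simp_all
    then have "r - s \<in> \<int>" "r' - s' \<in> \<int>" using c by (metis Ints_add Ints_diff Ints_of_nat)+
    then show "r - s \<in> \<int> \<and> r' - s' \<in> \<int> \<and> - (C + real n + real m + real n' + real m') \<le> r \<and>
        - (C + real n + real m + real n' + real m') \<le> s \<and>
        \<bar>r + r'\<bar> \<le> C + real n + real m + real n' + real m' \<and> \<bar>s + s'\<bar> \<le> C + real n + real m +
            real n' + real m'"
      using c by auto
  qed
qed

lemma zpow_add_nat:
  assumes "z \<noteq> 0" "r - s \<in> \<int>"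
  shows "zpow (r + real n) (s + real m) z = z ^ n * cnj z ^ m * zpow r s z"
  using assms by (simp add: zpow_add zpow_nat)

lemma expands2_shift_small:
  assumes E: "expands2 E m"
  shows "expands2 (\<lambda>(r, s, r', s'). E (r - real i, s - real j, r', s')) (\<lambda>z w. z ^ i * cnj z ^ j *
      m z w)"
proof -
  have supp: "supp2 E" using E by (simp add: expands2_def)
  have "expands2 (\<lambda>(r, s, r', s'). E (r - real i, s - real j, r', s')) (\<lambda>z w. z ^ i * cnj z ^ j *
      m (1 * z) (1 * w))"
  proof (rule expands2_reindex[OF E, where h = "\<lambda>(r, s, r', s'). (r + real i, s + real j, r', s')"])
    show "bij (\<lambda>(r, s, r', s'). (r + real i, s + real j, r' :: real, s' :: real))"
      by (rule o_bij[of "\<lambda>(r, s, r', s'). (r - real i, s - real j, r', s')"]) auto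
    show "supp2 (\<lambda>(r, s, r', s'). E (r - real i, s - real j, r', s'))"
      using supp2_shift[OF supp, of i j 0 0] by simp
    fix z w :: complex and x :: "real \<times> real \<times> real \<times> real" assume z: "z \<noteq> 0" "w \<noteq> 0"
    obtain r s r' s' where x: "x = (r, s, r', s')" by (cases x)
    have "r - s \<in> \<int>" if "E x \<noteq> 0" using supp that unfolding supp2_def x by blast
    then show "(case case x of (r, s, r', s') \<Rightarrow> (r + real i, s + real j, r', s') of
        (r, s, r', s') \<Rightarrow> E (r - real i, s - real j, r', s')) *
        mono2 z w (case x of (r, s, r', s') \<Rightarrow> (r + real i, s + real j, r', s')) =
        z ^ i * cnj z ^ j * (E x * mono2 (1 * z) (1 * w) x)"
      using z by (cases "E x = 0") (auto simp: x mono2_def zpow_add_nat)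
  qed auto
  then show ?thesis by simp
qed

lemma expands2_shift_big:
  assumes E: "expands2 E m"
  shows "expands2 (\<lambda>(r, s, r', s'). E (r, s, r' - real i, s' - real j)) (\<lambda>z w. w ^ i * cnj w ^ j *
      m z w)"
proof -
  have supp: "supp2 E" using E by (simp add: expands2_def)
  have "expands2 (\<lambda>(r, s, r', s'). E (r, s, r' - real i, s' - real j)) (\<lambda>z w. w ^ i * cnj w ^ j *
      m (1 * z) (1 * w))"
  proof (rule expands2_reindex[OF E, where h = "\<lambda>(r, s, r', s'). (r, s, r' + real i, s' + real j)"])
    show "bij (\<lambda>(r :: real, s :: real, r', s'). (r, s, r' + real i, s' + real j))"
      by (rule o_bij[of "\<lambda>(r, s, r', s'). (r, s, r' - real i, s' - real j)"]) auto
    show "supp2 (\<lambda>(r, s, r', s'). E (r, s, r' - real i, s' - real j))"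
      using supp2_shift[OF supp, of 0 0 i j] by simp
    fix z w :: complex and x :: "real \<times> real \<times> real \<times> real" assume z: "z \<noteq> 0" "w \<noteq> 0"
    obtain r s r' s' where x: "x = (r, s, r', s')" by (cases x)
    have "r' - s' \<in> \<int>" if "E x \<noteq> 0" using supp that unfolding supp2_def x by blast
    then show "(case case x of (r, s, r', s') \<Rightarrow> (r, s, r' + real i, s' + real j) of
        (r, s, r', s') \<Rightarrow> E (r, s, r' - real i, s' - real j)) *
        mono2 z w (case x of (r, s, r', s') \<Rightarrow> (r, s, r' + real i, s' + real j)) =
        w ^ i * cnj w ^ j * (E x * mono2 (1 * z) (1 * w) x)"
      using z by (cases "E x = 0") (auto simp: x mono2_def zpow_add_nat)
  qed auto
  then show ?thesis by simp
qed

lemma expands2_reflect_small: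
  assumes E: "expands2 E m"
  shows "expands2 (\<lambda>(r, s, r', s'). (- 1) powi \<lfloor>r - s\<rfloor> * E (r, s, r', s')) (\<lambda>z w. m (- z) w)"
proof -
  have supp: "supp2 E" using E by (simp add: expands2_def)
  have "expands2 (\<lambda>(r, s, r', s'). (- 1) powi \<lfloor>r - s\<rfloor> * E (r, s, r', s')) (\<lambda>z w. 1 *
      m (- 1 * z) (1 * w))"
  proof (rule expands2_reindex[OF E, where h = id])
    show "supp2 (\<lambda>(r, s, r', s'). (- 1) powi \<lfloor>r - s\<rfloor> * E (r, s, r', s'))"
      using supp2_cmult[OF supp, of "\<lambda>(r, s, r', s'). (- 1) powi \<lfloor>r - s\<rfloor>"]
          by (simp add: case_prod_beta')
  qed (auto simp: mono2_def zpow_minus)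
  then show ?thesis by simp
qed

lemma expands2_reflect_big:
  assumes E: "expands2 E m"
  shows "expands2 (\<lambda>(r, s, r', s'). (- 1) powi \<lfloor>r' - s'\<rfloor> * E (r, s, r', s')) (\<lambda>z w. m z (- w))"
proof -
  have supp: "supp2 E" using E by (simp add: expands2_def)
  have "expands2 (\<lambda>(r, s, r', s'). (- 1) powi \<lfloor>r' - s'\<rfloor> * E (r, s, r', s')) (\<lambda>z w. 1 *
      m (1 * z) (- 1 * w))"
  proof (rule expands2_reindex[OF E, where h = id])
    show "supp2 (\<lambda>(r, s, r', s'). (- 1) powi \<lfloor>r' - s'\<rfloor> * E (r, s, r', s'))"
      using supp2_cmult[OF supp, of "\<lambda>(r, s, r', s'). (- 1) powi \<lfloor>r' - s'\<rfloor>"]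
          by (simp add: case_prod_beta')
  qed (auto simp: mono2_def zpow_minus)
  then show ?thesis by simp
qed

text \<open>A series in the large variable only.\<close>

definition const_series :: "complex rseries \<Rightarrow> rseries2" where
  "const_series \<phi> = (\<lambda>(r, s, r', s'). if (r, s) = (0, 0) then \<phi> (r', s') else 0)"

text \<open>The function given by a series with finitely many terms; otherwise the sum is \<open>0\<close>.\<close>

definition finite_value :: "complex rseries \<Rightarrow> complex \<Rightarrow> complex" where
  "finite_value \<phi> w = (\<Sum>x | \<phi> x \<noteq> 0. \<phi> x * zpow (fst x) (snd x) w)"

lemma expands2_const_series:
  assumes fin: "finite {x. \<phi> x \<noteq> 0}" and int: "\<And>r s. \<phi> (r, s) \<noteq> 0 \<Longrightarrow> r - s \<in> \<int>"
  shows "expands2 (const_series \<phi>) (\<lambda>z w. finite_value \<phi> w)"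
proof -
  define C where "C = (\<Sum>x | \<phi> x \<noteq> 0. \<bar>fst x\<bar> + \<bar>snd x\<bar>)"
  have C: "\<bar>fst x\<bar> + \<bar>snd x\<bar> \<le> C" if "\<phi> x \<noteq> 0" for x
    unfolding C_def by (rule member_le_sum) (use that fin in auto)
  have C0: "C \<ge> 0" unfolding C_def by (rule sum_nonneg) auto
  have "supp2 (const_series \<phi>)" unfolding supp2_def
  proof (intro exI[of _ C] allI impI)
    fix r s r' s' assume "const_series \<phi> (r, s, r', s') \<noteq> 0"
    then have "r = 0" "s = 0" "\<phi> (r', s') \<noteq> 0" by (auto simp: const_series_def split: if_splits)
    then show "r - s \<in> \<int> \<and> r' - s' \<in> \<int> \<and> - C \<le> r \<and> - C \<le> s \<and> \<bar>r + r'\<bar> \<le> C \<and> \<bar>s + s'\<bar> \<le> C"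
      using C[of "(r', s')"] C0 int by auto
  qed
  moreover have "((\<lambda>x. const_series \<phi> x * mono2 z w x) has_sum finite_value \<phi> w) UNIV"
      if "z \<noteq> 0" for z w
  proof (rule has_sum_finite_neutralI)
    define h where "h = (\<lambda>(r' :: real, s' :: real). (0 :: real, 0 :: real, r', s'))"
    have inj: "inj_on h {x. \<phi> x \<noteq> 0}" by (auto simp: h_def inj_on_def)
    show "finite (h ` {x. \<phi> x \<noteq> 0})" using fin by simp
    show "const_series \<phi> x * mono2 z w x = 0" if "x \<in> UNIV - h ` {x. \<phi> x \<noteq> 0}" for x
      using that by (cases x) (auto simp: const_series_def h_def image_iff)
    show "finite_value \<phi> w = (\<Sum>x\<in>h ` {x. \<phi> x \<noteq> 0}. const_series \<phi> x * mono2 z w x)"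
      unfolding finite_value_def sum.reindex[OF inj] o_def
      by (rule sum.cong) (use that in \<open>auto simp: h_def const_series_def mono2_def\<close>)
  qed simp
  ultimately show ?thesis unfolding expands2_def by (intro conjI exI[of _ 1]) auto
qed

lemma expands2_const_series_unique:
  assumes E: "expands2 E (\<lambda>z w. m w)" and E': "expands2 E' (\<lambda>z w. m' w)" and eq: "\<And>w. w \<noteq> 0 \<Longrightarrow>
      m w = m' w"
  shows "E = E'"
  by (rule expands2_unique[OF E E' zero_less_one]) (auto intro!: eq)

lemma param_analytic_finite_value:
  assumes "param_analytic f t" "f t \<noteq> 0"
  shows "param_analytic (\<lambda>s. finite_value \<phi> (f s)) t"
  unfolding finite_value_def
  by (intro param_analytic_sum param_analytic_mult param_analytic_const param_analytic_zpow assms)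

lemma isCont_finite_value: "w \<noteq> 0 \<Longrightarrow> isCont (finite_value \<phi>) w"
proof -
  assume w: "w \<noteq> 0"
  have "isCont (zpow r s) w" for r s
    unfolding zpow_def using w by (intro continuous_intros) auto
  then have "isCont (\<lambda>w. \<Sum>x | \<phi> x \<noteq> 0. \<phi> x * zpow (fst x) (snd x) w) w"
    by (intro continuous_intros) auto
  then show ?thesis by (simp add: finite_value_def[abs_def])
qed

lemma sum_square_eq_sum_triangle:
  fixes g :: "nat \<Rightarrow> nat \<Rightarrow> 'a::comm_monoid_add"
  assumes "\<And>n k. n + k > L \<Longrightarrow> g n k = 0"
  shows "(\<Sum>n\<le>L. \<Sum>k\<le>L. g n k) = (\<Sum>j\<le>L. \<Sum>k\<le>j. g (j - k) k)"
proof -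
  have supp: "n + k \<le> L" if "g n k \<noteq> 0" for n k using assms that not_le by blast
  have "(\<Sum>n\<le>L. \<Sum>k\<le>L. g n k) = (\<Sum>(n, k)\<in>{..L} \<times> {..L}. g n k)"
    by (simp add: sum.cartesian_product)
  also have "\<dots> = (\<Sum>(n, k)\<in>{(n, k). n + k \<le> L}. g n k)"
    by (rule sum.mono_neutral_right) (use supp in auto)
  also have "\<dots> = (\<Sum>(k, n)\<in>{(k, n). k + n \<le> L}. g n k)"
    by (rule sum.reindex_bij_witness[of _ prod.swap prod.swap]) auto
  also have "\<dots> = (\<Sum>j\<le>L. \<Sum>k\<le>j. g (j - k) k)"
    by (rule sum.triangle_reindex_eq)
  finally show ?thesis .
qed

section \<open>Gradings, translations and the restricted dual\<close>

context translation_covariant_full_prevertex_algebra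
begin

abbreviation dual :: "('v \<Rightarrow> complex) set" where
  "dual \<equiv> restricted_dual smul F"

lemma dual_linear:
  assumes "u \<in> dual"
  shows "u (x + y) = u x + u y" "u (smul c x) = c * u x" "u 0 = 0" "u (sum f I) = (\<Sum>i\<in>I. u (f i))"
proof -
  have u: "Vector_Spaces.linear smul (*) u" using assms by (simp add: restricted_dual_def)
  interpret u: Vector_Spaces.linear smul "(*)" u by (rule u)
  show "u (x + y) = u x + u y" "u (smul c x) = c * u x" "u 0 = 0" "u (sum f I) = (\<Sum>i\<in>I. u (f i))"
    by (simp_all add: u.add u.scale u.sum)
qed

lemma dual_support_finite: "u \<in> dual \<Longrightarrow> finite {(h, h'). \<exists>v\<in>F h h'. u v \<noteq> 0}"
  by (simp add: restricted_dual_def)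

lemma homogeneous_decomposition:
  "\<exists>c :: real \<times> real \<Rightarrow> 'v. (\<forall>x. c x \<in> F (fst x) (snd x)) \<and> finite {x. c x \<noteq> 0} \<and> v =
      (\<Sum>x | c x \<noteq> 0. c x)"
proof -
  obtain c :: "real \<times> real \<Rightarrow> 'v" where c: "\<forall>h h'. c (h, h') \<in> F h h'" "finite {x. c x \<noteq> 0}" "v =
      (\<Sum>x | c x \<noteq> 0. c x)"
    using ex1_implies_ex[OF direct_sum[of v]] by blast
  then have "c x \<in> F (fst x) (snd x)" for x by (cases x) simp
  with c show ?thesis by blast
qed

sublocale lin_D: Vector_Spaces.linear smul smul D by (rule linear_D)
sublocale lin_D': Vector_Spaces.linear smul smul D' by (rule linear_D')

lemma linear_Dpow: "Vector_Spaces.linear smul smul (\<lambda>v. (D ^^ n) ((D' ^^ m) v))"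
proof -
  have pow: "Vector_Spaces.linear smul smul (T ^^ n)" if T: "Vector_Spaces.linear smul smul T"
      for T n
  proof (induction n)
    case 0
    show ?case using linear_id by (simp add: id_def)
  next
    case (Suc n)
    show ?case using Vector_Spaces.linear_compose[OF Suc T] by (simp only: funpow.simps)
  qed
  show ?thesis using Vector_Spaces.linear_compose[OF pow[OF linear_D', of m] pow[OF linear_D,
      of n]] by (simp add: o_def)
qed

lemma D_grade: assumes "v \<in> F h h'" shows "D v \<in> F (h + 1) h'"
proof -
  interpret l: Vector_Spaces.linear smul smul "Y v (0, 0)" by (rule linear_Y_right)
  have "D v = Y v (1, 0) vac"
    using D_comm[of v 0 0 vac] by (simp add: D_vac PV3)
  also have "\<dots> = mode Y v (- 2) (- 1) vac" by (simp add: mode_def)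
  also have "\<dots> \<in> F (h + 0 - (- 2) - 1) (h' + 0 - (- 1) - 1)"
    by (rule PV5[OF assms vac_in])
  finally show ?thesis by (simp add: algebra_simps)
qed

lemma D'_grade: assumes "v \<in> F h h'" shows "D' v \<in> F h (h' + 1)"
proof -
  interpret l: Vector_Spaces.linear smul smul "Y v (0, 0)" by (rule linear_Y_right)
  have "D' v = Y v (0, 1) vac"
    using D'_comm[of v 0 0 vac] by (simp add: D'_vac PV3)
  also have "\<dots> = mode Y v (- 1) (- 2) vac" by (simp add: mode_def)
  also have "\<dots> \<in> F (h + 0 - (- 1) - 1) (h' + 0 - (- 2) - 1)"
    by (rule PV5[OF assms vac_in])
  finally show ?thesis by (simp add: algebra_simps)
qed

lemma Dpow_grade: "v \<in> F h h' \<Longrightarrow> (D ^^ n) ((D' ^^ m) v) \<in> F (h + real n) (h' + real m)"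
proof (induction n)
  case 0
  then show ?case
  proof (induction m)
    case (Suc m)
    have "h' + real (Suc m) = h' + real m + 1" by simp
    then show ?case using D'_grade[OF Suc(1)[OF Suc(2)]]
        by (simp only: funpow.simps o_apply id_apply of_nat_0 add_0_right)
  qed simp
next
  case (Suc n)
  have "h + real (Suc n) = h + real n + 1" by simp
  then show ?case using D_grade[OF Suc(1)[OF Suc(2)]] by (simp only: funpow.simps o_apply)
qed

lemma Y_grade: "a \<in> F h h' \<Longrightarrow> b \<in> F k k' \<Longrightarrow> Y a (r, s) b \<in> F (h + k + r) (h' + k' + s)"
  using PV5[of a h h' b k k' "- r - 1" "- s - 1"] by (simp add: mode_def algebra_simps)

text \<open>The divided powers \<open>D\<^sup>n D'\<^sup>m / (n! m!)\<close>.\<close>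

definition DD :: "nat \<Rightarrow> nat \<Rightarrow> 'v \<Rightarrow> 'v" where
  "DD n m v = smul (complex_of_real (1 / (fact n * fact m))) ((D ^^ n) ((D' ^^ m) v))"

lemma linear_DD: "Vector_Spaces.linear smul smul (DD n m)"
proof -
  interpret l: Vector_Spaces.linear smul smul "\<lambda>v. (D ^^ n) ((D' ^^ m) v)" by (rule linear_Dpow)
  show ?thesis unfolding DD_def[abs_def]
    by unfold_locales (simp_all add: l.add l.scale scale_right_distrib mult.commute)
qed

lemma DD_zero [simp]: "DD n m 0 = 0"
proof -
  interpret l: Vector_Spaces.linear smul smul "DD n m" by (rule linear_DD)
  show ?thesis by simp
qed

lemma Y_zero_right [simp]: "Y a x 0 = 0"
proof -
  interpret l: Vector_Spaces.linear smul smul "Y a x" by (rule linear_Y_right)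
  show ?thesis by simp
qed

lemma Y_sum_right: "Y a x (sum f I) = (\<Sum>i\<in>I. Y a x (f i))"
proof -
  interpret l: Vector_Spaces.linear smul smul "Y a x" by (rule linear_Y_right)
  show ?thesis by (rule l.sum)
qed

lemma Y_scale_right: "Y a x (smul c b) = smul c (Y a x b)"
proof -
  interpret l: Vector_Spaces.linear smul smul "Y a x" by (rule linear_Y_right)
  show ?thesis by (rule l.scale)
qed

lemma Y_sum_left: "Y (sum f I) x b = (\<Sum>i\<in>I. Y (f i) x b)"
proof -
  interpret l: Vector_Spaces.linear smul smul "\<lambda>a. Y a x b" by (rule linear_Y_left)
  show ?thesis by (rule l.sum)
qed

lemma DD_grade: "v \<in> F h h' \<Longrightarrow> DD n m v \<in> F (h + real n) (h' + real m)"
  unfolding DD_def using Dpow_grade subspace_scale[OF graded_subspace] by blast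

text \<open>Composition with a linear map preserves the restricted dual if only finitely many
  homogeneous components are not annihilated.\<close>

lemma dual_compose:
  assumes u: "u \<in> dual" and T: "Vector_Spaces.linear smul smul T" and fin: "finite S"
    and grade: "\<And>h h' v. v \<in> F h h' \<Longrightarrow> u (T v) \<noteq> 0 \<Longrightarrow> (h, h') \<in> S"
  shows "u \<circ> T \<in> dual"
  unfolding restricted_dual_def
proof (intro CollectI conjI)
  show "Vector_Spaces.linear smul (*) (u \<circ> T)"
    using Vector_Spaces.linear_compose[OF T] u by (auto simp: restricted_dual_def)
  show "finite {(h, h'). \<exists>v\<in>F h h'. (u \<circ> T) v \<noteq> 0}"
    by (rule finite_subset[OF _ fin]) (use grade in auto)
qed

lemma dual_compose_DD:
  assumes u: "u \<in> dual"
  shows "u \<circ> DD n m \<in> dual"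
proof (rule dual_compose[OF u linear_DD])
  show "finite ((\<lambda>(h, h'). (h - real n, h' - real m)) ` {(h, h'). \<exists>v\<in>F h h'. u v \<noteq> 0})"
    using dual_support_finite[OF u] by simp
  fix h h' v assume "v \<in> F h h'" "u (DD n m v) \<noteq> 0"
  then show "(h, h') \<in> (\<lambda>(h, h'). (h - real n, h' - real m)) ` {(h, h'). \<exists>v\<in>F h h'. u v \<noteq> 0}"
    using DD_grade[of v h h' n m] by (intro image_eqI[of _ _ "(h + real n, h' + real m)"]) auto
qed

lemma dual_compose_Y:
  assumes u: "u \<in> dual"
  shows "u \<circ> Y a x \<in> dual"
proof -
  obtain r s where x: "x = (r, s)" by (cases x)
  obtain c where c: "\<And>y. c y \<in> F (fst y) (snd y)" "finite {y. c y \<noteq> 0}" "a = (\<Sum>y | c y \<noteq> 0. c y)"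
    using homogeneous_decomposition by blast
  define S where "S = (\<Union>y\<in>{y. c y \<noteq> 0}. (\<lambda>(h, h'). (h - fst y - r, h' - snd y - s)) ` {(h, h').
      \<exists>v\<in>F h h'. u v \<noteq> 0})"
  show ?thesis
  proof (rule dual_compose[OF u linear_Y_right])
    show "finite S" unfolding S_def using c(2) dual_support_finite[OF u] by simp
    fix h h' v assume v: "v \<in> F h h'" "u (Y a x v) \<noteq> 0"
    have "u (Y a x v) = (\<Sum>y | c y \<noteq> 0. u (Y (c y) x v))"
      by (subst c(3)) (simp add: Y_sum_left dual_linear[OF u])
    then obtain y where y: "c y \<noteq> 0" "u (Y (c y) x v) \<noteq> 0"
      using v(2) by (metis (mono_tags, lifting) mem_Collect_eq sum.neutral)
    have "Y (c y) x v \<in> F (fst y + h + r) (snd y + h' + s)"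
      unfolding x by (rule Y_grade[OF c(1) v(1)])
    then show "(h, h') \<in> S"
      unfolding S_def using y
      by (intro UN_I[of y] image_eqI[of _ _ "(fst y + h + r, snd y + h' + s)"]) auto
  qed
qed

lemma finite_dual_Y_support:
  assumes u: "u \<in> dual"
  shows "finite {x. u (Y a x b) \<noteq> 0}"
proof -
  obtain c where c: "\<And>y. c y \<in> F (fst y) (snd y)" "finite {y. c y \<noteq> 0}" "a = (\<Sum>y | c y \<noteq> 0. c y)"
    using homogeneous_decomposition by blast
  obtain d where d: "\<And>y. d y \<in> F (fst y) (snd y)" "finite {y. d y \<noteq> 0}" "b = (\<Sum>y | d y \<noteq> 0. d y)"
    using homogeneous_decomposition by blast
  define S where "S = (\<Union>y\<in>{y. c y \<noteq> 0}. \<Union>z\<in>{z. d z \<noteq> 0}.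
      (\<lambda>(h, h'). (h - fst y - fst z, h' - snd y - snd z)) ` {(h, h'). \<exists>v\<in>F h h'. u v \<noteq> 0})"
  have "{x. u (Y a x b) \<noteq> 0} \<subseteq> S"
  proof
    fix x assume "x \<in> {x. u (Y a x b) \<noteq> 0}"
    then have nz: "u (Y a x b) \<noteq> 0" by simp
    have "u (Y a x b) = (\<Sum>y | c y \<noteq> 0. \<Sum>z | d z \<noteq> 0. u (Y (c y) x (d z)))"
      by (subst c(3), subst d(3)) (simp add: Y_sum_left Y_sum_right dual_linear[OF u], rule
          sum.swap)
    then obtain y where "c y \<noteq> 0" "(\<Sum>z | d z \<noteq> 0. u (Y (c y) x (d z))) \<noteq> 0"
      using nz by (metis (mono_tags, lifting) mem_Collect_eq sum.neutral)
    moreover from this(2) obtain z where "d z \<noteq> 0" "u (Y (c y) x (d z)) \<noteq> 0"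
      by (metis (mono_tags, lifting) mem_Collect_eq sum.neutral)
    moreover have "Y (c y) x (d z) \<in> F (fst y + fst z + fst x) (snd y + snd z + snd x)"
      using Y_grade[OF c(1) d(1), of y "fst x" "snd x" z] by simp
    ultimately show "x \<in> S"
      unfolding S_def
      by (intro UN_I[of y] UN_I[of z] image_eqI[of _ _ "(fst y + fst z + fst x, snd y + snd z +
          snd x)"]) auto
  qed
  moreover have "finite S" unfolding S_def using c(2) d(2) dual_support_finite[OF u] by simp
  ultimately show ?thesis by (rule finite_subset)
qed

text \<open>The weights seen by \<open>u\<close> are finitely many, and \<open>D\<close>, \<open>D'\<close> raise weights that start above a
  fixed bound.\<close>

lemma DD_eventually_zero:
  assumes u: "u \<in> dual" and bdd: "spectrum_bounded_below F"
  shows "\<exists>K. \<forall>n m v. n > K \<or> m > K \<longrightarrow> u (DD n m v) = 0"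
proof -
  obtain N where N: "\<And>h h'. h \<le> N \<or> h' \<le> N \<Longrightarrow> F h h' = {0}"
    using bdd unfolding spectrum_bounded_below_def by blast
  define S where "S = {(h, h'). \<exists>v\<in>F h h'. u v \<noteq> 0}"
  have finS: "finite S" unfolding S_def by (rule dual_support_finite[OF u])
  define B where "B = (\<Sum>x\<in>S. \<bar>fst x\<bar> + \<bar>snd x\<bar>)"
  have B: "\<bar>fst x\<bar> + \<bar>snd x\<bar> \<le> B" if "x \<in> S" for x
    unfolding B_def by (rule member_le_sum) (use that finS in auto)
  define K where "K = nat \<lceil>B - N\<rceil>"
  have hom: "u (DD n m v) = 0" if nm: "n > K \<or> m > K" and v: "v \<in> F h h'" for n m v h h'
  proof (rule ccontr)
    assume nz: "u (DD n m v) \<noteq> 0"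
    then have "(h + real n, h' + real m) \<in> S" using DD_grade[OF v] by (auto simp: S_def)
    from B[OF this] have "h + real n \<le> B" "h' + real m \<le> B" by auto
    moreover have "v \<noteq> 0" using nz by (auto simp: dual_linear[OF u])
    then have "h > N" "h' > N" using N[of h h'] v by force+
    ultimately show False using nm unfolding K_def by linarith
  qed
  have "u (DD n m v) = 0" if nm: "n > K \<or> m > K" for n m v
  proof -
    obtain c where c: "\<And>y. c y \<in> F (fst y) (snd y)" "finite {y. c y \<noteq> 0}" "v = (\<Sum>y | c y \<noteq> 0. c y)"
      using homogeneous_decomposition by blast
    interpret l: Vector_Spaces.linear smul smul "DD n m" by (rule linear_DD)
    show ?thesis
      by (subst c(3)) (simp add: l.sum dual_linear[OF u] hom[OF nm c(1)])
  qed
  then show ?thesis by blast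
qed

lemma Y_integral_support:
  assumes "Y a (r, s) b \<noteq> 0"
  shows "r - s \<in> \<int>"
proof -
  have "Y a (r, s) \<noteq> 0" using assms by (auto simp: zero_fun_def)
  then show ?thesis using Y_series[of a] unfolding rpower_series_def by blast
qed

lemma Y_lower_truncated: "\<exists>N. \<forall>r s. Y a (r, s) b \<noteq> 0 \<longrightarrow> r \<ge> N \<and> s \<ge> N"
proof -
  obtain N where N: "\<And>r s. r \<ge> N \<or> s \<ge> N \<Longrightarrow> mode Y a r s b = 0" using PV1 by blast
  have "r \<ge> - N - 1 \<and> s \<ge> - N - 1" if "Y a (r, s) b \<noteq> 0" for r s
    using N[of "- r - 1" "- s - 1"] that by (auto simp: mode_def not_le not_less intro: ccontr)
  then show ?thesis by blast
qed

section \<open>Exponentiated translations\<close>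

text \<open>\<open>exp_translate W\<close> is the series \<open>exp(z D + zbar D') W(z)\<close>. Each coefficient is a finite sum
  when the exponents of \<open>W\<close> are bounded below.\<close>

definition exp_translate :: "'v rseries \<Rightarrow> 'v rseries" where
  "exp_translate W =
      (\<lambda>(r, s). \<Sum>(n, m) | W (r - real n, s - real m) \<noteq> 0. DD n m (W (r - real n, s - real m)))"

lemma exp_translate_eq:
  assumes "\<And>n m. n > L \<or> m > L \<Longrightarrow> W (r - real n, s - real m) = 0"
  shows "exp_translate W (r, s) = (\<Sum>n\<le>L. \<Sum>m\<le>L. DD n m (W (r - real n, s - real m)))"
proof -
  have "exp_translate W (r, s) = (\<Sum>(n, m)\<in>{..L} \<times> {..L}. DD n m (W (r - real n, s - real m)))"
    unfolding exp_translate_def prod.case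
  proof (rule sum.mono_neutral_left)
    have "n \<le> L \<and> m \<le> L" if "W (r - real n, s - real m) \<noteq> 0" for n m
      using assms[of n m] that by (meson not_le)
    then show "{(n, m). W (r - real n, s - real m) \<noteq> 0} \<subseteq> {..L} \<times> {..L}" by auto
  qed auto
  then show ?thesis by (simp add: sum.cartesian_product)
qed

lemma dual_exp_translate:
  assumes u: "u \<in> dual" and W: "\<And>r s. W (r, s) \<noteq> 0 \<Longrightarrow> r \<ge> N \<and> s \<ge> N"
    and K: "\<And>n m v. n > K \<or> m > K \<Longrightarrow> u (DD n m v) = 0"
  shows "u (exp_translate W (r, s)) = (\<Sum>n\<le>K. \<Sum>m\<le>K. u (DD n m (W (r - real n, s - real m))))"
proof -
  define L where "L = K + nat \<lceil>r - N\<rceil> + nat \<lceil>s - N\<rceil>"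
  have "W (r - real n, s - real m) = 0" if "n > L \<or> m > L" for n m
  proof (rule ccontr)
    assume "W (r - real n, s - real m) \<noteq> 0"
    from W[OF this] have "real n \<le> r - N" "real m \<le> s - N" by auto
    then show False using that unfolding L_def by linarith
  qed
  from exp_translate_eq[of L W r s, OF this]
  have "u (exp_translate W (r, s)) = (\<Sum>n\<le>L. \<Sum>m\<le>L. u (DD n m (W (r - real n, s - real m))))"
    by (simp add: dual_linear[OF u])
  also have "\<dots> = (\<Sum>n\<le>K. \<Sum>m\<le>L. u (DD n m (W (r - real n, s - real m))))"
    by (rule sum.mono_neutral_right) (auto simp: L_def K not_le)
  also have "\<dots> = (\<Sum>n\<le>K. \<Sum>m\<le>K. u (DD n m (W (r - real n, s - real m))))"
    by (intro sum.cong refl sum.mono_neutral_right) (auto simp: L_def K not_le)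
  finally show ?thesis .
qed

lemma gbinomial_shift_identity:
  fixes r :: real
  shows "(r + 1) * ((r + real (Suc k)) gchoose k) = real (Suc k) *
      ((r + real (Suc k)) gchoose (Suc k))"
proof -
  have "real (Suc k) * ((r + real (Suc k)) gchoose (Suc k)) = ((r + real (Suc k)) gchoose k) *
      ((r + real (Suc k)) - real k)"
    using gbinomial_mult_1'[of "r + real (Suc k)" k] by (simp add: algebra_simps)
  then show ?thesis by (simp add: algebra_simps)
qed

text \<open>The coefficients of \<open>A(z) exp(w T) = exp(w T) A(z - w)\<close>, for a family of operators
  \<open>A(z) = \<Sum> A\<^sub>r z\<^sup>r\<close> with \<open>[T, A(z)] = d/dz A(z)\<close>.\<close>

lemma translation_commutation:
  fixes T :: "'v \<Rightarrow> 'v" and A :: "real \<Rightarrow> 'v \<Rightarrow> 'v"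
  assumes T: "Vector_Spaces.linear smul smul T" and A: "\<And>r. Vector_Spaces.linear smul smul (A r)"
    and comm: "\<And>r b. T (A r b) - A r (T b) = smul (complex_of_real (r + 1)) (A (r + 1) b)"
  shows "A r (smul (complex_of_real (1 / fact j)) ((T ^^ j) w)) =
    (\<Sum>k\<le>j. smul (complex_of_real ((- 1) ^ k * ((r + real k) gchoose k)))
        (smul (complex_of_real (1 / fact (j - k))) ((T ^^ (j - k)) (A (r + real k) w))))"
proof -
  interpret T: Vector_Spaces.linear smul smul T by (rule T)
  define c where "c = (\<lambda>r k. (- 1) ^ k * ((r + real k) gchoose k))"
  define B where "B = (\<lambda>j v. smul (complex_of_real (1 / fact j)) ((T ^^ j) v))"
  have TB: "T (B j v) = smul (complex_of_real (real (Suc j))) (B (Suc j) v)" for j v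
  proof -
    have "1 / fact j = real (Suc j) * (1 / fact (Suc j) :: real)" by (simp del: of_nat_Suc)
    then show ?thesis by (simp only: B_def T.scale scale_scale funpow.simps o_apply flip:
        of_real_mult)
  qed
  have "A r (B j w) = (\<Sum>k\<le>j. smul (complex_of_real (c r k)) (B (j - k) (A (r + real k) w)))" for r
  proof (induction j arbitrary: r)
    case 0
    show ?case by (simp add: B_def c_def)
  next
    case (Suc j)
    interpret A: Vector_Spaces.linear smul smul "A r" by (rule A)
    define X where "X = (\<lambda>k. B (Suc j - k) (A (r + real k) w))"
    have S1: "T (A r (B j w)) =
        (\<Sum>k\<le>Suc j. smul (complex_of_real (c r k * (real (Suc j) - real k))) (X k))"
    proof -
      have "T (A r (B j w)) =
          (\<Sum>k\<le>j. smul (complex_of_real (c r k)) (T (B (j - k) (A (r + real k) w))))"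
        by (simp add: Suc T.sum T.scale)
      also have "\<dots> = (\<Sum>k\<le>j. smul (complex_of_real (c r k * (real (Suc j) - real k))) (X k))"
      proof (intro sum.cong refl)
        fix k assume "k \<in> {..j}"
        then have "Suc (j - k) = Suc j - k" "real (Suc (j - k)) = real (Suc j) - real k" by auto
        then show "smul (complex_of_real (c r k)) (T (B (j - k) (A (r + real k) w))) =
            smul (complex_of_real (c r k * (real (Suc j) - real k))) (X k)"
          by (simp only: TB X_def scale_scale of_real_mult)
      qed
      finally show ?thesis by simp
    qed
    have S2: "smul (complex_of_real (r + 1)) (A (r + 1) (B j w)) =
        - (\<Sum>k\<le>Suc j. smul (complex_of_real (real k * c r k)) (X k))"
    proof -
      have "smul (complex_of_real (r + 1)) (A (r + 1) (B j w)) =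
          (\<Sum>k\<le>j. smul (complex_of_real ((r + 1) * c (r + 1) k)) (B (j - k) (A (r + 1 + real k) w)))"
        by (simp add: Suc scale_sum_right)
      also have "\<dots> = (\<Sum>k\<le>j. - smul (complex_of_real (real (Suc k) * c r (Suc k))) (X (Suc k)))"
      proof (intro sum.cong refl)
        fix k
        have "(r + 1) * c (r + 1) k = - (real (Suc k) * c r (Suc k))"
        proof -
          have "(r + 1) * c (r + 1) k = (- 1) ^ k * ((r + 1) * ((r + real (Suc k)) gchoose k))"
            by (simp add: c_def add.assoc)
          also have "\<dots> = (- 1) ^ k * (real (Suc k) * ((r + real (Suc k)) gchoose (Suc k)))"
            by (simp only: gbinomial_shift_identity)
          finally show ?thesis by (simp add: c_def)
        qed
        moreover have "r + 1 + real k = r + real (Suc k)" by simp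
        ultimately show "smul (complex_of_real ((r + 1) * c (r + 1) k)) (B (j - k) (A (r + 1 +
            real k) w)) =
            - smul (complex_of_real (real (Suc k) * c r (Suc k))) (X (Suc k))"
          by (simp only: X_def diff_Suc_Suc of_real_minus scale_minus_left)
      qed
      also have "\<dots> = - (\<Sum>k\<le>Suc j. smul (complex_of_real (real k * c r k)) (X k))"
        by (subst sum.atMost_Suc_shift) (simp add: sum_negf)
      finally show ?thesis .
    qed
    have "smul (complex_of_real (real (Suc j))) (A r (B (Suc j) w)) = A r (T (B j w))"
      by (simp add: TB A.scale)
    also have "\<dots> = T (A r (B j w)) - smul (complex_of_real (r + 1)) (A (r + 1) (B j w))"
      using comm[of r "B j w"] by (simp add: algebra_simps)
    also have "\<dots> = (\<Sum>k\<le>Suc j. smul (complex_of_real (c r k * (real (Suc j) - real k))) (X k) +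
        smul (complex_of_real (real k * c r k)) (X k))"
      unfolding S1 S2 by (simp only: sum.distrib diff_minus_eq_add)
    also have "\<dots> =
        (\<Sum>k\<le>Suc j. smul (complex_of_real (real (Suc j))) (smul (complex_of_real (c r k)) (X k)))"
    proof (intro sum.cong refl)
      fix k
      have "c r k * (real (Suc j) - real k) + real k * c r k = real (Suc j) * c r k"
          by (simp add: algebra_simps)
      then show "smul (complex_of_real (c r k * (real (Suc j) - real k))) (X k) +
          smul (complex_of_real (real k * c r k)) (X k) =
          smul (complex_of_real (real (Suc j))) (smul (complex_of_real (c r k)) (X k))"
        by (simp only: scale_scale flip: scale_left_distrib of_real_add of_real_mult)
    qed
    also have "\<dots> = smul (complex_of_real (real (Suc j))) (\<Sum>k\<le>Suc j. smul (complex_of_real (c r k))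
        (X k))"
      by (simp only: scale_sum_right)
    finally have "A r (B (Suc j) w) = (\<Sum>k\<le>Suc j. smul (complex_of_real (c r k)) (X k))"
      by (rule scale_left_imp_eq[rotated]) (simp del: of_nat_Suc)
    then show ?case by (simp only: X_def)
  qed
  then show ?thesis by (simp only: B_def c_def)
qed

text \<open>Both commutators at once; the order of \<open>D\<close> and \<open>D'\<close> is kept, so that they need not commute.\<close>

lemma Y_DD:
  "Y a (r, s) (DD i j w) = (\<Sum>k\<le>i. \<Sum>l\<le>j. smul (zpow_coeff (- 1) (r + real k) (s + real l) (k, l))
      (DD (i - k) (j - l) (Y a (r + real k, s + real l) w)))"
proof -
  define B where "B = (\<lambda>j v. smul (complex_of_real (1 / fact j)) ((D' ^^ j) v))"
  have DDB: "DD n m v = smul (complex_of_real (1 / fact n)) ((D ^^ n) (B m v))" for n m v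
  proof -
    interpret l: Vector_Spaces.linear smul smul "\<lambda>v. (D ^^ n) ((D' ^^ 0) v)" by (rule linear_Dpow)
    show ?thesis using l.scale by (simp add: DD_def B_def)
  qed
  have "Y a (r, s) (DD i j w) = (\<Sum>k\<le>i. smul (complex_of_real ((- 1) ^ k * ((r + real k) gchoose k)))
      (smul (complex_of_real (1 / fact (i - k))) ((D ^^ (i - k)) (Y a (r + real k, s) (B j w)))))"
    unfolding DDB by (rule translation_commutation[where A =
        "\<lambda>r. Y a (r, s)", OF linear_D linear_Y_right D_comm])
  also have "\<dots> = (\<Sum>k\<le>i. \<Sum>l\<le>j. smul (zpow_coeff (- 1) (r + real k) (s + real l) (k, l))
      (DD (i - k) (j - l) (Y a (r + real k, s + real l) w)))"
  proof (intro sum.cong refl)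
    fix k
    have lin: "Vector_Spaces.linear smul smul (D ^^ (i - k))" using linear_Dpow[of "i - k" 0]
        by simp
    interpret l: Vector_Spaces.linear smul smul "D ^^ (i - k)" by (rule lin)
    have "Y a (r + real k, s) (B j w) =
        (\<Sum>l\<le>j. smul (complex_of_real ((- 1) ^ l * ((s + real l) gchoose l)))
        (B (j - l) (Y a (r + real k, s + real l) w)))"
      unfolding B_def by (rule translation_commutation[where A =
          "\<lambda>s. Y a (r + real k, s)", OF linear_D' linear_Y_right D'_comm])
    then show "smul (complex_of_real ((- 1) ^ k * ((r + real k) gchoose k)))
        (smul (complex_of_real (1 / fact (i - k))) ((D ^^ (i - k)) (Y a (r + real k, s) (B j w)))) =
        (\<Sum>l\<le>j. smul (zpow_coeff (- 1) (r + real k) (s + real l) (k, l))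
          (DD (i - k) (j - l) (Y a (r + real k, s + real l) w)))"
      by (simp add: l.sum l.scale scale_sum_right DDB zpow_coeff_def power_add mult_ac)
  qed
  finally show ?thesis .
qed

text \<open>The identity
  \<open>u (Y(a, w) exp(z D + zbar D') W(z)) = \<Sum> z\<^sup>n zbar\<^sup>m / (n! m!) u (D\<^sup>n D'\<^sup>m Y(a, w - z) W(z))\<close> as
  one of convergent series, the sum on the right being finite.\<close>

lemma expands2_exp_translate:
  assumes u: "u \<in> dual" and W: "\<And>r s. W (r, s) \<noteq> 0 \<Longrightarrow> r \<ge> N \<and> s \<ge> N"
    and K: "\<And>n m v. n > K \<or> m > K \<Longrightarrow> u (DD n m v) = 0"
    and M: "\<And>n m. expands2 (\<lambda>(r, s, r', s'). u (DD n m (Y a (r', s') (W (r, s))))) (M n m)"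
  shows "expands2 (\<lambda>(r, s, r', s'). u (Y a (r', s') (exp_translate W (r, s))))
      (\<lambda>z w. \<Sum>n\<le>K. \<Sum>m\<le>K. z ^ n * cnj z ^ m * M n m z (w - z))"
proof -
  define E where "E = (\<lambda>n m (r, s, r', s'). u (DD n m (Y a (r', s') (W (r, s)))))"
  define G where "G = (\<lambda>n m. binom_transform (- 1) (\<lambda>(r, s, r', s'). r') (\<lambda>(r, s, r', s'). s')
      (E n m))"
  have main: "expands2 (\<lambda>x. \<Sum>n\<le>K. \<Sum>m\<le>K. (\<lambda>(r, s, r', s'). G n m (r - real n, s - real m, r', s')) x)
      (\<lambda>z w. \<Sum>n\<le>K. \<Sum>m\<le>K. z ^ n * cnj z ^ m * M n m z (w - z))"
    unfolding G_def by (intro expands2_sum expands2_shift_small expands2_translate)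
        (use M in \<open>simp add: E_def\<close>)
  have coeff: "(\<Sum>n\<le>K. \<Sum>m\<le>K. G n m (r - real n, s - real m, r', s')) =
      u (Y a (r', s') (exp_translate W (r, s)))"
    for r s r' s'
  proof -
    define L where "L = K + nat \<lceil>r - N\<rceil> + nat \<lceil>s - N\<rceil>"
    have W0: "W (r - real n, s - real m) = 0" if "n > L \<or> m > L" for n m
    proof (rule ccontr)
      assume "W (r - real n, s - real m) \<noteq> 0"
      from W[OF this] have "real n \<le> r - N" "real m \<le> s - N" by auto
      then show False using that unfolding L_def by linarith
    qed
    \<comment> \<open>The term with \<open>D\<^sup>n D'\<^sup>m\<close> on the outside and binomial indices \<open>k, l\<close>. It comes from
      \<open>D\<^sup>n\<^sup>+\<^sup>k D'\<^sup>m\<^sup>+\<^sup>l\<close> acting on \<open>W\<close>, so both sides are sums of \<open>T\<close> over the same indices.\<close>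
    define T where "T = (\<lambda>n m k l. zpow_coeff (- 1) (r' + real k) (s' + real l) (k, l) *
        E n m (r - real (n + k), s - real (m + l), r' + real k, s' + real l))"
    have T0: "T n m k l = 0" if "n > K \<or> m > K \<or> n + k > L \<or> m + l > L" for n m k l
      using that W0[of "n + k" "m + l"] K[of n m] by (auto simp: T_def E_def dual_linear[OF u])
    have "(\<Sum>n\<le>K. \<Sum>m\<le>K. G n m (r - real n, s - real m, r', s')) =
        (\<Sum>n\<le>K. \<Sum>m\<le>K. \<Sum>k\<le>L. \<Sum>l\<le>L. T n m k l)"
    proof (intro sum.cong refl)
      fix n m
      have "G n m (r - real n, s - real m, r', s') = (\<Sum>(k, l)\<in>{..L} \<times> {..L}. T n m k l)"
        unfolding G_def binom_transform_def
      proof (rule sum.mono_neutral_cong_left)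
        show "{kl. E n m (shift2 kl (r - real n, s - real m, r', s')) \<noteq> 0} \<subseteq> {..L} \<times> {..L}"
        proof clarsimp
          fix k l assume nz: "E n m (r - real n - real k, s - real m - real l, r' + real k, s' +
              real l) \<noteq> 0"
          then have "W (r - real (n + k), s - real (m + l)) \<noteq> 0"
            by (auto simp: E_def dual_linear[OF u] algebra_simps)
          then have "\<not> (n + k > L \<or> m + l > L)" using W0 by blast
          then show "k \<le> L \<and> l \<le> L" by simp
        qed
      qed (auto simp: T_def algebra_simps)
      then show "G n m (r - real n, s - real m, r', s') = (\<Sum>k\<le>L. \<Sum>l\<le>L. T n m k l)"
        by (simp add: sum.cartesian_product)
    qed
    also have "\<dots> = (\<Sum>n\<le>L. \<Sum>m\<le>L. \<Sum>k\<le>L. \<Sum>l\<le>L. T n m k l)"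
    proof -
      have "(\<Sum>n\<le>K. \<Sum>m\<le>K. \<Sum>k\<le>L. \<Sum>l\<le>L. T n m k l) = (\<Sum>n\<le>K. \<Sum>m\<le>L. \<Sum>k\<le>L. \<Sum>l\<le>L. T n m k l)"
        by (intro sum.cong refl sum.mono_neutral_left) (auto simp: L_def T0 not_le)
      also have "\<dots> = (\<Sum>n\<le>L. \<Sum>m\<le>L. \<Sum>k\<le>L. \<Sum>l\<le>L. T n m k l)"
        by (intro sum.mono_neutral_left) (auto simp: L_def T0 not_le)
      finally show ?thesis .
    qed
    also have "\<dots> = (\<Sum>n\<le>L. \<Sum>k\<le>L. \<Sum>m\<le>L. \<Sum>l\<le>L. T n m k l)"
      by (intro sum.cong refl sum.swap)
    also have "\<dots> = (\<Sum>i\<le>L. \<Sum>k\<le>i. \<Sum>m\<le>L. \<Sum>l\<le>L. T (i - k) m k l)"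
      by (rule sum_square_eq_sum_triangle) (simp add: T0)
    also have "\<dots> = (\<Sum>i\<le>L. \<Sum>k\<le>i. \<Sum>j\<le>L. \<Sum>l\<le>j. T (i - k) (j - l) k l)"
      by (intro sum.cong refl sum_square_eq_sum_triangle) (simp add: T0)
    also have "\<dots> = (\<Sum>i\<le>L. \<Sum>j\<le>L. \<Sum>k\<le>i. \<Sum>l\<le>j. T (i - k) (j - l) k l)"
      by (intro sum.cong refl sum.swap)
    also have "\<dots> = (\<Sum>i\<le>L. \<Sum>j\<le>L. u (Y a (r', s') (DD i j (W (r - real i, s - real j)))))"
    proof (intro sum.cong refl)
      fix i j
      show "(\<Sum>k\<le>i. \<Sum>l\<le>j. T (i - k) (j - l) k l) =
          u (Y a (r', s') (DD i j (W (r - real i, s - real j))))"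
        unfolding Y_DD dual_linear[OF u] by (intro sum.cong refl) (simp add: T_def E_def)
    qed
    also have "\<dots> = u (Y a (r', s') (exp_translate W (r, s)))"
      using exp_translate_eq[of L W r s, OF W0] by (simp add: Y_sum_right dual_linear[OF u])
    finally show ?thesis .
  qed
  have "(\<lambda>x. \<Sum>n\<le>K. \<Sum>m\<le>K. (\<lambda>(r, s, r', s'). G n m (r - real n, s - real m, r', s')) x) =
      (\<lambda>(r, s, r', s'). u (Y a (r', s') (exp_translate W (r, s))))"
    by (rule ext) (clarsimp simp: coeff)
  then show ?thesis using main by (simp only:)
qed

lemma Y_vac_nat: "Y b (real n, real m) vac = DD n m b"
proof -
  have nz: "complex_of_real (real k + 1) \<noteq> 0" for k
  proof -
    have "real k + 1 \<noteq> 0" by linarith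
    then show ?thesis by (metis of_real_eq_0_iff)
  qed
  have m: "Y b (0, real m) vac = DD 0 m b" for m
  proof (induction m)
    case 0 show ?case by (simp add: DD_def PV3)
  next
    case (Suc m)
    have "smul (complex_of_real (real m + 1)) (Y b (0, real m + 1) vac) = D' (DD 0 m b)"
      using D'_comm[of b 0 "real m" vac] Suc by (simp add: D'_vac)
    also have "\<dots> = smul (complex_of_real (real m + 1)) (DD 0 (Suc m) b)"
    proof -
      have "1 / fact m = (real m + 1) * (1 / (fact (Suc m)) :: real)" by (simp add: add.commute)
      then show ?thesis by (simp add: DD_def lin_D'.scale flip: of_real_mult of_real_add)
    qed
    finally have "Y b (0, real m + 1) vac = DD 0 (Suc m) b"
      by (rule scale_left_imp_eq[OF nz])
    then show ?case by (simp add: add.commute)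
  qed
  show ?thesis
  proof (induction n)
    case 0 show ?case by (simp add: m)
  next
    case (Suc n)
    have "smul (complex_of_real (real n + 1)) (Y b (real n + 1, real m) vac) = D (DD n m b)"
      using D_comm[of b "real n" "real m" vac] Suc by (simp add: D_vac)
    also have "\<dots> = smul (complex_of_real (real n + 1)) (DD (Suc n) m b)"
    proof -
      have "1 / (fact n * fact m) = (real n + 1) * (1 / (fact (Suc n) * fact m) :: real)"
          by (simp add: add.commute)
      then show ?thesis by (simp add: DD_def lin_D.scale flip: of_real_mult of_real_add)
    qed
    finally have "Y b (real n + 1, real m) vac = DD (Suc n) m b"
      by (rule scale_left_imp_eq[OF nz])
    then show ?case by (simp add: add.commute)
  qed
qed

lemma Y_vac_exp_translate: "Y b x vac = exp_translate (\<lambda>x. if x = (0, 0) then b else 0) x"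
proof -
  obtain r s where x: "x = (r, s)" by (cases x)
  show ?thesis
  proof (cases "r \<in> \<nat> \<and> s \<in> \<nat>")
    case True
    then obtain n m where nm: "r = real n" "s = real m" by (auto elim!: Nats_cases)
    have "exp_translate (\<lambda>x. if x = (0, 0) then b else 0) (r, s) =
        (\<Sum>i\<le>n + m. \<Sum>j\<le>n + m. DD i j (if (r - real i, s - real j) = (0, 0) then b else 0))"
      by (rule exp_translate_eq) (auto simp: nm)
    also have "\<dots> = (\<Sum>i\<le>n + m. \<Sum>j\<le>n + m. if j = m then (if i = n then DD n m b else 0) else 0)"
      by (intro sum.cong refl) (auto simp: nm)
    also have "\<dots> = DD n m b" by simp
    finally show ?thesis by (simp add: x nm Y_vac_nat)
  next
    case False
    then have "Y b (r, s) vac = 0" using PV3(1) by blast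
    moreover have "(if (r - real n, s - real m) = (0, 0) then b else 0) = 0" for n m
      using False by (auto simp: Nats_def)
    ultimately show ?thesis by (simp add: x exp_translate_def)
  qed
qed

section \<open>Skew symmetry\<close>

lemma expands2_dual_Y:
  assumes u: "u \<in> dual"
  shows "expands2 (const_series (\<lambda>x. u (Y a x b))) (\<lambda>z w. finite_value (\<lambda>x. u (Y a x b)) w)"
proof (rule expands2_const_series)
  show "finite {x. u (Y a x b) \<noteq> 0}" by (rule finite_dual_Y_support[OF u])
  show "r - s \<in> \<int>" if "u (Y a (r, s) b) \<noteq> 0" for r s
    by (rule Y_integral_support[of a r s b]) (use that in \<open>auto simp: dual_linear[OF u]\<close>)
qed

text \<open>The product applied to the vacuum: \<open>Y(b, z) vac\<close> is the translate of the constant series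
  \<open>b\<close>, and \<open>u (D\<^sup>n D'\<^sup>m Y(a, w) b)\<close> has finitely many terms for reasons of weight.\<close>

lemma expands2_vac:
  assumes u: "u \<in> dual" and K: "\<And>n m v. n > K \<or> m > K \<Longrightarrow> u (DD n m v) = 0"
  shows "expands2 (\<lambda>(r, s, r', s'). u (Y a (r', s') (Y b (r, s) vac)))
      (\<lambda>z w. \<Sum>n\<le>K. \<Sum>m\<le>K. z ^ n * cnj z ^ m * finite_value (\<lambda>x. u (DD n m (Y a x b))) (w - z))"
  unfolding Y_vac_exp_translate
proof (rule expands2_exp_translate[OF u _ K])
  show "r \<ge> 0 \<and> s \<ge> 0" if "(if (r, s) = (0, 0) then b else 0) \<noteq> 0" for r s :: real
    using that by (auto split: if_splits)
  fix n m
  have "(\<lambda>(r, s, r', s'). u (DD n m (Y a (r', s') (if (r, s) = (0, 0) then b else 0)))) =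
      const_series (\<lambda>x. u (DD n m (Y a x b)))"
    by (auto simp: const_series_def fun_eq_iff dual_linear[OF u])
  moreover have "expands2 (const_series (\<lambda>x. u (DD n m (Y a x b)))) (\<lambda>z w. finite_value
      (\<lambda>x. u (DD n m (Y a x b))) w)"
    using expands2_dual_Y[OF dual_compose_DD[OF u], of n m a b] by simp
  ultimately show "expands2 (\<lambda>(r, s, r', s'). u (DD n m (Y a (r', s') (if (r, s) =
      (0, 0) then b else 0))))
      (\<lambda>z w. finite_value (\<lambda>x. u (DD n m (Y a x b))) w)" by simp
qed

lemma full_localityD:
  assumes "full_locality smul F Y" "u \<in> dual"
  shows "\<exists>\<mu>\<in>GCor2. has_expansion_12 \<mu> (\<lambda>(r1, s1, r2, s2). u (Y a1 (r1, s1) (Y a2 (r2, s2) a3))) \<and>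
      has_expansion_21 \<mu> (\<lambda>(r1, s1, r2, s2). u (Y a2 (r2, s2) (Y a1 (r1, s1) a3)))"
  using assms unfolding full_locality_def by blast

lemma DD_0_0 [simp]: "DD 0 0 v = v"
  by (simp add: DD_def)

lemma DD_scale: "DD n m (smul c v) = smul c (DD n m v)"
proof -
  interpret l: Vector_Spaces.linear smul smul "DD n m" by (rule linear_DD)
  show ?thesis by (rule l.scale)
qed

text \<open>\<open>reflected W\<close> is the series \<open>W(- z)\<close>.\<close>

definition reflected :: "'v rseries \<Rightarrow> 'v rseries" where
  "reflected W = (\<lambda>(r, s). smul ((- 1) powi \<lfloor>r - s\<rfloor>) (W (r, s)))"

lemma reflected_lower_truncated: "\<exists>N. \<forall>r s. reflected (\<lambda>x. Y a x b) (r, s) \<noteq> 0 \<longrightarrow> r \<ge> N \<and> s \<ge> N"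
  using Y_lower_truncated[of a b] by (auto simp: reflected_def)

lemma dual_exp_translate_reflected:
  assumes u: "u \<in> dual" and K: "\<And>n m v. n > K \<or> m > K \<Longrightarrow> u (DD n m v) = 0"
  shows "u (exp_translate (reflected (\<lambda>x. Y a x b)) (r, s)) = (\<Sum>n\<le>K. \<Sum>m\<le>K.
      (- 1) powi \<lfloor>(r - real n) - (s - real m)\<rfloor> * u (DD n m (Y a (r - real n, s - real m) b)))"
proof -
  obtain N where N: "\<And>r s. reflected (\<lambda>x. Y a x b) (r, s) \<noteq> 0 \<Longrightarrow> r \<ge> N \<and> s \<ge> N"
    using reflected_lower_truncated by blast
  have "u (DD n m (reflected (\<lambda>x. Y a x b) (r - real n, s - real m))) =
      (- 1) powi \<lfloor>(r - real n) - (s - real m)\<rfloor> * u (DD n m (Y a (r - real n, s - real m) b))"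
          for n m
    by (simp only: reflected_def prod.case DD_scale dual_linear[OF u])
  then show ?thesis
    using dual_exp_translate[OF u, of "reflected (\<lambda>x. Y a x b)" N K r s, OF N K] by simp
qed

text \<open>\<open>u (Y(b, z) a) = u (exp(z D + zbar D') Y(a, - z) b)\<close>, coefficientwise.\<close>

lemma skew_symmetry:
  assumes FL: "full_locality smul F Y" and bdd: "spectrum_bounded_below F" and u: "u \<in> dual"
  shows "u (Y b (r, s) a) = u (exp_translate (reflected (\<lambda>x. Y a x b)) (r, s))"
proof -
  obtain K where K: "\<And>n m v. n > K \<or> m > K \<Longrightarrow> u (DD n m v) = 0"
    using DD_eventually_zero[OF u bdd] by blast
  define P where "P = (\<lambda>n m. finite_value (\<lambda>x. u (DD n m (Y a x b))))"
  define Q where "Q = (\<lambda>n m. finite_value (\<lambda>x. u (DD n m (Y b x a))))"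
  \<comment> \<open>\<open>u (Y(a, w) Y(b, z) vac)\<close> converges to \<open>S w z\<close>, and \<open>u (Y(b, w) Y(a, z) vac)\<close> to \<open>T w z\<close>.\<close>
  define S where "S = (\<lambda>w z. \<Sum>n\<le>K. \<Sum>m\<le>K. z ^ n * cnj z ^ m * P n m (w - z))"
  define T where "T = (\<lambda>w z. \<Sum>n\<le>K. \<Sum>m\<le>K. z ^ n * cnj z ^ m * Q n m (w - z))"
  obtain \<mu> where
    12: "has_expansion_12 \<mu> (\<lambda>(r1, s1, r2, s2). u (Y a (r1, s1) (Y b (r2, s2) vac)))" and
    21: "has_expansion_21 \<mu> (\<lambda>(r1, s1, r2, s2). u (Y b (r2, s2) (Y a (r1, s1) vac)))"
    using full_localityD[OF FL u] by blast
  have "expands2 (\<lambda>(r, s, r', s'). u (Y a (r', s') (Y b (r, s) vac))) (\<lambda>z w. \<mu> (w, z))"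
    using has_expansion_12_imp_expands2[OF 12] by simp
  moreover have "expands2 (\<lambda>(r, s, r', s'). u (Y a (r', s') (Y b (r, s) vac))) (\<lambda>z w. S w z)"
    using expands2_vac[OF u K] by (simp add: S_def P_def)
  ultimately obtain R where R: "R > 0" "\<And>z w. z \<noteq> 0 \<Longrightarrow> norm z < R * norm w \<Longrightarrow> \<mu> (w, z) = S w z"
    using expands2_value_unique by blast
  have an: "curve_analytic S" unfolding curve_analytic_def
  proof (intro allI impI)
    fix \<gamma> \<delta> t assume c: "param_analytic \<gamma> t" "param_analytic \<delta> t" "(\<gamma> t, \<delta> t) \<in> Y2"
    show "param_analytic (\<lambda>s. S (\<gamma> s) (\<delta> s)) t"
      unfolding S_def P_def
      by (intro param_analytic_sum param_analytic_mult param_analytic_power param_analytic_cnj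
          param_analytic_finite_value param_analytic_diff c) (use c(3) in \<open>auto simp: Y2_def\<close>)
  qed
  have \<mu>S: "\<mu> (w, z) = S w z" if "(w, z) \<in> Y2" for w z
    by (rule curve_analytic_identity[OF has_expansion_12_imp_curve_analytic[OF 12] an R that])
  have "expands2 (\<lambda>(r, s, r', s'). u (Y b (r', s') (Y a (r, s) vac))) (\<lambda>z w. \<mu> (z, w))"
    using has_expansion_21_imp_expands2[OF 21] by simp
  moreover have "expands2 (\<lambda>(r, s, r', s'). u (Y b (r', s') (Y a (r, s) vac))) (\<lambda>z w. T w z)"
    using expands2_vac[OF u K] by (simp add: T_def Q_def)
  ultimately obtain R' where R': "R' > 0" "\<And>z w. z \<noteq> 0 \<Longrightarrow> norm z < R' * norm w \<Longrightarrow> \<mu> (z, w) = T w z"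
    using expands2_value_unique by blast
  \<comment> \<open>Both sums are continuous at \<open>z = 0\<close>, where only the term \<open>n = m = 0\<close> of \<open>T\<close> survives.\<close>
  have PQ: "(\<Sum>n\<le>K. \<Sum>m\<le>K. w ^ n * cnj w ^ m * P n m (- w)) = Q 0 0 w" if w: "w \<noteq> 0" for w
  proof -
    have ev: "\<forall>\<^sub>F z in at 0. S z w = T w z"
    proof -
      have "\<forall>\<^sub>F z in at 0. dist z 0 < min R' 1 * norm w"
        by (rule tendstoD[OF tendsto_ident_at]) (use R' w in auto)
      moreover have "\<forall>\<^sub>F z in at 0. z \<noteq> (0 :: complex)" by (rule eventually_neq_at_within)
      ultimately show ?thesis
      proof eventually_elim
        case (elim z)
        have "min R' 1 * norm w \<le> R' * norm w" "min R' 1 * norm w \<le> 1 * norm w"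
          by (intro mult_right_mono; simp)+
        then have "norm z < R' * norm w" "norm z < 1 * norm w" using elim(1) by auto
        then show ?case
          using R'(2)[OF elim(2)] \<mu>S[of z w] norm_less_imp_Y2[OF elim(2)] elim(2)
              by (auto simp: Y2_def)
      qed
    qed
    have "isCont (\<lambda>z. S z w) 0" unfolding S_def P_def
      by (intro continuous_intros isCont_o2[OF _ isCont_finite_value]) (use w in auto)
    then have lim1: "((\<lambda>z. S z w) \<longlongrightarrow> S 0 w) (at 0)" by (simp add: isCont_def)
    have "isCont (\<lambda>z. T w z) 0" unfolding T_def Q_def
      by (intro continuous_intros isCont_o2[OF _ isCont_finite_value]) (use w in auto)
    then have "((\<lambda>z. T w z) \<longlongrightarrow> T w 0) (at 0)" by (simp add: isCont_def)
    then have "S 0 w = T w 0"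
      using tendsto_unique[OF _ lim1] tendsto_cong[OF ev] by auto
    moreover have "T w 0 = Q 0 0 w"
    proof -
      have "T w 0 = (\<Sum>n\<le>K. \<Sum>m\<le>K. if m = 0 then (if n = 0 then Q 0 0 w else 0) else 0)"
        unfolding T_def by (intro sum.cong refl) (auto simp: power_0_left)
      then show ?thesis by simp
    qed
    ultimately show ?thesis by (simp add: S_def)
  qed
  have cs: "expands2 (const_series (\<lambda>x. u (DD n m (Y a x b)))) (\<lambda>z w. P n m w)" for n m
    using expands2_dual_Y[OF dual_compose_DD[OF u], of n m a b] by (simp add: P_def)
  have "const_series (\<lambda>x. u (Y b x a)) = (\<lambda>x. \<Sum>n\<le>K. \<Sum>m\<le>K. (\<lambda>(r, s, r', s').
      (\<lambda>(r, s, r', s'). (- 1) powi \<lfloor>r' - s'\<rfloor> * const_series (\<lambda>x. u (DD n m (Y a x b)))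
          (r, s, r', s'))
      (r, s, r' - real n, s' - real m)) x)"
  proof (rule expands2_const_series_unique)
    show "expands2 (const_series (\<lambda>x. u (Y b x a))) (\<lambda>z w. Q 0 0 w)"
      using expands2_dual_Y[OF u, of b a] by (simp add: Q_def)
    show "expands2 (\<lambda>x. \<Sum>n\<le>K. \<Sum>m\<le>K. (\<lambda>(r, s, r', s').
      (\<lambda>(r, s, r', s'). (- 1) powi \<lfloor>r' - s'\<rfloor> * const_series (\<lambda>x. u (DD n m (Y a x b)))
          (r, s, r', s'))
      (r, s, r' - real n, s' - real m)) x) (\<lambda>z w. \<Sum>n\<le>K. \<Sum>m\<le>K. w ^ n * cnj w ^ m * P n m (- w))"
      by (intro expands2_sum expands2_shift_big[OF expands2_reflect_big[OF cs]])
  qed (simp add: PQ)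
  from fun_cong[OF this, of "(0, 0, r, s)"]
  have "u (Y b (r, s) a) = (\<Sum>n\<le>K. \<Sum>m\<le>K.
      (- 1) powi \<lfloor>(r - real n) - (s - real m)\<rfloor> * u (DD n m (Y a (r - real n, s - real m) b)))"
    by (simp add: const_series_def)
  also have "\<dots> = u (exp_translate (reflected (\<lambda>x. Y a x b)) (r, s))"
    by (rule dual_exp_translate_reflected[OF u K, symmetric])
  finally show ?thesis .
qed

section \<open>Associativity\<close>

lemma associativity:
  assumes FL: "full_locality smul F Y" and bdd: "spectrum_bounded_below F" and u: "u \<in> dual"
  shows "\<exists>\<mu>\<in>GCor2.
        has_expansion_12 \<mu> (\<lambda>(r1, s1, r2, s2). u (Y a (r1, s1) (Y b (r2, s2) c))) \<and>
        has_expansion_0 \<mu> (\<lambda>(r0, s0, r2, s2). u (Y (Y a (r0, s0) b) (r2, s2) c)) \<and>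
        has_expansion_21 \<mu> (\<lambda>(r1, s1, r2, s2). u (Y b (r2, s2) (Y a (r1, s1) c)))"
proof -
  obtain K where K: "\<And>n m v. n > K \<or> m > K \<Longrightarrow> u (DD n m v) = 0"
    using DD_eventually_zero[OF u bdd] by blast
  obtain \<mu> where \<mu>: "\<mu> \<in> GCor2" and
    12: "has_expansion_12 \<mu> (\<lambda>(r1, s1, r2, s2). u (Y a (r1, s1) (Y b (r2, s2) c)))" and
    21: "has_expansion_21 \<mu> (\<lambda>(r1, s1, r2, s2). u (Y b (r2, s2) (Y a (r1, s1) c)))"
    using full_localityD[OF FL u] by blast
  have "\<exists>\<nu>. has_expansion_12 \<nu> (\<lambda>(r1, s1, r2, s2). u (DD n m (Y a (r1, s1) (Y c (r2, s2) b)))) \<and>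
      has_expansion_21 \<nu> (\<lambda>(r1, s1, r2, s2). u (DD n m (Y c (r2, s2) (Y a (r1, s1) b))))" for n m
    using full_localityD[OF FL dual_compose_DD[OF u], of n m a c b] by auto
  then obtain \<nu> where
    \<nu>12: "\<And>n m. has_expansion_12 (\<nu> n m) (\<lambda>(r1, s1, r2, s2). u
        (DD n m (Y a (r1, s1) (Y c (r2, s2) b))))" and
    \<nu>21: "\<And>n m. has_expansion_21 (\<nu> n m) (\<lambda>(r1, s1, r2, s2). u
        (DD n m (Y c (r2, s2) (Y a (r1, s1) b))))"
    by metis
  define S where "S = (\<lambda>w z. \<Sum>n\<le>K. \<Sum>m\<le>K. z ^ n * cnj z ^ m * \<nu> n m (w - z, - z))"
  define W where "W = reflected (\<lambda>x. Y c x b)"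
  obtain N where N: "\<And>r s. W (r, s) \<noteq> 0 \<Longrightarrow> r \<ge> N \<and> s \<ge> N"
    using reflected_lower_truncated unfolding W_def by blast
  have "expands2 (\<lambda>(r, s, r', s'). u (Y a (r', s') (exp_translate W (r, s)))) (\<lambda>z w. S w z)"
    unfolding S_def
  proof (rule expands2_exp_translate[OF u N K])
    fix n m
    have "expands2 (\<lambda>(r, s, r', s'). u (DD n m (Y a (r', s') (Y c (r, s) b)))) (\<lambda>z w. \<nu> n m (w, z))"
      using has_expansion_12_imp_expands2[OF \<nu>12[of n m]] by simp
    from expands2_reflect_small[OF this]
    show "expands2 (\<lambda>(r, s, r', s'). u (DD n m (Y a (r', s') (W (r, s))))) (\<lambda>z w. \<nu> n m (w, - z))"
      by (simp add: W_def reflected_def Y_scale_right DD_scale dual_linear[OF u])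
  qed
  \<comment> \<open>Skew symmetry inside the product, for the functional \<open>u \<circ> Y a x\<close> of the restricted dual.\<close>
  moreover have "u (Y a x (exp_translate W (r, s))) = u (Y a x (Y b (r, s) c))" for x r s
    using skew_symmetry[OF FL bdd dual_compose_Y[OF u, of a x], of b r s c] by (simp add: W_def)
  ultimately have "expands2 (\<lambda>(r, s, r', s'). u (Y a (r', s') (Y b (r, s) c))) (\<lambda>z w. S w z)"
      by simp
  moreover have "expands2 (\<lambda>(r, s, r', s'). u (Y a (r', s') (Y b (r, s) c))) (\<lambda>z w. \<mu> (w, z))"
    using has_expansion_12_imp_expands2[OF 12] by simp
  ultimately obtain R where R: "R > 0" "\<And>z w. z \<noteq> 0 \<Longrightarrow> norm z < R * norm w \<Longrightarrow> S w z = \<mu> (w, z)"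
    using expands2_value_unique by blast
  have an: "curve_analytic S" unfolding curve_analytic_def
  proof (intro allI impI)
    fix \<gamma> \<delta> t assume g: "param_analytic \<gamma> t" "param_analytic \<delta> t" "(\<gamma> t, \<delta> t) \<in> Y2"
    show "param_analytic (\<lambda>s. S (\<gamma> s) (\<delta> s)) t"
      unfolding S_def
      by (intro param_analytic_sum param_analytic_mult param_analytic_power param_analytic_cnj g
          curve_analyticD[OF has_expansion_12_imp_curve_analytic[OF \<nu>12]] param_analytic_diff
          param_analytic_minus) (use g(3) in \<open>auto simp: Y2_def\<close>)
  qed
  have S\<mu>: "S w z = \<mu> (w, z)" if "(w, z) \<in> Y2" for w z
    by (rule curve_analytic_identity[OF an has_expansion_12_imp_curve_analytic[OF 12] R that])
  \<comment> \<open>Skew symmetry of the outer product \<open>Y(Y(a, z) b, w) c\<close>.\<close>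
  have iterate: "expands2 (\<lambda>(r0, s0, r2, s2). u (Y (Y a (r0, s0) b) (r2, s2) c))
      (\<lambda>z w. S (w + z) w)"
  proof -
    have "expands2 (\<lambda>(r0, s0, r2, s2). u (DD n m (Y c (r2, s2) (Y a (r0, s0) b))))
        (\<lambda>z w. \<nu> n m (z, w))" for n m
      using has_expansion_21_imp_expands2[OF \<nu>21[of n m]] by simp
    note expands2_shift_big[OF expands2_reflect_big[OF this]]
    then have "expands2 (\<lambda>x. \<Sum>n\<le>K. \<Sum>m\<le>K. (\<lambda>(r0, s0, r2, s2).
        (\<lambda>(r0, s0, r2, s2). (- 1) powi \<lfloor>r2 - s2\<rfloor> *
            (\<lambda>(r0, s0, r2, s2). u (DD n m (Y c (r2, s2) (Y a (r0, s0) b)))) (r0, s0, r2, s2))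
          (r0, s0, r2 - real n, s2 - real m)) x)
        (\<lambda>z w. \<Sum>n\<le>K. \<Sum>m\<le>K. w ^ n * cnj w ^ m * \<nu> n m (z, - w))"
      by (intro expands2_sum)
    moreover have "(\<lambda>x. \<Sum>n\<le>K. \<Sum>m\<le>K. (\<lambda>(r0, s0, r2, s2).
        (\<lambda>(r0, s0, r2, s2). (- 1) powi \<lfloor>r2 - s2\<rfloor> *
            (\<lambda>(r0, s0, r2, s2). u (DD n m (Y c (r2, s2) (Y a (r0, s0) b)))) (r0, s0, r2, s2))
          (r0, s0, r2 - real n, s2 - real m)) x) =
        (\<lambda>(r0, s0, r2, s2). u (Y (Y a (r0, s0) b) (r2, s2) c))"
      by (rule ext) (clarsimp simp: skew_symmetry[OF FL bdd u, of "Y a _ b"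
          _ _ c] dual_exp_translate_reflected[OF u K])
    ultimately show ?thesis by (simp add: S_def)
  qed
  obtain E where E: "has_expansion_0 \<mu> E" using has_expansion_0_exists[OF 12] by blast
  have "E = (\<lambda>(r0, s0, r2, s2). u (Y (Y a (r0, s0) b) (r2, s2) c))"
  proof (rule expands2_unique[OF has_expansion_0_imp_expands2[OF E] iterate zero_less_one])
    fix z w :: complex assume zw: "z \<noteq> 0" "norm z < 1 * norm w"
    then show "\<mu> (w + z, w) = S (w + z) w"
      using S\<mu>[of "w + z" w] norm_less_imp_Y2[OF zw] by (simp add: Y2_def)
  qed
  then show ?thesis using \<mu> 12 21 E by blast
qed

end

theorem proposition4p1:
  fixes smul :: "complex \<Rightarrow> 'v::ab_group_add \<Rightarrow> 'v"
    and F :: "real \<Rightarrow> real \<Rightarrow> 'v set"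
    and Y :: "'v \<Rightarrow> ('v \<Rightarrow> 'v) rseries"
    and vac :: 'v
    and D D' :: "'v \<Rightarrow> 'v"
  assumes "translation_covariant_full_prevertex_algebra smul F Y vac D D'"
    and "full_locality smul F Y"
    and "spectrum_bounded_below F"
  shows "full_vertex_algebra smul F Y vac"
proof -
  interpret translation_covariant_full_prevertex_algebra smul F Y vac D D' by (rule assms(1))
  show ?thesis
    by unfold_locales (rule associativity[OF assms(2,3)])
qed

end
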